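(* Let $(L|K,v)$ be a finite uv--extension of valued fields, let $p$ be the characteristic exponent of $Kv$, and write $d(L|K,v)=p^m$ with $m\geq 0$. Then $$\mathrm{ndd}(L|K,v)\leq m\cdot \frac{[L:K]!}{p^m}\quad\text{ and }\quad \mathrm{ndd}^*(L|K,v)\leq m.$$ If in addition $L|K$ is a normal extension, then $\mathrm{ndd}(L|K,v)\leq m\cdot (vL:vK)$.
   Context: Valuations are written additively; $vK$ is the value group, $Kv$ the residue field, $\widetilde{vK}$ the divisible hull of $vK$. An extension of $v$ from $K$ to its algebraic closure $\tilde K$ is fixed. The characteristic exponent of $Kv$ is $p=\mathrm{char}\,Kv$ if this is positive, and $p=1$ otherwise. An algebraic extension $(L|K,v)$ is a uv--extension if the extension of $v$ from $K$ to $L$ is unique. For a finite uv--extension, its defect is $d(L|K,v)=\frac{[L:K]}{(vL:vK)[Lv:Kv]}$, which is a power of $p$. For $a\in L$, put $v(a-K)=\{v(a-c)\mid c\in K\}$. The distance $\mathrm{dist}(a,K)$ is the cut in $\widetilde{vK}$ whose lower cut set is the smallest initial segment of $\widetilde{vK}$ containing $v(a-K)\cap\widetilde{vK}$. The cut $\alpha+\mathrm{dist}(a,K)$ is obtained by adding $\alpha$ to all elements of the lower cut set. Two distances are equal modulo $vK$ (resp. modulo $\widetilde{vK}$) if one is obtained from the other by adding some $\alpha\in vK$ (resp. $\alpha\in\widetilde{vK}$). An element $a$ is weakly immediate over $K$ if $v(a-K)$ has no maximal element. $\mathrm{ndd}(L|K,v)$ (resp. $\mathrm{ndd}^*(L|K,v)$)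 is the number of distances $\mathrm{dist}(a,K)$, with $a\in L\setminus K$ weakly immediate over $K$, that are distinct modulo $vK$ (resp. modulo $\widetilde{vK}$); i.e. $\mathrm{ndd}(L|K,v)$ is the minimal $n\ge 0$ such that there are $a_1,\ldots,a_n\in L\setminus K$ weakly immediate over $K$ such that for every $b\in L\setminus K$ weakly immediate over $K$ there are $i\in\{1,\ldots,n\}$ and $\alpha\in vK$ with $\mathrm{dist}(b,K)=\alpha+\mathrm{dist}(a_i,K)$; it is $0$ if there is no such $b$. *)

theory Defs
  imports "HOL-Algebra.Algebraic_Closure_Type" "HOL-Library.Extended_Real"
begin

text \<open>
  All fields are subfields (as sets) of one algebraically closed field, given by a type
  \<open>'a\<close>; the following record is that field in the sense of \<open>HOL-Algebra\<close>.
\<close>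

abbreviation ambient :: "'a::field ring" where
  "ambient \<equiv> ring_of_type_algebra"

section \<open>Valuations\<close>

text \<open>
  Krull valuations, written additively, with values in an arbitrary ordered abelian group.
  The value \<open>v 0 = \<infinity>\<close> is not represented: \<open>v\<close> is only ever evaluated at nonzero
  elements and every definition treats \<open>0\<close> separately.
\<close>

definition valuation_on :: "'a::field set \<Rightarrow> ('a \<Rightarrow> 'g::linordered_ab_group_add) \<Rightarrow> bool" where
  "valuation_on F v \<longleftrightarrow>
     (\<forall>x\<in>F - {0}. \<forall>y\<in>F - {0}. v (x * y) = v x + v y) \<and>
     (\<forall>x\<in>F - {0}. \<forall>y\<in>F - {0}. x + y \<noteq> 0 \<longrightarrow> min (v x) (v y) \<le> v (x + y))"

definition value_group :: "('a::field \<Rightarrow> 'g::linordered_ab_group_add) \<Rightarrow> 'a set \<Rightarrow> 'g set" where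
  "value_group v F = v ` (F - {0})"

text \<open>
  The divisible hull of \<open>vF\<close>, formed inside the type of values. If \<open>v\<close> is a valuation of the
  whole algebraically closed type, then the values contain a divisible group
  containing \<open>vF\<close>, and as the type is torsion-free the set below is the divisible hull.
\<close>

definition divisible_hull :: "('a::field \<Rightarrow> 'g::linordered_ab_group_add) \<Rightarrow> 'a set \<Rightarrow> 'g set" where
  "divisible_hull v F = {g. \<exists>n>0. (\<Sum>i<(n::nat). g) \<in> value_group v F}"

definition valuation_ring :: "('a::field \<Rightarrow> 'g::linordered_ab_group_add) \<Rightarrow> 'a set \<Rightarrow> 'a set" where
  "valuation_ring v F = {x \<in> F. x = 0 \<or> 0 \<le> v x}"

definition valuation_ideal :: "('a::field \<Rightarrow> 'g::linordered_ab_group_add) \<Rightarrow> 'a set \<Rightarrow> 'a set" where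
  "valuation_ideal v F = {x \<in> F. x = 0 \<or> 0 < v x}"

definition residue_field :: "('a::field \<Rightarrow> 'g::linordered_ab_group_add) \<Rightarrow> 'a set \<Rightarrow> 'a set ring" where
  "residue_field v F = (ambient\<lparr>carrier := valuation_ring v F\<rparr>) Quot (valuation_ideal v F)"

text \<open>The canonical image of \<open>Kv\<close> in \<open>Lv\<close>.\<close>

definition residue_subfield ::
    "('a::field \<Rightarrow> 'g::linordered_ab_group_add) \<Rightarrow> 'a set \<Rightarrow> 'a set \<Rightarrow> 'a set set" where
  "residue_subfield v K L =
     (\<lambda>x. valuation_ideal v L +>\<^bsub>ambient\<lparr>carrier := valuation_ring v L\<rparr>\<^esub> x) ` valuation_ring v K"

definition ring_characteristic :: "('b, 'c) ring_scheme \<Rightarrow> nat" where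
  "ring_characteristic R =
     (if \<exists>n>0. add_pow R (n::nat) \<one>\<^bsub>R\<^esub> = \<zero>\<^bsub>R\<^esub>
      then LEAST n. n > 0 \<and> add_pow R n \<one>\<^bsub>R\<^esub> = \<zero>\<^bsub>R\<^esub> else 0)"

definition characteristic_exponent :: "('b, 'c) ring_scheme \<Rightarrow> nat" where
  "characteristic_exponent R =
     (if ring_characteristic R > 0 then ring_characteristic R else 1)"

section \<open>Extensions\<close>

definition field_degree :: "'a::field set \<Rightarrow> 'a set \<Rightarrow> nat" where
  "field_degree K L = (ring.dim ambient over K) L"

definition ramification_index ::
    "('a::field \<Rightarrow> 'g::linordered_ab_group_add) \<Rightarrow> 'a set \<Rightarrow> 'a set \<Rightarrow> nat" where
  "ramification_index v K L = card ((\<lambda>g. (+) g ` value_group v K) ` value_group v L)"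

definition residue_degree ::
    "('a::field \<Rightarrow> 'g::linordered_ab_group_add) \<Rightarrow> 'a set \<Rightarrow> 'a set \<Rightarrow> nat" where
  "residue_degree v K L =
     (ring.dim (residue_field v L) over residue_subfield v K L) (carrier (residue_field v L))"

definition defect :: "('a::field \<Rightarrow> 'g::linordered_ab_group_add) \<Rightarrow> 'a set \<Rightarrow> 'a set \<Rightarrow> real" where
  "defect v K L =
     real (field_degree K L) / (real (ramification_index v K L) * real (residue_degree v K L))"

text \<open>
  It suffices to let \<open>w\<close> range over valuations with values in the type \<open>'g\<close>: the value group
  of any extension of \<open>v\<close> to an algebraic extension \<open>L\<close> of \<open>K\<close> embeds over \<open>vK\<close> into the divisible
  hull of \<open>vK\<close>, and two such extensions with values in \<open>'g\<close> are equivalent over \<open>vK\<close>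
  only if they are equal.
\<close>

definition unique_extension ::
    "('a::field \<Rightarrow> 'g::linordered_ab_group_add) \<Rightarrow> 'a set \<Rightarrow> 'a set \<Rightarrow> bool" where
  "unique_extension v K L \<longleftrightarrow>
     (\<forall>w :: 'a \<Rightarrow> 'g. valuation_on L w \<and> (\<forall>x\<in>K - {0}. w x = v x) \<longrightarrow> (\<forall>x\<in>L - {0}. w x = v x))"

definition normal_extension :: "'a::field set \<Rightarrow> 'a set \<Rightarrow> bool" where
  "normal_extension K L \<longleftrightarrow>
     (\<forall>x\<in>L. (ring.algebraic ambient over K) x) \<and>
     (\<forall>f\<in>carrier (K[X]\<^bsub>ambient\<^esub>). pirreducible\<^bsub>ambient\<^esub> K f \<longrightarrow>
        (\<exists>a\<in>L. ring.eval ambient f a = 0) \<longrightarrow> ring.splitted (ambient\<lparr>carrier := L\<rparr>) f)"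

section \<open>Distances\<close>

text \<open>Only used for \<open>a \<notin> K\<close>, so that no value is infinite.\<close>

definition difference_values ::
    "('a::field \<Rightarrow> 'g::linordered_ab_group_add) \<Rightarrow> 'a set \<Rightarrow> 'a \<Rightarrow> 'g set" where
  "difference_values v K a = {v (a - c) | c. c \<in> K}"

text \<open>For \<open>a \<in> K\<close> the maximum is \<open>v (a - a) = \<infinity>\<close>, hence the first conjunct.\<close>

definition weakly_immediate ::
    "('a::field \<Rightarrow> 'g::linordered_ab_group_add) \<Rightarrow> 'a set \<Rightarrow> 'a \<Rightarrow> bool" where
  "weakly_immediate v K a \<longleftrightarrow>
     a \<notin> K \<and> \<not> (\<exists>g\<in>difference_values v K a. \<forall>h\<in>difference_values v K a. h \<le> g)"

definition initial_segment :: "'g::linorder set \<Rightarrow> 'g set \<Rightarrow> bool" where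
  "initial_segment H S \<longleftrightarrow> S \<subseteq> H \<and> (\<forall>x\<in>S. \<forall>y\<in>H. y \<le> x \<longrightarrow> y \<in> S)"

text \<open>Cuts in the divisible hull are represented by their lower cut sets.\<close>

definition distance ::
    "('a::field \<Rightarrow> 'g::linordered_ab_group_add) \<Rightarrow> 'a set \<Rightarrow> 'a \<Rightarrow> 'g set" where
  "distance v K a =
     \<Inter> {S. initial_segment (divisible_hull v K) S \<and>
         difference_values v K a \<inter> divisible_hull v K \<subseteq> S}"

definition shift_cut :: "'g::linordered_ab_group_add \<Rightarrow> 'g set \<Rightarrow> 'g set" where
  "shift_cut \<alpha> S = (+) \<alpha> ` S"

text \<open>The minimal number is \<open>\<infinity>\<close> if no finite number suffices.\<close>

definition num_distances ::
    "'g::linordered_ab_group_add set \<Rightarrow> ('a::field \<Rightarrow> 'g) \<Rightarrow> 'a set \<Rightarrow> 'a set \<Rightarrow> enat" where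
  "num_distances G v K L =
     Inf {enat n | n. \<exists>a :: nat \<Rightarrow> 'a.
        (\<forall>i\<in>{1..n}. a i \<in> L - K \<and> weakly_immediate v K (a i)) \<and>
        (\<forall>b\<in>L - K. weakly_immediate v K b \<longrightarrow>
           (\<exists>i\<in>{1..n}. \<exists>\<alpha>\<in>G. distance v K b = shift_cut \<alpha> (distance v K (a i))))}"

definition ndd :: "('a::field \<Rightarrow> 'g::linordered_ab_group_add) \<Rightarrow> 'a set \<Rightarrow> 'a set \<Rightarrow> enat" where
  "ndd v K L = num_distances (value_group v K) v K L"

definition ndd_star :: "('a::field \<Rightarrow> 'g::linordered_ab_group_add) \<Rightarrow> 'a set \<Rightarrow> 'a set \<Rightarrow> enat" where
  "ndd_star v K L = num_distances (divisible_hull v K) v K L"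

end

theory Submission
  imports Defs
begin

text \<open>
  Call a \<open>K\<close>-subspace \<open>W\<close> of \<open>L\<close> containing \<open>K\<close> immediate if all elements of \<open>W - K\<close> are weakly immediate.
  Multiplying a basis of \<open>W\<close> by representatives of \<open>vL/vK\<close> and by lifts of a basis of \<open>Lv|Kv\<close> gives
  independent elements, so \<open>dim W \<le> d(L|K,v) = p\<^sup>m\<close>. On the other hand, given \<open>n\<close> weakly immediate elements with
  distances distinct modulo \<open>vK\<close>, suitably ordered, the monomials in them with exponents below \<open>p\<close> span an
  immediate space of dimension \<open>p\<^sup>n\<close>. This is shown by adjoining one element \<open>a\<close> at a time: a polynomial \<open>f\<close> of
  degree below \<open>p\<close> over \<open>W\<close> is, near \<open>a\<close>, dominated by its constant Taylor term.
  If this fails, then Newton steps \<open>c - f(c)/e\<close>, which stay in \<open>W\<close>, show that the distance of \<open>a\<close> is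
  a translate of a convex subgroup \<open>H\<close>; modulo \<open>H\<close> the coefficients of \<open>f\<close> lie in \<open>K\<close>, and \<open>a\<close> is a simple zero
  of \<open>f\<close> although all its conjugates over \<open>K\<close> coincide with it. Uniqueness of the extension of \<open>v\<close> enters
  only through this last fact.
\<close>

section \<open>Polynomials with coefficients in a subset of a field\<close>

text \<open>The difficulty is that \<open>W\<close> is only a vector space: there is no minimal
  polynomial of \<open>a\<close> over \<open>W\<close>, and products of coefficients leave
  \<open>W\<close>. Induction on the degree takes its place. The Taylor coefficients at
  \<open>a\<close> of the derivative of \<open>f\<close> are those of \<open>f\<close> times
  positive integers below \<open>p\<close>, and these integers are units; so dominance for the
  derivative controls all terms of \<open>f\<close> of order two and more, and only the constant and
  the linear term remain to be compared. This is where the degree bound \<open>p\<close> comes from.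
  \<open>K\<close> need not be henselian, so Newton steps need not converge. A single step suffices:
  it improves an approximation by a fixed amount, and as \<open>W\<close> never comes as close to
  \<open>a\<close> as \<open>K\<close> does, the cut of \<open>a\<close> is stable under translation
  by this amount. The order of the elements matters because coefficients in \<open>W\<close> have to
  be replaced by elements of \<open>K\<close> with an error beyond a whole coset of
  \<open>H\<close>. This fails for an element of \<open>W\<close> whose cut has a largest element
  modulo \<open>H\<close>. Comparing \<open>p^n\<close> with \<open>p^m\<close> gives
  \<open>ndd v K L \<le> enat m\<close>, from which all three bounds follow.\<close>

definition coeffs_in :: "'a::zero set \<Rightarrow> 'a poly \<Rightarrow> bool" where
  "coeffs_in S p \<longleftrightarrow> (\<forall>i. Polynomial.coeff p i \<in> S)"

locale field_subring =
  fixes R :: "'a::field set"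
  assumes zero_mem [simp]: "0 \<in> R"
    and one_mem [simp]: "1 \<in> R"
    and add_mem: "x \<in> R \<Longrightarrow> y \<in> R \<Longrightarrow> x + y \<in> R"
    and uminus_mem: "x \<in> R \<Longrightarrow> - x \<in> R"
    and mult_mem: "x \<in> R \<Longrightarrow> y \<in> R \<Longrightarrow> x * y \<in> R"

locale field_subfield = field_subring R for R :: "'a::field set" +
  assumes inverse_mem: "x \<in> R \<Longrightarrow> inverse x \<in> R"

text \<open>The same closure rules for polynomials are needed over a subfield, an immediate space, a
  valuation ring and its maximal ideal; each of them is an instance, a ring being a module over
  itself.\<close>

locale field_submodule = field_subring R for R :: "'a::field set" +
  fixes W :: "'a set"
  assumes W_zero [simp]: "0 \<in> W"
    and W_add: "x \<in> W \<Longrightarrow> y \<in> W \<Longrightarrow> x + y \<in> W"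
    and W_scale: "r \<in> R \<Longrightarrow> x \<in> W \<Longrightarrow> r * x \<in> W"
begin

lemma W_uminus: "x \<in> W \<Longrightarrow> - x \<in> W"
  using W_scale[of "- 1" x] uminus_mem[of 1] by simp

lemma W_diff: "x \<in> W \<Longrightarrow> y \<in> W \<Longrightarrow> x - y \<in> W"
  using W_add[of x "- y"] W_uminus by simp

lemma W_scale_right: "r \<in> R \<Longrightarrow> x \<in> W \<Longrightarrow> x * r \<in> W"
  using W_scale by (simp add: mult.commute)

lemma W_sum: "(\<And>i. i \<in> I \<Longrightarrow> f i \<in> W) \<Longrightarrow> sum f I \<in> W"
  by (induction I rule: infinite_finite_induct) (auto intro: W_add)

lemma power_mem: "r \<in> R \<Longrightarrow> r ^ n \<in> R"
  by (induction n) (auto intro: mult_mem)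

lemma of_nat_mem: "of_nat n \<in> R"
  by (induction n) (auto intro: add_mem)

lemma coeffs_in_0 [simp]: "coeffs_in W 0"
  by (simp add: coeffs_in_def)

lemma coeffs_in_pCons [simp]: "coeffs_in W (pCons x p) \<longleftrightarrow> x \<in> W \<and> coeffs_in W p"
  by (auto simp: coeffs_in_def coeff_pCons split: nat.splits)

lemma coeffs_in_add: "coeffs_in W p \<Longrightarrow> coeffs_in W q \<Longrightarrow> coeffs_in W (p + q)"
  by (auto simp: coeffs_in_def intro: W_add)

lemma coeffs_in_diff: "coeffs_in W p \<Longrightarrow> coeffs_in W q \<Longrightarrow> coeffs_in W (p - q)"
  by (auto simp: coeffs_in_def intro: W_diff)

lemma coeffs_in_smult: "r \<in> R \<Longrightarrow> coeffs_in W p \<Longrightarrow> coeffs_in W (smult r p)"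
  by (auto simp: coeffs_in_def intro: W_scale)

lemma coeffs_in_mult: "coeffs_in R p \<Longrightarrow> coeffs_in W q \<Longrightarrow> coeffs_in W (p * q)"
  by (auto simp: coeffs_in_def coeff_mult intro!: W_sum W_scale)

lemma coeffs_in_pcompose:
  assumes "coeffs_in W p" "coeffs_in R q"
  shows "coeffs_in W (pcompose p q)"
  using assms(1)
proof (induction p)
  case (pCons x p)
  then show ?case using assms(2)
    by (auto simp: pcompose_pCons intro!: coeffs_in_add coeffs_in_mult)
qed simp

lemma coeffs_in_pderiv: "coeffs_in W p \<Longrightarrow> coeffs_in W (pderiv p)"
  unfolding coeffs_in_def coeff_pderiv by (metis W_scale of_nat_mem)

lemma poly_mem: "coeffs_in W p \<Longrightarrow> r \<in> R \<Longrightarrow> poly p r \<in> W"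
  by (induction p) (auto intro: W_add W_scale)

end

sublocale field_subring \<subseteq> self: field_submodule R R
  by unfold_locales (auto intro: add_mem mult_mem)

context field_subring begin

lemma minus_mem: "x \<in> R \<Longrightarrow> y \<in> R \<Longrightarrow> x - y \<in> R"
  by (rule self.W_diff)

text \<open>Prepending a coefficient to the dividend shifts the remainder up by one degree, and a
  multiple of \<open>q\<close> removes its new top coefficient. As \<open>q\<close> is monic, the
  coefficients stay in \<open>R\<close>. The remainder is bounded through vanishing coefficients,
  which also covers a zero remainder and a \<open>q\<close> of degree 0.\<close>

lemma division_by_monic:
  assumes q: "coeffs_in R q" "Polynomial.lead_coeff q = 1"
    and g: "coeffs_in R g"
  shows "\<exists>Q r. coeffs_in R Q \<and> coeffs_in R r \<and> g = Q * q + r \<and>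
    (\<forall>i\<ge>Polynomial.degree q. Polynomial.coeff r i = 0)"
  using g
proof (induction g)
  case 0
  show ?case by (intro exI[of _ 0]) auto
next
  case (pCons x g)
  then obtain Q r where Qr: "coeffs_in R Q" "coeffs_in R r" "g = Q * q + r"
    "\<forall>i\<ge>Polynomial.degree q. Polynomial.coeff r i = 0"
    by auto
  define c where "c = Polynomial.coeff (pCons x r) (Polynomial.degree q)"
  have x: "x \<in> R" using pCons.prems by simp
  have c: "c \<in> R"
    using x Qr(2) by (auto simp: c_def coeff_pCons coeffs_in_def split: nat.splits)
  have "pCons x g = (pCons 0 Q + [:c:]) * q + (pCons x r - smult c q)"
    by (simp add: Qr(3) algebra_simps)
  moreover have "coeffs_in R (pCons 0 Q + [:c:])"
    using c Qr(1) by (auto intro!: self.coeffs_in_add)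
  moreover have "coeffs_in R (pCons x r - smult c q)"
    using c x Qr(2) q(1) by (auto intro!: self.coeffs_in_diff self.coeffs_in_smult)
  moreover have "Polynomial.coeff (pCons x r - smult c q) i = 0" if i: "i \<ge> Polynomial.degree q" for i
  proof (cases "i = Polynomial.degree q")
    case True
    then show ?thesis using q(2) by (simp add: c_def)
  next
    case False
    then obtain j where j: "i = Suc j" "j \<ge> Polynomial.degree q" using i by (cases i) auto
    then show ?thesis using Qr(4) by (simp add: coeff_eq_0)
  qed
  ultimately show ?case by blast
qed

end

context field_subfield begin

lemma divide_mem: "x \<in> R \<Longrightarrow> y \<in> R \<Longrightarrow> x / y \<in> R"
  using mult_mem inverse_mem by (simp add: divide_inverse)

end

section \<open>A Hensel type obstruction\<close>

text \<open>A valuation ring of the ambient field with its maximal ideal, described without values.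
  The intended instance is a coarsening of \<open>v\<close>, so that no quotient of the value group
  has to be formed.\<close>

locale valuation_ring_pair = field_subring R for R :: "'a::field set" +
  fixes M :: "'a set"
  assumes M_subset: "M \<subseteq> R"
    and M_zero: "0 \<in> M"
    and M_add: "x \<in> M \<Longrightarrow> y \<in> M \<Longrightarrow> x + y \<in> M"
    and M_mult: "x \<in> R \<Longrightarrow> y \<in> M \<Longrightarrow> x * y \<in> M"
    and one_notin_M: "1 \<notin> M"
    and inverse_in_R: "x \<in> R \<Longrightarrow> x \<notin> M \<Longrightarrow> inverse x \<in> R"
    and inverse_in_M: "x \<notin> R \<Longrightarrow> inverse x \<in> M"

sublocale valuation_ring_pair \<subseteq> M: field_submodule R M
  by unfold_locales (auto intro: M_zero M_add M_mult)

context valuation_ring_pair begin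

lemma M_prime:
  assumes xy: "x * y \<in> M" "x \<in> R" "x \<notin> M"
  shows "y \<in> M"
proof -
  have "inverse x * (x * y) \<in> M" using xy by (metis M_mult inverse_in_R)
  moreover have "x \<noteq> 0" using xy M_zero by auto
  ultimately show "y \<in> M" by (simp flip: mult.assoc)
qed

lemma prod_mset_mem_M: "(\<And>x. x \<in># A \<Longrightarrow> f x \<in> R) \<Longrightarrow> (\<Prod>x\<in>#A. f x) \<in> M \<Longrightarrow> \<exists>x\<in>#A. f x \<in> M"
proof (induction A)
  case empty
  then show ?case using one_notin_M by simp
next
  case (add x A)
  then show ?case using M_prime[of "f x" "\<Prod>x\<in>#A. f x"] by auto
qed

text \<open>Valuation rings are integrally closed: for \<open>y \<notin> R\<close>, dividing the
  equation by \<open>y ^ n\<close> writes 1 as a combination of positive powers of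
  \<open>inverse y \<in> M\<close>.\<close>

lemma root_mem:
  assumes q: "coeffs_in R q" "Polynomial.lead_coeff q = 1" and y: "poly q y = 0"
  shows "y \<in> R"
proof (rule ccontr)
  assume nR: "y \<notin> R"
  then have y0: "y \<noteq> 0" by auto
  have iy: "inverse y \<in> M" by (rule inverse_in_M[OF nR])
  define n where "n = Polynomial.degree q"
  have n: "n > 0"
  proof (rule ccontr)
    assume "\<not> n > 0"
    then have "Polynomial.degree q = 0" by (simp add: n_def)
    then obtain c where "q = [:c:]" by (auto elim: degree_eq_zeroE)
    then show False using q(2) y by simp
  qed
  have ip: "y ^ i * inverse y ^ n = inverse y ^ (n - i)" if "i \<le> n" for i
  proof -
    have "inverse y ^ n = inverse y ^ i * inverse y ^ (n - i)"
      using that by (simp only: power_add[symmetric] le_add_diff_inverse)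
    moreover have "y ^ i * inverse y ^ i = 1"
      by (simp only: power_mult_distrib[symmetric] right_inverse[OF y0] power_one)
    ultimately show ?thesis by (metis mult.assoc mult_1)
  qed
  have "0 = poly q y * inverse y ^ n" using y by simp
  also have "\<dots> = (\<Sum>i\<le>n. Polynomial.coeff q i * y ^ i) * inverse y ^ n"
    unfolding poly_altdef n_def ..
  also have "\<dots> = (\<Sum>i\<le>n. Polynomial.coeff q i * inverse y ^ (n - i))"
    unfolding sum_distrib_right by (intro sum.cong refl) (metis ip mult.assoc atMost_iff)
  also have "{..n} = insert n {..<n}" by auto
  also have "(\<Sum>i\<in>insert n {..<n}. Polynomial.coeff q i * inverse y ^ (n - i)) =
      1 + (\<Sum>i<n. Polynomial.coeff q i * inverse y ^ (n - i))"
    using q(2) unfolding n_def[symmetric] by (subst sum.insert) auto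
  finally have "1 = - (\<Sum>i<n. Polynomial.coeff q i * inverse y ^ (n - i))"
    by (simp only: eq_neg_iff_add_eq_0)
  also have "\<dots> \<in> M"
  proof (intro M.W_uminus M.W_sum M_mult)
    fix i assume "i \<in> {..<n}"
    then obtain j where "n - i = Suc j" by (metis Suc_diff_Suc lessThan_iff)
    then show "inverse y ^ (n - i) \<in> M"
      using iy M_subset by (auto intro!: M.W_scale_right M.power_mem)
  qed (use q in \<open>auto simp: coeffs_in_def\<close>)
  finally show False using one_notin_M by simp
qed

end

text \<open>Two factors vanish at \<open>a\<close> modulo \<open>M\<close>, so \<open>a\<close> is a
  multiple root: in the product rule one factor makes the first summand small, the other one the
  second.\<close>

lemma pderiv_prod_mset_mem:
  assumes "valuation_ring_pair R M"
    and "\<And>y. y \<in># B \<Longrightarrow> a - y \<in> M" "size B \<ge> 2"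
  shows "poly (pderiv (\<Prod>y\<in>#B. [:- y, 1:])) a \<in> M"
proof -
  interpret valuation_ring_pair R M by fact
  from assms(3) obtain y B' where B: "B = add_mset y B'" "B' \<noteq> {#}"
    by (cases B rule: multiset_cases) force+
  then obtain z B'' where B': "B' = add_mset z B''"
    by (metis multiset_cases)
  let ?P = "\<Prod>y\<in>#B''. [:- y, 1:]"
  have in_R: "poly (\<Prod>y\<in>#C. [:- y, 1:]) a \<in> R" if "set_mset C \<subseteq> set_mset B" for C
    using that
  proof (induction C)
    case (add x C)
    then have "(a - x) * poly (\<Prod>y\<in>#C. [:- y, 1:]) a \<in> R"
      using assms(2)[of x] M_subset by (intro mult_mem) auto
    then show ?case by (simp add: algebra_simps)
  qed simp
  have eq: "(\<Prod>y\<in>#B. [:- y, 1:]) = [:- y, 1:] * (\<Prod>y\<in>#B'. [:- y, 1:])"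
    by (simp add: B)
  have "poly (pderiv (\<Prod>y\<in>#B. [:- y, 1:])) a =
     (a - y) * poly (pderiv (\<Prod>y\<in>#B'. [:- y, 1:])) a + poly (\<Prod>y\<in>#B'. [:- y, 1:]) a"
    unfolding eq pderiv_mult by (simp add: pderiv_pCons algebra_simps)
  moreover have "poly (\<Prod>y\<in>#B'. [:- y, 1:]) a = (a - z) * poly ?P a"
    by (simp add: B' algebra_simps)
  moreover have "(a - z) * poly ?P a \<in> M"
    using assms(2) in_R[of B''] by (auto simp: B B' intro!: M.W_scale_right)
  moreover have "poly (pderiv (\<Prod>y\<in>#C. [:- y, 1:])) a \<in> R" if "set_mset C \<subseteq> set_mset B" for C
    using that
  proof (induction C)
    case (add x C)
    have "[:- x, 1:] * (\<Prod>y\<in>#C. [:- y, 1:]) = (\<Prod>y\<in>#add_mset x C. [:- y, 1:])" by simp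
    moreover have "poly (pderiv ([:- x, 1:] * (\<Prod>y\<in>#C. [:- y, 1:]))) a =
      (a - x) * poly (pderiv (\<Prod>y\<in>#C. [:- y, 1:])) a + poly (\<Prod>y\<in>#C. [:- y, 1:]) a"
      unfolding pderiv_mult by (simp add: pderiv_pCons algebra_simps)
    ultimately show ?case
      using add assms(2)[of x] M_subset in_R[of C] by (auto intro!: mult_mem add_mem)
  qed simp
  ultimately show ?thesis
    using assms(2)[of y] by (auto simp: B intro!: M_add M.W_scale_right)
qed

text \<open>If some coefficient were outside \<open>M\<close>, then cutting \<open>q\<close> off
  above the highest such coefficient and dividing by that coefficient would give a monic polynomial
  of degree at most that of \<open>q\<close>, against \<open>minimal\<close>.\<close>

lemma (in valuation_ring_pair) coeffs_in_M_trivial: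
  assumes K: "field_subfield K"
    and a: "a \<in> R"
    and q: "coeffs_in (K \<inter> R) q" "poly q a \<in> M"
    and minimal: "\<And>g. \<lbrakk>coeffs_in (K \<inter> R) g; Polynomial.lead_coeff g = 1; poly g a \<in> M\<rbrakk>
      \<Longrightarrow> Polynomial.degree q < Polynomial.degree g"
  shows "coeffs_in M q"
proof (rule ccontr)
  interpret K: field_subfield K by fact
  assume "\<not> coeffs_in M q"
  then obtain i0 where i0: "Polynomial.coeff q i0 \<notin> M" by (auto simp: coeffs_in_def)
  have le: "i \<le> Polynomial.degree q" if "Polynomial.coeff q i \<notin> M" for i
    using that M_zero by (metis le_degree)
  define i where "i = (GREATEST i. Polynomial.coeff q i \<notin> M)"
  have i: "Polynomial.coeff q i \<notin> M"
    unfolding i_def using GreatestI_nat[where P = "\<lambda>i. Polynomial.coeff q i \<notin> M", OF i0] le by blast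
  have above: "Polynomial.coeff q j \<in> M" if "j > i" for j
    using that Greatest_le_nat[of "\<lambda>i. Polynomial.coeff q i \<notin> M" j "Polynomial.degree q"] le
    unfolding i_def by (metis leD)
  define u where "u = inverse (Polynomial.coeff q i)"
  have qi: "Polynomial.coeff q i \<in> K \<inter> R" using q by (simp add: coeffs_in_def)
  then have u: "u \<in> K \<inter> R" "u * Polynomial.coeff q i = 1"
    using i inverse_in_R K.inverse_mem M_zero unfolding u_def by (auto intro!: left_inverse)
  define g where "g = (\<Sum>j\<le>i. monom (u * Polynomial.coeff q j) j)"
  have cg: "Polynomial.coeff g j = (if j \<le> i then u * Polynomial.coeff q j else 0)" for j
    unfolding g_def by (auto simp: coeff_sum sum.delta)
  have dg: "Polynomial.degree g = i"
    using u(2) by (intro antisym degree_le le_degree) (auto simp: cg)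
  have "coeffs_in (K \<inter> R) g"
    using q u by (auto simp: coeffs_in_def cg intro: K.mult_mem mult_mem)
  moreover have "Polynomial.lead_coeff g = 1" using u(2) by (simp add: dg cg)
  moreover have "poly g a \<in> M"
  proof -
    have "coeffs_in M (smult u q - g)"
      using u q above M_zero by (auto simp: coeffs_in_def cg intro!: M_mult)
    then have "poly (smult u q - g) a \<in> M" using a by (rule M.poly_mem)
    then have "u * poly q a - poly g a \<in> M" by simp
    moreover have "u * poly q a \<in> M" using u q(2) by (intro M_mult) auto
    ultimately have "u * poly q a - (u * poly q a - poly g a) \<in> M" by (metis M.W_diff)
    then show ?thesis by simp
  qed
  ultimately have "Polynomial.degree q < i" using minimal dg by blast
  moreover have "i \<le> Polynomial.degree q" by (rule le[OF i])
  ultimately show False by simp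
qed

text \<open>
  If \<open>g\<close> had a simple zero at \<open>a\<close> modulo \<open>M\<close>, the minimal polynomial of \<open>a\<close> modulo \<open>M\<close> over \<open>K \<inter> R\<close>
  would be separable; but it divides \<open>F\<close>, all of whose roots coincide modulo \<open>M\<close>.
\<close>

lemma pderiv_mem_M:
  fixes a :: "'a::alg_closed_field"
  assumes RM: "valuation_ring_pair R M" and K: "field_subfield K"
    and F: "coeffs_in K F" "F = (\<Prod>x\<in>#A. [:- x, 1:])"
    and a: "a \<in> R" "a \<in># A"
    and A: "\<And>x. x \<in># A \<Longrightarrow> x - a \<in> M"
    and far: "\<And>c. c \<in> K \<Longrightarrow> a - c \<notin> M"
    and g: "coeffs_in (K \<inter> R) g" "poly g a \<in> M"
  shows "poly (pderiv g) a \<in> M"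
proof -
  interpret valuation_ring_pair R M by fact
  interpret K: field_subfield K by fact
  interpret KR: field_subring "K \<inter> R"
    by unfold_locales (auto intro: K.add_mem K.mult_mem K.uminus_mem add_mem mult_mem uminus_mem)
  have AR: "x \<in> R" if "x \<in># A" for x
    using A[OF that] a(1) M_subset add_mem[of "x - a" a] by auto
  have "coeffs_in R (\<Prod>x\<in>#B. [:- x, 1:])" if "set_mset B \<subseteq> set_mset A" for B
    using that
  proof (induction B)
    case (add x B)
    then have "coeffs_in R ([:- x, 1:] * (\<Prod>x\<in>#B. [:- x, 1:]))"
      using AR by (intro self.coeffs_in_mult) (auto intro: uminus_mem)
    then show ?case by (simp only: image_mset_add_mset prod_mset.add_mset)
  qed (auto simp: coeffs_in_def coeff_pCons split: nat.splits simp flip: one_pCons)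
  then have FR: "coeffs_in (K \<inter> R) F" using F by (auto simp: coeffs_in_def)
  have monic: "Polynomial.lead_coeff F = 1"
    unfolding F(2) by (induction A) (simp_all add: lead_coeff_mult del: mult_pCons_left)
  have evalF: "poly F y = (\<Prod>x\<in>#A. y - x)" for y
    unfolding F(2) by (induction A) (auto simp: algebra_simps)
  have Fa: "poly F a = 0"
    unfolding evalF using a(2) by (auto simp: prod_mset_zero_iff)
  \<comment> \<open>A \<open>q\<close> of least degree with this property lifts the minimal
    polynomial of the residue of \<open>a\<close> over the residues of
    \<open>K \<inter> R\<close>.\<close>
  define P where "P q \<longleftrightarrow> coeffs_in (K \<inter> R) q \<and> Polynomial.lead_coeff q = 1 \<and> poly q a \<in> M" for q
  have "P F" using FR monic Fa M_zero by (simp add: P_def)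
  then obtain q where q: "P q" and qmin: "\<And>q'. P q' \<Longrightarrow> Polynomial.degree q \<le> Polynomial.degree q'"
    using ex_has_least_nat[of P F Polynomial.degree] by blast
  have q': "coeffs_in (K \<inter> R) q" "Polynomial.lead_coeff q = 1" "poly q a \<in> M"
    using q by (auto simp: P_def)
  have qR: "coeffs_in R q" using q' by (auto simp: coeffs_in_def)
  \<comment> \<open>A linear \<open>q\<close> would exhibit an element of \<open>K\<close> congruent
    to \<open>a\<close>, against \<open>far\<close>.\<close>
  have deg: "Polynomial.degree q \<ge> 2"
  proof (rule ccontr)
    assume "\<not> ?thesis"
    then have "Polynomial.degree q \<le> 1" by simp
    then have q_eq: "q = [:Polynomial.coeff q 0, Polynomial.coeff q 1:]"
      by (intro poly_eqI) (auto simp: coeff_pCons coeff_eq_0 split: nat.splits)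
    show False
    proof (cases "Polynomial.degree q = 0")
      case True
      then have "q = [:1:]" using q'(2) by (auto elim: degree_eq_zeroE)
      then show False using q'(3) one_notin_M by simp
    next
      case False
      then have "Polynomial.degree q = 1" using \<open>Polynomial.degree q \<le> 1\<close> by simp
      then have "Polynomial.coeff q 1 = 1" using q'(2) by simp
      then have "poly q a = a - (- Polynomial.coeff q 0)" by (subst q_eq) simp
      moreover have "- Polynomial.coeff q 0 \<in> K"
        using q'(1) by (auto simp: coeffs_in_def intro: K.uminus_mem)
      ultimately show False using far q'(3) by metis
    qed
  qed
  have rem: "coeffs_in M r" if "h = Q * q + r" "coeffs_in (K \<inter> R) h" "poly h a \<in> M"
    "coeffs_in (K \<inter> R) Q" "coeffs_in (K \<inter> R) r"
    "\<forall>i\<ge>Polynomial.degree q. Polynomial.coeff r i = 0" for h Q r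
  proof (rule coeffs_in_M_trivial[OF K a(1)])
    have "poly h a - poly Q a * poly q a \<in> M"
      using that q' a(1) by (intro M.W_diff M_mult self.poly_mem) (auto simp: coeffs_in_def)
    then show "poly r a \<in> M" using that(1) by simp
    fix g' assume "coeffs_in (K \<inter> R) g'" "Polynomial.lead_coeff g' = 1" "poly g' a \<in> M"
    then have "Polynomial.degree q \<le> Polynomial.degree g'" using qmin by (simp add: P_def)
    moreover have "Polynomial.degree r < Polynomial.degree q"
      using that(6) deg by (metis degree_0 leading_coeff_0_iff not_le_imp_less less_le_trans zero_less_numeral)
    ultimately show "Polynomial.degree r < Polynomial.degree g'" by simp
  qed (use that in auto)
  have "q \<noteq> 0" using deg by auto
  then obtain B where B: "size B = Polynomial.degree q" "q = (\<Prod>x\<in>#B. [:- x, 1:])"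
    using alg_closed_imp_factorization[of q] q'(2) by auto
  \<comment> \<open>Modulo \<open>M\<close> the polynomial \<open>F\<close> is a multiple of
    \<open>q\<close>, and \<open>y\<close> is integral; hence a product of factors
    \<open>y - x\<close> with \<open>x \<in># A\<close> lies in \<open>M\<close>. As
    \<open>M\<close> is prime, \<open>y\<close> is congruent to some \<open>x\<close>, and so to
    \<open>a\<close>.\<close>
  have near: "a - y \<in> M" if y: "y \<in># B" for y
  proof -
    have "poly q y = (\<Prod>x\<in>#B. y - x)"
      unfolding B(2) by (induction B) (auto simp: algebra_simps)
    then have qy: "poly q y = 0" using y by (auto simp: prod_mset_zero_iff)
    have yR: "y \<in> R" by (rule root_mem[OF qR q'(2) qy])
    obtain Q r where Qr: "coeffs_in (K \<inter> R) Q" "coeffs_in (K \<inter> R) r" "F = Q * q + r"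
      "\<forall>i\<ge>Polynomial.degree q. Polynomial.coeff r i = 0"
      using KR.division_by_monic[OF q'(1,2) FR] by auto
    have "coeffs_in M r" using rem[OF Qr(3) FR] Fa M_zero Qr by simp
    then have "poly r y \<in> M" using yR by (rule M.poly_mem)
    then have "(\<Prod>x\<in>#A. y - x) \<in> M" using evalF[of y] Qr(3) qy by simp
    then obtain x where x: "x \<in># A" "y - x \<in> M"
      using prod_mset_mem_M[of A "\<lambda>x. y - x"] yR AR minus_mem by blast
    have "- ((y - x) + (x - a)) \<in> M" using x A by (intro M.W_uminus M_add) auto
    then show ?thesis by simp
  qed
  have dq: "poly (pderiv q) a \<in> M"
    unfolding B(2) by (rule pderiv_prod_mset_mem[OF valuation_ring_pair_axioms near]) (use deg B in auto)
  obtain Q r where Qr: "coeffs_in (K \<inter> R) Q" "coeffs_in (K \<inter> R) r" "g = Q * q + r"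
      "\<forall>i\<ge>Polynomial.degree q. Polynomial.coeff r i = 0"
    using KR.division_by_monic[OF q'(1,2) g(1)] by auto
  have r: "coeffs_in M r" using rem[OF Qr(3) g Qr(1,2,4)] .
  have QR: "coeffs_in R Q" using Qr(1) by (auto simp: coeffs_in_def)
  have "poly (pderiv g) a = poly Q a * poly (pderiv q) a + poly (pderiv Q) a * poly q a + poly (pderiv r) a"
    unfolding Qr(3) by (simp add: pderiv_add pderiv_mult algebra_simps)
  also have "\<dots> \<in> M"
    using self.poly_mem[OF QR a(1)] self.poly_mem[OF self.coeffs_in_pderiv[OF QR] a(1)]
      M.poly_mem[OF M.coeffs_in_pderiv[OF r] a(1)] dq q'(3)
    by (intro M_add M_mult)
  finally show ?thesis .
qed

section \<open>Valuations on a field\<close>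

locale valued_field =
  fixes v :: "'a::field \<Rightarrow> 'g::linordered_ab_group_add"
  assumes valuation: "valuation_on UNIV v"
begin

text \<open>Comparisons in which 0 has value infinity, whatever \<open>v 0\<close> happens to
  be.\<close>

definition val_ge :: "'a \<Rightarrow> 'g \<Rightarrow> bool" where
  "val_ge x g \<longleftrightarrow> x = 0 \<or> g \<le> v x"

definition val_gt :: "'a \<Rightarrow> 'g \<Rightarrow> bool" where
  "val_gt x g \<longleftrightarrow> x = 0 \<or> g < v x"

lemma v_mult: "x \<noteq> 0 \<Longrightarrow> y \<noteq> 0 \<Longrightarrow> v (x * y) = v x + v y"
  using valuation by (auto simp: valuation_on_def)

lemma v_add: "x \<noteq> 0 \<Longrightarrow> y \<noteq> 0 \<Longrightarrow> x + y \<noteq> 0 \<Longrightarrow> min (v x) (v y) \<le> v (x + y)"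
  using valuation by (auto simp: valuation_on_def)

lemma v_one [simp]: "v 1 = 0"
  using v_mult[of 1 1] by simp

lemma v_minus_one [simp]: "v (- 1) = 0"
proof -
  have "v (- 1) + v (- 1) = 0" using v_mult[of "- 1" "- 1"] by simp
  then show ?thesis by (simp only: double_zero)
qed

lemma v_uminus [simp]: "v (- x) = v x"
  using v_mult[of "- 1" x] by (cases "x = 0") auto

lemma v_diff_commute: "v (x - y) = v (y - x)"
  using v_uminus[of "x - y"] by simp

lemma v_inverse: "x \<noteq> 0 \<Longrightarrow> v (inverse x) = - v x"
  using v_mult[of x "inverse x"] by (simp add: eq_neg_iff_add_eq_0 add.commute)

lemma v_divide: "x \<noteq> 0 \<Longrightarrow> y \<noteq> 0 \<Longrightarrow> v (x / y) = v x - v y"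
  by (simp add: divide_inverse v_mult v_inverse)

lemma v_power_mono: "x \<noteq> 0 \<Longrightarrow> y \<noteq> 0 \<Longrightarrow> v x \<le> v y \<Longrightarrow> v (x ^ n) \<le> v (y ^ n)"
  by (induction n) (auto simp: v_mult intro: add_mono)

lemma v_power_cong: "x \<noteq> 0 \<Longrightarrow> y \<noteq> 0 \<Longrightarrow> v x = v y \<Longrightarrow> v (x ^ n) = v (y ^ n)"
  by (induction n) (auto simp: v_mult)

lemma val_ge_0 [simp]: "val_ge 0 g" and val_gt_0 [simp]: "val_gt 0 g"
  by (auto simp: val_ge_def val_gt_def)

lemma val_ge_self [simp]: "val_ge x (v x)"
  by (simp add: val_ge_def)

lemma val_gt_imp_ge: "val_gt x g \<Longrightarrow> val_ge x g"
  by (auto simp: val_ge_def val_gt_def)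

lemma val_ge_mono: "val_ge x g \<Longrightarrow> h \<le> g \<Longrightarrow> val_ge x h"
  and val_gt_mono: "val_gt x g \<Longrightarrow> h \<le> g \<Longrightarrow> val_gt x h"
  and val_ge_less: "val_ge x g \<Longrightarrow> h < g \<Longrightarrow> val_gt x h"
  by (auto simp: val_ge_def val_gt_def)

lemma val_ge_uminus [simp]: "val_ge (- x) g \<longleftrightarrow> val_ge x g"
  and val_gt_uminus [simp]: "val_gt (- x) g \<longleftrightarrow> val_gt x g"
  by (auto simp: val_ge_def val_gt_def)

lemma val_ge_add: "val_ge x g \<Longrightarrow> val_ge y g \<Longrightarrow> val_ge (x + y) g"
  using v_add[of x y] by (cases "x = 0 \<or> y = 0 \<or> x + y = 0") (auto simp: val_ge_def min_le_iff_disj)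

lemma val_gt_add: "val_gt x g \<Longrightarrow> val_gt y g \<Longrightarrow> val_gt (x + y) g"
  using v_add[of x y] by (cases "x = 0 \<or> y = 0 \<or> x + y = 0") (auto simp: val_gt_def min_le_iff_disj)

lemma val_ge_diff: "val_ge x g \<Longrightarrow> val_ge y g \<Longrightarrow> val_ge (x - y) g"
  using val_ge_add[of x g "- y"] by simp

lemma val_gt_diff: "val_gt x g \<Longrightarrow> val_gt y g \<Longrightarrow> val_gt (x - y) g"
  using val_gt_add[of x g "- y"] by simp

lemma val_gt_minus_commute: "val_gt (x - y) g \<longleftrightarrow> val_gt (y - x) g"
  using val_gt_uminus[of "x - y" g] by simp

lemma val_ge_mult: "val_ge x g \<Longrightarrow> val_ge y h \<Longrightarrow> val_ge (x * y) (g + h)"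
  by (cases "x = 0 \<or> y = 0") (auto simp: val_ge_def v_mult add_mono)

lemma val_gt_ge_mult: "val_gt x g \<Longrightarrow> val_ge y h \<Longrightarrow> val_gt (x * y) (g + h)"
  by (cases "x = 0 \<or> y = 0") (auto simp: val_ge_def val_gt_def v_mult add_less_le_mono)

lemma val_ge_gt_mult: "val_ge x g \<Longrightarrow> val_gt y h \<Longrightarrow> val_gt (x * y) (g + h)"
  by (cases "x = 0 \<or> y = 0") (auto simp: val_ge_def val_gt_def v_mult add_le_less_mono)

lemma val_gt_times_iff: "y \<noteq> 0 \<Longrightarrow> val_gt (x * y) (g + v y) \<longleftrightarrow> val_gt x g"
  by (cases "x = 0") (auto simp: val_gt_def v_mult)

lemma val_ge_times_iff: "y \<noteq> 0 \<Longrightarrow> val_ge (x * y) (g + v y) \<longleftrightarrow> val_ge x g"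
  by (cases "x = 0") (auto simp: val_ge_def v_mult)

lemma val_ge_divide_iff: "y \<noteq> 0 \<Longrightarrow> val_ge (x / y) g \<longleftrightarrow> val_ge x (g + v y)"
  using val_ge_times_iff[of y "x / y" g] by simp

lemma val_gt_divide_iff: "y \<noteq> 0 \<Longrightarrow> val_gt (x / y) g \<longleftrightarrow> val_gt x (g + v y)"
  using val_gt_times_iff[of y "x / y" g] by simp

lemma val_ge_sum: "(\<And>i. i \<in> I \<Longrightarrow> val_ge (f i) g) \<Longrightarrow> val_ge (sum f I) g"
  by (induction I rule: infinite_finite_induct) (auto intro: val_ge_add)

lemma val_gt_sum: "(\<And>i. i \<in> I \<Longrightarrow> val_gt (f i) g) \<Longrightarrow> val_gt (sum f I) g"
  by (induction I rule: infinite_finite_induct) (auto intro: val_gt_add)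

lemma val_eqI:
  assumes "x \<noteq> 0" "val_gt (y - x) (v x)"
  shows "y \<noteq> 0" and "v y = v x"
proof -
  show y: "y \<noteq> 0" using assms by (auto simp: val_gt_def)
  have "val_ge (x + (y - x)) (v x)"
    by (rule val_ge_add[OF val_ge_self val_gt_imp_ge[OF assms(2)]])
  then have "v x \<le> v y" using y by (simp add: val_ge_def)
  moreover have "\<not> v x < v y"
  proof
    assume "v x < v y"
    then have "val_gt (y - (y - x)) (v x)"
      using assms(2) by (intro val_gt_diff[of y _ "y - x"]) (simp_all add: val_gt_def)
    then show False using assms(1) by (simp add: val_gt_def)
  qed
  ultimately show "v y = v x" by simp
qed

lemma val_power_minus_commute:
  "val_gt (x * (c - a) ^ i) g \<longleftrightarrow> val_gt (x * (a - c) ^ i) g"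
  "val_ge (x * (c - a) ^ i) g \<longleftrightarrow> val_ge (x * (a - c) ^ i) g"
proof -
  have "(c - a) ^ i = (- 1) ^ i * (a - c) ^ i" by (simp flip: power_mult_distrib)
  then have "x * (c - a) ^ i = x * (a - c) ^ i \<or> x * (c - a) ^ i = - (x * (a - c) ^ i)"
    by (cases "even i") auto
  then show "val_gt (x * (c - a) ^ i) g \<longleftrightarrow> val_gt (x * (a - c) ^ i) g"
    "val_ge (x * (c - a) ^ i) g \<longleftrightarrow> val_ge (x * (a - c) ^ i) g" by auto
qed

text \<open>Used for Taylor expansions \<open>t\<close> at \<open>a\<close> and
  \<open>y = c - a\<close>, with \<open>k\<close> equal to 1 or 2: what is left are the terms to be
  shown negligible.\<close>

lemma poly_minus_sum:
  fixes t :: "'a poly"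
  shows "poly t y - (\<Sum>i<k. Polynomial.coeff t i * y ^ i) =
    (\<Sum>i=k..Polynomial.degree t. Polynomial.coeff t i * y ^ i)"
proof (cases "k \<le> Polynomial.degree t")
  case True
  then have "{..Polynomial.degree t} = {..<k} \<union> {k..Polynomial.degree t}" by auto
  then have "poly t y = (\<Sum>i<k. Polynomial.coeff t i * y ^ i) +
    (\<Sum>i=k..Polynomial.degree t. Polynomial.coeff t i * y ^ i)"
    unfolding poly_altdef by (simp only:) (subst sum.union_disjoint, auto)
  then show ?thesis by simp
next
  case False
  then have "(\<Sum>i<k. Polynomial.coeff t i * y ^ i) = (\<Sum>i\<le>Polynomial.degree t. Polynomial.coeff t i * y ^ i)"
    by (intro sum.mono_neutral_right) (auto simp: coeff_eq_0)
  then show ?thesis using False by (simp add: poly_altdef)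
qed

lemma val_gt_poly_minus_sum:
  "(\<And>i. i \<ge> k \<Longrightarrow> val_gt (Polynomial.coeff t i * y ^ i) g) \<Longrightarrow>
    val_gt (poly t y - (\<Sum>i<k. Polynomial.coeff t i * y ^ i)) g"
  unfolding poly_minus_sum by (auto intro!: val_gt_sum)

lemma val_ge_poly_minus_sum:
  "(\<And>i. i \<ge> k \<Longrightarrow> val_ge (Polynomial.coeff t i * y ^ i) g) \<Longrightarrow>
    val_ge (poly t y - (\<Sum>i<k. Polynomial.coeff t i * y ^ i)) g"
  unfolding poly_minus_sum by (auto intro!: val_ge_sum)

end

section \<open>Convex subgroups\<close>

locale convex_subgroup =
  fixes H :: "'g::linordered_ab_group_add set"
  assumes H_zero [simp]: "0 \<in> H"
    and H_add: "g \<in> H \<Longrightarrow> h \<in> H \<Longrightarrow> g + h \<in> H"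
    and H_uminus: "g \<in> H \<Longrightarrow> - g \<in> H"
    and H_convex: "0 \<le> g \<Longrightarrow> g \<le> h \<Longrightarrow> h \<in> H \<Longrightarrow> g \<in> H"
begin

lemma H_diff: "g \<in> H \<Longrightarrow> h \<in> H \<Longrightarrow> g - h \<in> H"
  using H_add[of g "- h"] H_uminus by simp

end

definition stabilizer :: "'g::linordered_ab_group_add set \<Rightarrow> 'g set" where
  "stabilizer C = {g. \<forall>x\<in>C. x + g \<in> C \<and> x - g \<in> C}"

lemma convex_subgroup_stabilizer:
  assumes "\<And>x y. x \<in> C \<Longrightarrow> y \<le> x \<Longrightarrow> y \<in> C"
  shows "convex_subgroup (stabilizer C)"
proof
  fix g h
  show "0 \<in> stabilizer C" by (simp add: stabilizer_def)
  show "g + h \<in> stabilizer C" if "g \<in> stabilizer C" "h \<in> stabilizer C"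
    using that by (simp add: stabilizer_def flip: add.assoc diff_diff_eq)
  show "- g \<in> stabilizer C" if "g \<in> stabilizer C"
    using that by (simp add: stabilizer_def)
  show "g \<in> stabilizer C" if "0 \<le> g" "g \<le> h" "h \<in> stabilizer C"
    using that assms by (auto simp: stabilizer_def intro: assms[of "_ + h"])
qed

lemma stabilizerI:
  assumes "\<And>x y. x \<in> C \<Longrightarrow> y \<le> x \<Longrightarrow> y \<in> C" "0 \<le> g" "\<And>x. x \<in> C \<Longrightarrow> x + g \<in> C"
  shows "g \<in> stabilizer C"
  using assms by (auto simp: stabilizer_def)

section \<open>Coarsening a valuation by a convex subgroup\<close>

context valued_field begin

text \<open>The valuation ring of the composition of \<open>v\<close> with the projection modulo
  \<open>H\<close>: the value lies above some element of \<open>H\<close>. For the maximal ideal it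
  lies above all of them.\<close>

definition coarse_ring :: "'g set \<Rightarrow> 'a set" where
  "coarse_ring H = {x. \<exists>h\<in>H. val_ge x h}"

definition coarse_ideal :: "'g set \<Rightarrow> 'a set" where
  "coarse_ideal H = {x. \<forall>h\<in>H. val_gt x h}"

lemma valuation_ring_pair_coarse:
  assumes "convex_subgroup H"
  shows "valuation_ring_pair (coarse_ring H) (coarse_ideal H)"
proof -
  interpret convex_subgroup H by fact
  show ?thesis
  proof
    fix x y
    show "0 \<in> coarse_ring H" unfolding coarse_ring_def using H_zero val_ge_0 by blast
    show "1 \<in> coarse_ring H" using H_zero by (auto simp: coarse_ring_def val_ge_def)
    show "x + y \<in> coarse_ring H" if xy: "x \<in> coarse_ring H" "y \<in> coarse_ring H"
    proof -
      obtain g h where gh: "g \<in> H" "h \<in> H" "val_ge x g" "val_ge y h"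
        using xy by (auto simp: coarse_ring_def)
      then have "val_ge (x + y) (min g h)"
        by (intro val_ge_add) (auto intro: val_ge_mono)
      moreover have "min g h \<in> H" using gh by (simp add: min_def)
      ultimately show ?thesis by (auto simp: coarse_ring_def)
    qed
    show "- x \<in> coarse_ring H" if "x \<in> coarse_ring H"
      using that by (auto simp: coarse_ring_def)
    show "x * y \<in> coarse_ring H" if "x \<in> coarse_ring H" "y \<in> coarse_ring H"
      using that by (auto simp: coarse_ring_def dest: val_ge_mult intro: H_add)
    show "coarse_ideal H \<subseteq> coarse_ring H"
      unfolding coarse_ring_def coarse_ideal_def using val_gt_imp_ge H_zero by blast
    show "0 \<in> coarse_ideal H" by (simp add: coarse_ideal_def)
    show "x + y \<in> coarse_ideal H" if "x \<in> coarse_ideal H" "y \<in> coarse_ideal H"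
      using that by (auto simp: coarse_ideal_def intro: val_gt_add)
    show "x * y \<in> coarse_ideal H" if xy: "x \<in> coarse_ring H" "y \<in> coarse_ideal H"
    proof -
      obtain g where g: "g \<in> H" "val_ge x g" using xy by (auto simp: coarse_ring_def)
      have "val_gt (x * y) h" if "h \<in> H" for h
        using val_ge_gt_mult[OF g(2), of y "h - g"] that H_diff[OF _ g(1)] \<open>y \<in> _\<close>
        by (auto simp: coarse_ideal_def)
      then show ?thesis by (simp add: coarse_ideal_def)
    qed
    show "1 \<notin> coarse_ideal H" using H_zero by (auto simp: coarse_ideal_def val_gt_def)
    show "inverse x \<in> coarse_ring H" if x: "x \<in> coarse_ring H" "x \<notin> coarse_ideal H"
    proof -
      obtain h where "h \<in> H" "x \<noteq> 0" "v x \<le> h"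
        using x by (auto simp: coarse_ideal_def val_gt_def not_less)
      then show ?thesis
        unfolding coarse_ring_def
        by (auto simp: val_ge_def v_inverse intro!: bexI[of _ "- h"] H_uminus)
    qed
    show "inverse x \<in> coarse_ideal H" if "x \<notin> coarse_ring H"
    proof -
      have x0: "x \<noteq> 0" using that H_zero val_ge_0 unfolding coarse_ring_def by blast
      have x: "v x < h" if "h \<in> H" for h
        using that \<open>x \<notin> _\<close> by (auto simp: coarse_ring_def val_ge_def not_le)
      have "h < - v x" if "h \<in> H" for h
        using x[OF H_uminus[OF that]] by (simp add: less_minus_iff)
      then show ?thesis
        using x0 by (auto simp: coarse_ideal_def val_gt_def v_inverse)
    qed
  qed
qed

end

section \<open>Weakly immediate elements\<close>

locale valued_field_over = valued_field v + K: field_subfield K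
  for v :: "'a::alg_closed_field \<Rightarrow> 'g::linordered_ab_group_add" and K :: "'a set"
begin

text \<open>The downward closure is formed in the whole type of values, which keeps the divisible
  hull out of the arguments; \<open>distance_eq\<close> makes the connection.\<close>

definition cut :: "'a \<Rightarrow> 'g set" where
  "cut a = {g. \<exists>c\<in>K. g \<le> v (a - c)}"

lemma cut_downward: "x \<in> cut a \<Longrightarrow> y \<le> x \<Longrightarrow> y \<in> cut a"
  by (auto simp: cut_def intro: order_trans)

lemma cut_memI: "c \<in> K \<Longrightarrow> v (a - c) \<in> cut a"
  by (auto simp: cut_def)

lemma weakly_immediate_iff:
  "weakly_immediate v K a \<longleftrightarrow> a \<notin> K \<and> (\<forall>c\<in>K. \<exists>d\<in>K. v (a - c) < v (a - d))"
  by (auto simp: weakly_immediate_def difference_values_def not_le)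

text \<open>Every \<open>d\<close> closer to \<open>a\<close> than \<open>c\<close> has the same
  distance from \<open>c\<close> as \<open>a\<close>. In particular all values
  \<open>v (a - c)\<close> belong to \<open>vK\<close>.\<close>

lemma weakly_immediate_approx:
  assumes "weakly_immediate v K a" "c \<in> K"
  obtains d where "d \<in> K" "d \<noteq> c" "v (d - c) = v (a - c)" "v (a - c) < v (a - d)"
proof -
  obtain d where d: "d \<in> K" "v (a - c) < v (a - d)"
    using assms by (auto simp: weakly_immediate_iff)
  have ne: "a - c \<noteq> 0" "a - d \<noteq> 0" using assms d by (auto simp: weakly_immediate_iff)
  have "val_gt ((d - c) - (a - c)) (v (a - c))"
    using d(2) by (simp add: val_gt_def v_diff_commute)
  from val_eqI[OF ne(1) this] have "d - c \<noteq> 0" "v (d - c) = v (a - c)" by simp_all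
  then show ?thesis using d that by auto
qed

lemma weakly_immediate_cong:
  assumes "weakly_immediate v K a" and far: "\<And>c. c \<in> K \<Longrightarrow> val_gt (b - a) (v (a - c))"
  shows "weakly_immediate v K b" "\<And>c. c \<in> K \<Longrightarrow> v (b - c) = v (a - c)"
proof -
  have *: "b - c \<noteq> 0 \<and> v (b - c) = v (a - c)" if "c \<in> K" for c
    using val_eqI[of "a - c" "b - c"] assms that by (auto simp: weakly_immediate_iff)
  then show "\<And>c. c \<in> K \<Longrightarrow> v (b - c) = v (a - c)" by blast
  have "b \<notin> K" using * by force
  then show "weakly_immediate v K b" using assms(1) * by (auto simp: weakly_immediate_iff)
qed

lemma cut_cong: "(\<And>c. c \<in> K \<Longrightarrow> v (b - c) = v (a - c)) \<Longrightarrow> cut b = cut a"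
  by (auto simp: cut_def)

lemma convex_subgroup_cut: "convex_subgroup (stabilizer (cut a))"
  by (rule convex_subgroup_stabilizer) (rule cut_downward)

definition immediate_space :: "'a set \<Rightarrow> bool" where
  "immediate_space W \<longleftrightarrow> field_submodule K W \<and> K \<subseteq> W \<and> (\<forall>w\<in>W - K. weakly_immediate v K w)"

lemma immediate_space_approx:
  assumes "immediate_space W" "w \<in> W" "w \<noteq> 0"
  obtains e where "e \<in> K" "e \<noteq> 0" "v e = v w" "val_gt (w - e) (v w)"
proof (cases "w \<in> K")
  case True
  then show ?thesis using assms that[of w] by simp
next
  case False
  then have wi: "weakly_immediate v K w" using assms by (auto simp: immediate_space_def)
  obtain e where "e \<in> K" "e \<noteq> 0" "v (e - 0) = v (w - 0)" "v (w - 0) < v (w - e)"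
    using weakly_immediate_approx[OF wi K.zero_mem] by metis
  then show ?thesis using that[of e] by (simp add: val_gt_def)
qed

text \<open>For a cut \<open>C\<close> and a convex subgroup \<open>H\<close>: modulo
  \<open>H\<close>, the cut has a largest element. If it has none, elements can be approximated from
  \<open>K\<close> beyond any coset of \<open>H\<close> met by the cut.\<close>

definition narrow :: "'g set \<Rightarrow> 'g set \<Rightarrow> bool" where
  "narrow C H \<longleftrightarrow> (\<exists>\<alpha>\<in>C. \<forall>\<beta>\<in>C. \<exists>h\<in>H. \<beta> \<le> \<alpha> + h)"

lemma not_narrow_approx:
  assumes "\<not> narrow (cut w) H" "c \<in> K" "\<alpha> \<le> v (w - c)"
  obtains e where "e \<in> K" "\<And>h. h \<in> H \<Longrightarrow> val_gt (w - e) (\<alpha> + h)"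
proof -
  have "\<alpha> \<in> cut w" using assms by (auto simp: cut_def)
  then obtain \<beta> where \<beta>: "\<beta> \<in> cut w" "\<And>h. h \<in> H \<Longrightarrow> \<alpha> + h < \<beta>"
    using assms(1) unfolding narrow_def by (meson not_le)
  then obtain e where "e \<in> K" "\<beta> \<le> v (w - e)" by (auto simp: cut_def)
  then show ?thesis using that[of e] \<beta>(2) by (auto simp: val_gt_def intro: less_le_trans)
qed

end

text \<open>
  The last hypothesis expresses that the conjugates of \<open>a\<close> over \<open>K\<close> have the same distances from
  the elements of \<open>K\<close>.
\<close>

locale extension_step = valued_field_over v K
  for v :: "'a::alg_closed_field \<Rightarrow> 'g::linordered_ab_group_add" and K :: "'a set" +
  fixes W :: "'a set" and a :: 'a and p :: nat
  assumes W: "immediate_space W"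
    and a: "weakly_immediate v K a"
    and not_in_W: "b \<in> W \<Longrightarrow> \<exists>c\<in>K. a \<noteq> b \<and> v (a - b) < v (a - c)"
    and not_narrow: "w \<in> W - K \<Longrightarrow> \<not> narrow (cut w) (stabilizer (cut a))"
    and p: "0 < k \<Longrightarrow> k < p \<Longrightarrow> of_nat k \<noteq> (0 :: 'a) \<and> v (of_nat k) = 0"
    and conjugates: "\<exists>A. coeffs_in K (\<Prod>x\<in>#A. [:- x, 1:]) \<and> a \<in># A \<and>
      (\<forall>x\<in>#A. \<forall>c\<in>K. v (x - c) = v (a - c))"
begin

abbreviation H :: "'g set" where "H \<equiv> stabilizer (cut a)"

sublocale W: field_submodule K W
  using W by (simp add: immediate_space_def)

sublocale H: convex_subgroup H
  by (rule convex_subgroup_cut)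

sublocale coarse: valuation_ring_pair "coarse_ring H" "coarse_ideal H"
  by (rule valuation_ring_pair_coarse) (rule H.convex_subgroup_axioms)

lemma K_subset_W: "K \<subseteq> W"
  using W by (simp add: immediate_space_def)

lemma a_notin_K: "a \<notin> K"
  using a by (simp add: weakly_immediate_def)

lemma a_minus_nonzero: "c \<in> K \<Longrightarrow> a - c \<noteq> 0"
  using a_notin_K by auto

lemma W_approx_coarse:
  assumes "w \<in> W" "val_ge w \<alpha>"
  obtains e where "e \<in> K" "\<And>h. h \<in> H \<Longrightarrow> val_gt (w - e) (\<alpha> + h)"
proof (cases "w \<in> K")
  case True
  then show ?thesis using that[of w] by simp
next
  case False
  then have "\<not> narrow (cut w) H" "\<alpha> \<le> v (w - 0)"
    using assms not_narrow[of w] K.zero_mem by (auto simp: val_ge_def)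
  then show ?thesis using not_narrow_approx[of w H 0 \<alpha>] that K.zero_mem by metis
qed

lemma H_add_below:
  assumes "c \<in> K" "h \<in> H"
  obtains d where "d \<in> K" "v (a - c) + h < v (a - d)"
proof -
  have "v (a - c) + h \<in> cut a"
    using assms cut_memI[of c a] by (auto simp: stabilizer_def)
  then obtain d where d: "d \<in> K" "v (a - c) + h \<le> v (a - d)" by (auto simp: cut_def)
  then obtain d' where "d' \<in> K" "v (a - d) < v (a - d')" using a by (auto simp: weakly_immediate_iff)
  then show ?thesis using d that[of d'] by auto
qed

text \<open>
  Since \<open>cut a\<close> is a translate of \<open>H\<close>, elements of \<open>W\<close> are congruent to elements of \<open>K\<close> modulo
  elements of value above \<open>H\<close>; this reduces to the case of polynomials over \<open>K\<close>.
\<close>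

lemma no_simple_coarse_zero:
  assumes f: "coeffs_in W f"
    and c0: "c0 \<in> K" and top: "\<And>c. c \<in> K \<Longrightarrow> \<exists>h\<in>H. v (a - c) \<le> v (a - c0) + h"
    and t: "t = pcompose f [:a, 1:]" and t1: "Polynomial.coeff t 1 \<noteq> 0"
    and t_ge: "\<And>i. val_ge (Polynomial.coeff t i * (a - c0) ^ i) (v (Polynomial.coeff t 1 * (a - c0)))"
    and t_0: "\<And>h. h \<in> H \<Longrightarrow> val_gt (poly f a) (v (Polynomial.coeff t 1 * (a - c0)) + h)"
    and e: "e \<in> K" "e \<noteq> 0" "v e = v (Polynomial.coeff t 1)"
  shows False
proof -
  \<comment> \<open>Normalization: \<open>v (a - c0)\<close> is the value of some \<open>s\<close>
    in \<open>K\<close>, so that \<open>a\<close> becomes \<open>c0 + s * a'\<close> with a unit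
    \<open>a'\<close>.\<close>
  obtain d where d: "d \<in> K" "d \<noteq> c0" "v (d - c0) = v (a - c0)"
    using weakly_immediate_approx[OF a c0] by metis
  define s where "s = d - c0"
  have s: "s \<in> K" "s \<noteq> 0" "v s = v (a - c0)"
    using d c0 by (auto simp: s_def intro: K.minus_mem)
  define a' where "a' = (a - c0) / s"
  have a'_eq: "a = c0 + s * a'" using s by (simp add: a'_def)
  have va': "a' \<noteq> 0" "v a' = 0"
    using s a_minus_nonzero[OF c0] by (simp_all add: a'_def v_divide)
  \<comment> \<open>After the substitution, division by \<open>e * s\<close> makes the linear Taylor
    coefficient at \<open>a'\<close> a unit and all others integral.\<close>
  define f' where "f' = smult (inverse (e * s)) (pcompose f [:c0, s:])"
  have f'W: "coeffs_in W f'"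
    unfolding f'_def using f c0 s e
    by (intro W.coeffs_in_smult W.coeffs_in_pcompose) (auto intro: K.inverse_mem K.mult_mem)
  define g where "g = pcompose f' [:a', 1:]"
  have f'_eq: "f' = pcompose g [:- a', 1:]"
  proof -
    have "pcompose [:a', 1:] [:- a', 1:] = [:0, 1:]" by (simp add: pcompose_pCons)
    then show ?thesis by (simp only: g_def pcompose_assoc[symmetric] pcompose_idR)
  qed
  have g_eq: "g = smult (inverse (e * s)) (pcompose t [:0, s:])"
  proof -
    have "pcompose [:c0, s:] [:a', 1:] = [:a, s:]"
      by (simp add: pcompose_pCons a'_eq[symmetric])
    moreover have "pcompose [:a, 1:] [:0, s:] = [:a, s:]" by (simp add: pcompose_pCons)
    ultimately show ?thesis
      by (simp only: g_def f'_def t pcompose_smult pcompose_assoc[symmetric])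
  qed
  have cg: "Polynomial.coeff g i = Polynomial.coeff t i * s ^ i / (e * s)" for i
    unfolding g_eq coeff_smult coeff_pcompose_linear by (simp add: divide_inverse mult_ac)
  have es: "e * s \<noteq> 0" "v (e * s) = v (Polynomial.coeff t 1 * (a - c0))"
    using e s t1 a_minus_nonzero[OF c0] by (auto simp: v_mult)
  have val_s: "v (Polynomial.coeff t i * s ^ i) = v (Polynomial.coeff t i * (a - c0) ^ i)"
    if "Polynomial.coeff t i \<noteq> 0" for i
    using that s(2) a_minus_nonzero[OF c0] v_power_cong[OF s(2) a_minus_nonzero[OF c0] s(3), of i]
    by (simp add: v_mult)
  have g_ge: "val_ge (Polynomial.coeff g i) 0" for i
  proof (cases "Polynomial.coeff t i = 0")
    case False
    then have "v (Polynomial.coeff t 1 * (a - c0)) \<le> v (Polynomial.coeff t i * s ^ i)"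
      using t_ge[of i] val_s[of i] a_minus_nonzero[OF c0] by (simp add: val_ge_def)
    then show ?thesis unfolding cg val_ge_divide_iff[OF es(1)] es(2) by (simp add: val_ge_def)
  qed (simp add: cg)
  have ring0: "x \<in> coarse_ring H" if "val_ge x 0" for x
    using that H.H_zero unfolding coarse_ring_def by blast
  have a'R: "a' \<in> coarse_ring H" using va' by (intro ring0) (simp add: val_ge_def)
  have g0: "poly f' a' \<in> coarse_ideal H"
  proof -
    have "poly f' a' = poly f a / (e * s)"
      using es by (simp add: f'_def poly_pcompose a'_eq field_simps)
    then show ?thesis
      using t_0 es by (auto simp: coarse_ideal_def val_gt_divide_iff add.commute)
  qed
  have f'_ge: "coeffs_in {x. val_ge x 0} f'"
  proof -
    interpret O: field_subring "{x. val_ge x 0}"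
    proof
      show "x * y \<in> {x. val_ge x 0}" if "x \<in> {x. val_ge x 0}" "y \<in> {x. val_ge x 0}" for x y
        using that val_ge_mult[of x 0 y 0] by simp
      show "x + y \<in> {x. val_ge x 0}" if "x \<in> {x. val_ge x 0}" "y \<in> {x. val_ge x 0}" for x y
        using that val_ge_add[of x 0 y] by simp
    qed (auto simp: val_ge_def)
    show ?thesis
      unfolding f'_eq using g_ge va'
      by (intro O.self.coeffs_in_pcompose) (auto simp: coeffs_in_def val_ge_def coeff_pCons split: nat.splits)
  qed
  \<comment> \<open>Here the order of the elements enters: no cut of an element of
    \<open>W - K\<close> is narrow, so each coefficient is congruent to an element of
    \<open>K\<close> modulo the coarse ideal.\<close>
  have "\<forall>i. \<exists>e\<in>K. Polynomial.coeff f' i - e \<in> coarse_ideal H"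
  proof
    fix i
    have "Polynomial.coeff f' i \<in> W" "val_ge (Polynomial.coeff f' i) 0"
      using f'W f'_ge by (auto simp: coeffs_in_def)
    then obtain e where "e \<in> K" "\<And>h. h \<in> H \<Longrightarrow> val_gt (Polynomial.coeff f' i - e) (0 + h)"
      using W_approx_coarse by blast
    then show "\<exists>e\<in>K. Polynomial.coeff f' i - e \<in> coarse_ideal H" by (auto simp: coarse_ideal_def)
  qed
  then obtain G where G: "\<And>i. G i \<in> K" "\<And>i. Polynomial.coeff f' i - G i \<in> coarse_ideal H" by metis
  define q where "q = (\<Sum>i\<le>Polynomial.degree f'. monom (G i) i)"
  have cq: "Polynomial.coeff q i = (if i \<le> Polynomial.degree f' then G i else 0)" for i
    unfolding q_def by (auto simp: coeff_sum sum.delta)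
  have diff: "coeffs_in (coarse_ideal H) (f' - q)"
    using G(2) coarse.M_zero by (auto simp: coeffs_in_def cq coeff_eq_0)
  have f'R: "coeffs_in (coarse_ring H) f'"
    using f'_ge ring0 by (auto simp: coeffs_in_def)
  have "coeffs_in (coarse_ring H) (f' - (f' - q))"
    by (rule coarse.self.coeffs_in_diff[OF f'R])
      (use diff coarse.M_subset in \<open>auto simp: coeffs_in_def\<close>)
  then have qKR: "coeffs_in (K \<inter> coarse_ring H) q"
    using G(1) by (auto simp: coeffs_in_def cq)
  have qa: "poly q a' \<in> coarse_ideal H"
    using coarse.M.W_diff[OF g0 coarse.M.poly_mem[OF diff a'R]] by simp
  obtain A where A: "coeffs_in K (\<Prod>x\<in>#A. [:- x, 1:])" "a \<in># A"
      "\<And>x c. x \<in># A \<Longrightarrow> c \<in> K \<Longrightarrow> v (x - c) = v (a - c)"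
    using conjugates by blast
  define A' where "A' = image_mset (\<lambda>x. (x - c0) / s) A"
  have "(\<Prod>x\<in>#image_mset (\<lambda>x. (x - c0) / s) B. [:- x, 1:]) =
      smult (inverse s ^ size B) (pcompose (\<Prod>x\<in>#B. [:- x, 1:]) [:c0, s:])" for B
  proof (induction B)
    case (add x B)
    have "[:- ((x - c0) / s), 1:] = smult (inverse s) (pcompose [:- x, 1:] [:c0, s:])"
      using s by (simp add: pcompose_pCons field_simps)
    then show ?case
      by (simp only: image_mset_add_mset prod_mset.add_mset add.IH pcompose_mult size_add_mset power_Suc
          mult_smult_left mult_smult_right smult_smult mult.commute)
  qed (simp add: pcompose_1)
  then have FK: "coeffs_in K (\<Prod>x\<in>#A'. [:- x, 1:])"
    unfolding A'_def using A(1) s c0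
    by (auto intro!: K.self.coeffs_in_smult K.self.coeffs_in_pcompose K.self.power_mem K.inverse_mem)
  \<comment> \<open>A conjugate \<open>y\<close> has \<open>v (y - d) = v (a - d)\<close> for all
    \<open>d\<close> in \<open>K\<close>, so \<open>y - a\<close> has a value beyond the whole cut,
    which contains \<open>v (a - c0) + H\<close>.\<close>
  have near: "x - a' \<in> coarse_ideal H" if x: "x \<in># A'" for x
  proof -
    obtain y where y: "y \<in># A" "x = (y - c0) / s" using x by (auto simp: A'_def)
    have eq: "x - a' = (y - a) / s" by (simp add: y a'_def diff_divide_distrib)
    have "val_gt (x - a') h" if h: "h \<in> H" for h
    proof -
      obtain d where d: "d \<in> K" "v (a - c0) + h < v (a - d)" using H_add_below[OF c0 h] .
      have "val_ge ((y - d) - (a - d)) (v (a - d))"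
        using A(3)[OF y(1) d(1)] by (intro val_ge_diff[of "y - d" _ "a - d"]) (auto simp: val_ge_def)
      then have "val_gt (y - a) (h + v s)" using d s by (auto intro: val_ge_less simp: add.commute)
      then show ?thesis unfolding eq using s by (simp add: val_gt_divide_iff)
    qed
    then show ?thesis by (simp add: coarse_ideal_def)
  qed
  have "poly (pderiv q) a' \<in> coarse_ideal H"
  proof (rule pderiv_mem_M[OF coarse.valuation_ring_pair_axioms K.field_subfield_axioms FK refl a'R _ near _ qKR qa])
    show "a' \<in># A'" using A(2) by (auto simp: A'_def a'_def)
    fix c assume c: "c \<in> K"
    have "c0 + s * c \<in> K" using c c0 s by (intro K.add_mem K.mult_mem)
    from top[OF this] obtain h where h: "h \<in> H" "v (a - (c0 + s * c)) \<le> v (a - c0) + h" by blast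
    have "a - (c0 + s * c) = (a' - c) * s" unfolding a'_eq by (simp add: algebra_simps)
    moreover from this have "a' - c \<noteq> 0" using a_minus_nonzero[OF \<open>c0 + s * c \<in> K\<close>] by auto
    ultimately have "v (a' - c) \<le> h" using h s by (simp add: v_mult add.commute)
    then show "a' - c \<notin> coarse_ideal H"
      using h \<open>a' - c \<noteq> 0\<close> by (auto simp: coarse_ideal_def val_gt_def not_less)
  qed
  moreover have "poly (pderiv (f' - q)) a' \<in> coarse_ideal H"
    by (intro coarse.M.poly_mem coarse.M.coeffs_in_pderiv diff a'R)
  ultimately have "poly (pderiv f') a' \<in> coarse_ideal H"
    using coarse.M_add by (fastforce simp: pderiv_diff)
  moreover have "poly (pderiv f') a' = Polynomial.coeff g 1"
  proof -
    have "pderiv g = pcompose (pderiv f') [:a', 1:]"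
      unfolding g_def by (simp add: pderiv_pcompose pderiv_pCons)
    then have "poly (pderiv g) 0 = poly (pderiv f') a'" by (simp add: poly_pcompose)
    then show ?thesis by (simp add: poly_0_coeff_0 coeff_pderiv)
  qed
  \<comment> \<open>The normalization gave this coefficient the value 0.\<close>
  ultimately have "val_gt (Polynomial.coeff g 1) 0" using H.H_zero by (auto simp: coarse_ideal_def)
  then show False using t1 s e by (auto simp: cg val_gt_def v_divide)
qed

text \<open>The coefficients of \<open>pcompose f [:a, 1:]\<close> are the Taylor coefficients of
  \<open>f\<close> at \<open>a\<close>. The condition makes \<open>v (poly f c)\<close> equal to
  \<open>v (poly f a)\<close> for all \<open>c\<close> in \<open>K\<close> near \<open>a\<close>; by
  \<open>val_closer\<close> it persists when \<open>c\<close> is replaced by an element closer to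
  \<open>a\<close>.\<close>

definition dominated :: "'a poly \<Rightarrow> bool" where
  "dominated f \<longleftrightarrow> poly f a \<noteq> 0 \<and> (\<exists>c\<in>K. \<forall>i\<ge>1.
    val_gt (Polynomial.coeff (pcompose f [:a, 1:]) i * (a - c) ^ i) (v (poly f a)))"

lemma val_closer:
  assumes "c \<in> K" "d \<in> K" "v (a - d) \<le> v (a - c)"
  shows "val_gt (x * (a - d) ^ i) g \<Longrightarrow> val_gt (x * (a - c) ^ i) g"
    and "val_ge (x * (a - d) ^ i) g \<Longrightarrow> val_ge (x * (a - c) ^ i) g"
proof -
  have "v ((a - d) ^ i) \<le> v ((a - c) ^ i)"
    using assms a_minus_nonzero by (intro v_power_mono)
  then show "val_gt (x * (a - d) ^ i) g \<Longrightarrow> val_gt (x * (a - c) ^ i) g"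
    and "val_ge (x * (a - d) ^ i) g \<Longrightarrow> val_ge (x * (a - c) ^ i) g"
    using a_minus_nonzero[OF assms(1)] a_minus_nonzero[OF assms(2)]
    by (cases "x = 0"; auto simp: val_gt_def val_ge_def v_mult intro: less_le_trans order_trans add_left_mono)+
qed

lemma coeff_taylor_pderiv:
  "Polynomial.coeff (pcompose (pderiv f) [:a, 1:]) i =
    of_nat (Suc i) * Polynomial.coeff (pcompose f [:a, 1:]) (Suc i)"
proof -
  have "pcompose (pderiv f) [:a, 1:] = pderiv (pcompose f [:a, 1:])"
    by (simp add: pderiv_pcompose pderiv_pCons)
  then show ?thesis by (simp add: coeff_pderiv)
qed

lemma poly_pderiv_taylor: "poly (pderiv f) a = Polynomial.coeff (pcompose f [:a, 1:]) 1"
  using coeff_taylor_pderiv[of f 0] poly_0_coeff_0[of "pcompose (pderiv f) [:a, 1:]"]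
  by (simp add: poly_pcompose)

lemma pderiv_small_degree:
  fixes f :: "'a poly"
  assumes "0 < Polynomial.degree f" "Polynomial.degree f < p"
  shows "pderiv f \<noteq> 0" "Polynomial.degree (pderiv f) < Polynomial.degree f"
proof -
  have "f \<noteq> 0" using assms(1) by auto
  then have "Polynomial.coeff (pderiv f) (Polynomial.degree f - 1) \<noteq> 0"
    using assms(1) p[OF assms] by (simp add: coeff_pderiv leading_coeff_0_iff del: of_nat_Suc)
  then show "pderiv f \<noteq> 0" by auto
  have "Polynomial.degree (pderiv f) \<le> Polynomial.degree f - 1"
    by (rule degree_le) (auto simp: coeff_pderiv coeff_eq_0)
  then show "Polynomial.degree (pderiv f) < Polynomial.degree f" using assms(1) by simp
qed

text \<open>The Taylor coefficients of the derivative are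
  \<open>of_nat (Suc i) * \<tau> (Suc i)\<close>, where \<open>Suc i\<close> is a unit up to the
  degree of \<open>f\<close>. Dominance of the constant term of the derivative is thus dominance of
  the linear term of \<open>f\<close> over the higher ones.\<close>

lemma linear_term_dominates:
  assumes deg: "Polynomial.degree f < p" and dom: "dominated (pderiv f)"
  defines "\<tau> \<equiv> Polynomial.coeff (pcompose f [:a, 1:])"
  shows "\<tau> 1 \<noteq> 0" "\<exists>c1\<in>K. \<forall>c\<in>K. v (a - c1) \<le> v (a - c) \<longrightarrow>
    val_gt (poly (pderiv f) c - \<tau> 1) (v (\<tau> 1)) \<and> (\<forall>i\<ge>1. val_gt (\<tau> (Suc i) * (a - c) ^ i) (v (\<tau> 1)))"
proof -
  define t' where "t' = pcompose (pderiv f) [:a, 1:]"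
  have ct': "Polynomial.coeff t' i = of_nat (Suc i) * \<tau> (Suc i)" for i
    unfolding t'_def \<tau>_def by (rule coeff_taylor_pderiv)
  obtain c1 where \<tau>1: "\<tau> 1 \<noteq> 0" and c1: "c1 \<in> K"
    and dom1: "\<And>i. i \<ge> 1 \<Longrightarrow> val_gt (Polynomial.coeff t' i * (a - c1) ^ i) (v (\<tau> 1))"
    using dom unfolding dominated_def poly_pderiv_taylor t'_def \<tau>_def by blast
  show "\<tau> 1 \<noteq> 0" by fact
  have "val_gt (poly (pderiv f) c - \<tau> 1) (v (\<tau> 1)) \<and> (\<forall>i\<ge>1. val_gt (\<tau> (Suc i) * (a - c) ^ i) (v (\<tau> 1)))"
    if c: "c \<in> K" "v (a - c1) \<le> v (a - c)" for c
  proof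
    have dom_c: "val_gt (Polynomial.coeff t' i * (a - c) ^ i) (v (\<tau> 1))" if "i \<ge> 1" for i
      using dom1[OF that] by (rule val_closer(1)[OF c(1) c1 c(2)])
    have "val_gt (poly t' (c - a) - (\<Sum>i<1. Polynomial.coeff t' i * (c - a) ^ i)) (v (\<tau> 1))"
      by (rule val_gt_poly_minus_sum) (simp only: val_power_minus_commute(1)[of _ c a] dom_c)
    then show "val_gt (poly (pderiv f) c - \<tau> 1) (v (\<tau> 1))"
      using ct'[of 0] by (simp add: t'_def poly_pcompose)
    show "\<forall>i\<ge>1. val_gt (\<tau> (Suc i) * (a - c) ^ i) (v (\<tau> 1))"
    proof (intro allI impI)
      fix i :: nat assume i: "i \<ge> 1"
      show "val_gt (\<tau> (Suc i) * (a - c) ^ i) (v (\<tau> 1))"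
      proof (cases "Suc i \<le> Polynomial.degree f")
        case True
        then have "of_nat (Suc i) \<noteq> (0 :: 'a)" "v (of_nat (Suc i)) = 0"
          using p[of "Suc i"] deg by auto
        then show ?thesis
          using dom_c[OF i] val_gt_times_iff[of "of_nat (Suc i)" "\<tau> (Suc i) * (a - c) ^ i" "v (\<tau> 1)"]
          unfolding ct' by (simp add: mult_ac del: of_nat_Suc)
      next
        case False
        then have "\<tau> (Suc i) = 0"
          using degree_pcompose[of f "[:a, 1:]"] by (simp add: \<tau>_def coeff_eq_0)
        then show ?thesis by simp
      qed
    qed
  qed
  then show "\<exists>c1\<in>K. \<forall>c\<in>K. v (a - c1) \<le> v (a - c) \<longrightarrow>
    val_gt (poly (pderiv f) c - \<tau> 1) (v (\<tau> 1)) \<and> (\<forall>i\<ge>1. val_gt (\<tau> (Suc i) * (a - c) ^ i) (v (\<tau> 1)))"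
    using c1 by blast
qed

text \<open>By induction the derivative is dominated, so a failure can only come from the linear
  term. The value of \<open>poly f a\<close> then exceeds the cut of \<open>a\<close> shifted by
  \<open>v (\<tau> 1)\<close>, that is, \<open>a\<close> behaves like a simple zero of
  \<open>f\<close> as far as \<open>K\<close> can tell.\<close>

lemma taylor_dominated:
  assumes "coeffs_in W f" "f \<noteq> 0" "Polynomial.degree f < p"
  shows "dominated f"
  using assms
proof (induction "Polynomial.degree f" arbitrary: f rule: less_induct)
  case less
  note f = less.prems
  define k where "k = Polynomial.degree f"
  define t where "t = pcompose f [:a, 1:]"
  define \<tau> where "\<tau> i = Polynomial.coeff t i" for i
  have deg_t: "Polynomial.degree t = k"
    unfolding t_def k_def using degree_pcompose[of f "[:a, 1:]"] by simp
  have \<tau>_0: "\<tau> i = 0" if "i > k" for i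
    using that deg_t by (simp add: \<tau>_def coeff_eq_0)
  have poly_t: "poly f c = poly t (c - a)" for c by (simp add: t_def poly_pcompose)
  have \<tau>0: "\<tau> 0 = poly f a" by (simp add: \<tau>_def poly_t poly_0_coeff_0)
  show ?case
  proof (cases "k = 0")
    case True
    then obtain x where "f = [:x:]" by (auto simp: k_def elim: degree_eq_zeroE)
    moreover have "\<exists>c. c \<in> K" using K.zero_mem by blast
    ultimately show ?thesis using f(2)
      by (auto simp: dominated_def coeff_pCons split: nat.splits)
  next
    case False
    then have k: "0 < k" "k < p" using f(3) by (auto simp: k_def)
    define f1 where "f1 = pderiv f"
    have f1W: "coeffs_in W f1" unfolding f1_def by (rule W.coeffs_in_pderiv[OF f(1)])
    have f1: "f1 \<noteq> 0" "Polynomial.degree f1 < k"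
      using pderiv_small_degree[of f] k by (simp_all add: f1_def k_def)
    define t' where "t' = pcompose f1 [:a, 1:]"
    have ct': "Polynomial.coeff t' i = of_nat (Suc i) * \<tau> (Suc i)" for i
      unfolding t'_def f1_def \<tau>_def t_def by (rule coeff_taylor_pderiv)
    have poly_t': "poly f1 c = poly t' (c - a)" for c by (simp add: t'_def poly_pcompose)
    have "dominated f1" using f1 k by (intro less.hyps f1W) (auto simp: k_def)
    note linear = linear_term_dominates[OF f(3) this[unfolded f1_def], folded t_def f1_def, folded \<tau>_def]
    have \<tau>1: "\<tau> 1 \<noteq> 0" by (rule linear(1))
    obtain c1 where c1: "c1 \<in> K"
      and dom: "\<And>c. c \<in> K \<Longrightarrow> v (a - c1) \<le> v (a - c) \<Longrightarrow> val_gt (poly f1 c - \<tau> 1) (v (\<tau> 1)) \<and>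
        (\<forall>i\<ge>1. val_gt (\<tau> (Suc i) * (a - c) ^ i) (v (\<tau> 1)))"
      using linear(2) by blast
    define close where "close c \<longleftrightarrow> c \<in> K \<and> v (a - c1) \<le> v (a - c)" for c
    have closeK: "c \<in> K" if "close c" for c using that by (simp add: close_def)
    have dom': "val_gt (\<tau> (Suc i) * (a - c) ^ i) (v (\<tau> 1))" if "i \<ge> 1" "close c" for i c
      using dom[of c] that by (simp add: close_def)
    have u_near: "val_gt (poly f1 c - \<tau> 1) (v (\<tau> 1))" if "close c" for c
      using dom[of c] that by (simp add: close_def)
    have dom'': "val_gt (\<tau> (Suc i) * (a - c) ^ Suc i) (v (\<tau> 1 * (a - c)))" if "i \<ge> 1" "close c" for i c
      using val_gt_times_iff[of "a - c" "\<tau> (Suc i) * (a - c) ^ i" "v (\<tau> 1)"] dom'[OF that] \<tau>1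
        a_minus_nonzero[OF closeK[OF that(2)]] by (simp add: v_mult mult_ac add.commute)
    show ?thesis
    proof (rule ccontr)
      assume contra: "\<not> ?thesis"
      have fa_ge: "val_ge (poly f a) (v (\<tau> 1 * (a - c)))" if c: "close c" for c
      proof (rule ccontr)
        assume *: "\<not> ?thesis"
        have "val_gt (\<tau> i * (a - c) ^ i) (v (poly f a))" if i1: "i \<ge> 1" for i
        proof (cases "i = 1")
          case True
          then show ?thesis using * by (simp add: val_gt_def val_ge_def not_le)
        next
          case False
          then obtain j where j: "i = Suc j" "j \<ge> 1" using i1 by (cases i) auto
          have "v (poly f a) \<le> v (\<tau> 1 * (a - c))" using * by (simp add: val_ge_def not_le less_imp_le)
          with dom''[OF j(2) c] show ?thesis unfolding j(1) by (rule val_gt_mono)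
        qed
        then show False using contra * closeK[OF c] unfolding \<tau>_def t_def dominated_def by (auto simp: val_ge_def)
      qed
      \<comment> \<open>Some higher term must remain within \<open>H\<close> of the linear
        coefficient; otherwise all errors of a Newton step are smaller by an amount outside
        \<open>H\<close>, and the step would shift the cut by an amount that does not stabilize
        it.\<close>
      have "\<exists>j\<ge>1. \<tau> (Suc j) \<noteq> 0 \<and> v (\<tau> (Suc j) * (a - c) ^ j) - v (\<tau> 1) \<in> H" if c: "close c" for c
      proof (rule ccontr)
        assume neg: "\<not> ?thesis"
        have cK: "c \<in> K" using c by (rule closeK)
        define u where "u = poly f1 c"
        have uW: "u \<in> W" unfolding u_def by (rule W.poly_mem[OF f1W cK])
        have u: "u \<noteq> 0" "v u = v (\<tau> 1)"
          using val_eqI[OF \<tau>1 u_near[OF c]] by (simp_all add: u_def)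
        obtain e where e: "e \<in> K" "\<And>h. h \<in> H \<Longrightarrow> val_gt (u - e) (v (\<tau> 1) + h)"
          using W_approx_coarse[OF uW, of "v (\<tau> 1)"] u by (auto simp: val_ge_def)
        have "val_gt (e - u) (v u)"
          using e(2)[OF H.H_zero] u by (simp add: val_gt_minus_commute)
        from val_eqI[OF u(1) this] have e_nz: "e \<noteq> 0" and ve: "v e = v (\<tau> 1)" using u by auto
        \<comment> \<open>The errors of a Newton step: the replacement of the derivative at
          \<open>c\<close> by \<open>e\<close>, and the Taylor terms from order two on, divided by
          \<open>a - c\<close>. Zeros are dropped since their values are meaningless.\<close>
        define Y where "Y = insert (u - e) ((\<lambda>j. \<tau> (Suc j) * (a - c) ^ j) ` {1..k}) - {0}"
        have Y_fin: "finite Y" by (simp add: Y_def)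
        have Y_pos: "0 < v y - v (\<tau> 1)" "v y - v (\<tau> 1) \<notin> H" if "y \<in> Y" for y
        proof -
          from that consider "y = u - e" "y \<noteq> 0" | j where "j \<ge> 1" "y = \<tau> (Suc j) * (a - c) ^ j" "y \<noteq> 0"
            by (auto simp: Y_def)
          then have "0 < v y - v (\<tau> 1) \<and> v y - v (\<tau> 1) \<notin> H"
          proof cases
            case 1
            then have "v (\<tau> 1) + h < v y" if "h \<in> H" for h using e(2)[OF that] by (simp add: val_gt_def)
            from this[OF H.H_zero] this[of "v y - v (\<tau> 1)"] show ?thesis by auto
          next
            case 2
            then show ?thesis using neg dom'[OF _ c, of j] by (auto simp: val_gt_def)
          qed
          then show "0 < v y - v (\<tau> 1)" "v y - v (\<tau> 1) \<notin> H" by auto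
        qed
        text \<open>A Newton step with denominator \<open>e\<close>: the approximation \<open>c' - poly f c' / e\<close> lies in \<open>W\<close>.\<close>
        have newton: "\<exists>d\<in>K. z \<noteq> 0 \<and> v z < v (\<tau> 1) + v (a - d)"
          if c': "close c'" and z: "z = (e - \<tau> 1) * (a - c') + (poly f c' - (poly f a + \<tau> 1 * (c' - a)))"
          for c' z
        proof -
          define b where "b = c' - inverse e * poly f c'"
          have c'K: "c' \<in> K" using c' by (rule closeK)
          have "b \<in> W"
            unfolding b_def using c'K e(1) K_subset_W
            by (intro W.W_diff W.W_scale W.poly_mem[OF f(1)] K.inverse_mem) auto
          \<comment> \<open>The Newton iterate \<open>b\<close> belongs to \<open>W\<close>, hence
            some element of \<open>K\<close> is closer to \<open>a\<close>.\<close>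
          then obtain d0 where d0: "d0 \<in> K" "a \<noteq> b" "v (a - b) < v (a - d0)" using not_in_W by blast
          obtain d where d: "d \<in> K" "v (a - b) < v (a - d)" "close d"
          proof (cases "v (a - c1) \<le> v (a - d0)")
            case True
            then show ?thesis using d0 that[of d0] by (simp add: close_def)
          next
            case False
            then show ?thesis using d0 c1 that[of c1] by (simp add: close_def)
          qed
          \<comment> \<open>Two readings of \<open>z\<close>: this one yields its exact value, while
            the Taylor form in its definition yields a lower bound through the errors in
            \<open>Y\<close>.\<close>
          have eq: "z = e * (a - b) - poly f a"
            using e_nz unfolding z b_def by (simp add: algebra_simps)
          have ab: "e * (a - b) \<noteq> 0" "v (e * (a - b)) = v (\<tau> 1) + v (a - b)"
            using d0(2) e_nz ve by (auto simp: v_mult)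
          have "val_ge (poly f a) (v (\<tau> 1) + v (a - d))"
            using fa_ge[OF d(3)] \<tau>1 a_minus_nonzero[OF d(1)] by (simp add: v_mult)
          then have "val_gt (z - e * (a - b)) (v (e * (a - b)))"
            unfolding eq ab(2) using d(2) by (simp add: val_ge_less)
          from val_eqI[OF ab(1) this] have "z \<noteq> 0" "v z = v (\<tau> 1) + v (a - b)" using ab by auto
          then show ?thesis using d by auto
        qed
        have X_ge: "val_ge ((e - \<tau> 1) * (a - c') + (poly f c' - (poly f a + \<tau> 1 * (c' - a)))) (g + v (a - c'))"
          if Yg: "\<And>y. y \<in> Y \<Longrightarrow> g \<le> v y" and c': "c' \<in> K" "v (a - c) \<le> v (a - c')" for c' g
        proof -
          have \<tau>_ge: "val_ge (\<tau> (Suc j) * (a - c) ^ j) g" if "j \<ge> 1" for j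
          proof (cases "\<tau> (Suc j) = 0")
            case False
            then have "j \<in> {1..k}" using \<tau>_0[of "Suc j"] that by (cases "j \<le> k") auto
            moreover have "\<tau> (Suc j) * (a - c) ^ j \<noteq> 0"
              using False a_minus_nonzero[OF cK] by simp
            ultimately have "\<tau> (Suc j) * (a - c) ^ j \<in> Y" unfolding Y_def by blast
            then show ?thesis using Yg by (simp add: val_ge_def)
          qed simp
          have of_nat_ge: "val_ge (of_nat i * x) g" if "val_ge x g" for i x
            using that by (induction i) (auto simp: ring_distribs intro: val_ge_add)
          have "val_ge (poly t' (c - a) - (\<Sum>i<1. Polynomial.coeff t' i * (c - a) ^ i)) g"
            by (rule val_ge_poly_minus_sum)
              (auto simp: val_power_minus_commute(2)[of _ c a] ct' mult.assoc simp del: of_nat_Suc intro!: of_nat_ge \<tau>_ge)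
          then have "val_ge (u - \<tau> 1) g" by (simp add: u_def poly_t' ct')
          moreover have "val_ge (u - e) g"
          proof (cases "u - e = 0")
            case False
            then have "u - e \<in> Y" unfolding Y_def by blast
            then show ?thesis using Yg by (simp add: val_ge_def)
          qed (simp only: val_ge_0)
          ultimately have "val_ge ((u - \<tau> 1) - (u - e)) g" by (rule val_ge_diff)
          then have 1: "val_ge ((e - \<tau> 1) * (a - c')) (g + v (a - c'))"
            by (intro val_ge_mult) auto
          have "val_ge (poly t (c' - a) - (\<Sum>i<2. Polynomial.coeff t i * (c' - a) ^ i)) (g + v (a - c'))"
          proof (rule val_ge_poly_minus_sum)
            fix i :: nat assume "2 \<le> i"
            then obtain j where j: "i = Suc j" "j \<ge> 1" by (cases i) auto
            have "val_ge (\<tau> (Suc j) * (a - c') ^ j * (a - c')) (g + v (a - c'))"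
              using val_closer(2)[OF c'(1) cK c'(2) \<tau>_ge[OF j(2)]] by (intro val_ge_mult) auto
            then show "val_ge (Polynomial.coeff t i * (c' - a) ^ i) (g + v (a - c'))"
              unfolding val_power_minus_commute(2)[of _ c' a] j \<tau>_def by (simp add: mult_ac)
          qed
          moreover have "(\<Sum>i<2. Polynomial.coeff t i * (c' - a) ^ i) = poly f a + \<tau> 1 * (c' - a)"
            using \<tau>0 by (simp add: numeral_2_eq_2 \<tau>_def)
          ultimately have 2: "val_ge (poly f c' - (poly f a + \<tau> 1 * (c' - a))) (g + v (a - c'))"
            by (simp add: poly_t)
          show ?thesis using 1 2 by (rule val_ge_add)
        qed
        show False
        proof (cases "Y = {}")
          case True
          \<comment> \<open>Without errors the lower bound on \<open>v z\<close> holds for every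
            \<open>g\<close>, in particular for one that contradicts \<open>newton\<close>.\<close>
          define z where "z = (e - \<tau> 1) * (a - c) + (poly f c - (poly f a + \<tau> 1 * (c - a)))"
          obtain d where d: "d \<in> K" "z \<noteq> 0" "v z < v (\<tau> 1) + v (a - d)"
            using newton[OF c z_def] by blast
          have "val_ge z (v (\<tau> 1) + v (a - d) - v (a - c) + v (a - c))"
            unfolding z_def using True cK by (intro X_ge) auto
          then show False using d by (simp add: val_ge_def)
        next
          case False
          then obtain y where y: "y \<in> Y" "\<And>y'. y' \<in> Y \<Longrightarrow> v y \<le> v y'"
            using ex_min_if_finite[of "v ` Y"] Y_fin by (auto simp: not_less)
          \<comment> \<open>For the least error \<open>y\<close>, a Newton step from any close
            \<open>c'\<close> produces an element of \<open>K\<close> whose distance from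
            \<open>a\<close> exceeds \<open>v (a - c')\<close> by at least
            \<open>v y - v (\<tau> 1)\<close>. So translation by this amount preserves the
            cut.\<close>
          have "v y - v (\<tau> 1) \<in> H"
          proof (rule stabilizerI)
            show "r \<in> cut a" if "q \<in> cut a" "r \<le> q" for q r using that by (rule cut_downward)
            show "0 \<le> v y - v (\<tau> 1)" using Y_pos[OF y(1)] by simp
            fix x assume "x \<in> cut a"
            then obtain d where d: "d \<in> K" "x \<le> v (a - d)" by (auto simp: cut_def)
            define c' where "c' = (if v (a - c) \<le> v (a - d) then d else c)"
            have c': "c' \<in> K" "v (a - c) \<le> v (a - c')" "x \<le> v (a - c')" "close c'"
              using c d cK by (auto simp: c'_def close_def)
            obtain d' where d': "d' \<in> K" 
              "v ((e - \<tau> 1) * (a - c') + (poly f c' - (poly f a + \<tau> 1 * (c' - a)))) < v (\<tau> 1) + v (a - d')"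
              "(e - \<tau> 1) * (a - c') + (poly f c' - (poly f a + \<tau> 1 * (c' - a))) \<noteq> 0"
              using newton[OF c'(4) refl] by blast
            have "v y + v (a - c') \<le> v ((e - \<tau> 1) * (a - c') + (poly f c' - (poly f a + \<tau> 1 * (c' - a))))"
              using X_ge[OF y(2) c'(1,2)] d'(3) by (simp add: val_ge_def)
            also note d'(2)
            finally have "v y + v (a - c') < v (\<tau> 1) + v (a - d')" .
            then have "v (a - c') + (v y - v (\<tau> 1)) \<le> v (a - d')" by (simp add: algebra_simps)
            then have "x + (v y - v (\<tau> 1)) \<le> v (a - d')"
              using c'(3) by (meson add_right_mono order_trans)
            then show "x + (v y - v (\<tau> 1)) \<in> cut a" using d'(1) by (auto simp: cut_def)
          qed
          then show False using Y_pos[OF y(1)] by simp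
        qed
      qed
      note flat = this
      \<comment> \<open>At \<open>c1\<close> the term of index \<open>Suc j\<close> already exceeds
        \<open>v (\<tau> 1)\<close>; on passing to \<open>c\<close> its value grows by at least
        \<open>v (a - c) - v (a - c1)\<close>, since \<open>j\<close> is positive. By
        \<open>flat\<close> the total stays in \<open>H\<close>.\<close>
      have top: "\<exists>h\<in>H. v (a - c) \<le> v (a - c1) + h" if c: "c \<in> K" for c
      proof (cases "v (a - c1) \<le> v (a - c)")
        case True
        then have cc: "close c" using c by (simp add: close_def)
        obtain j where j: "j \<ge> 1" "\<tau> (Suc j) \<noteq> 0" "v (\<tau> (Suc j) * (a - c) ^ j) - v (\<tau> 1) \<in> H"
          using flat[OF cc] by blast
        have nz: "a - c \<noteq> 0" "a - c1 \<noteq> 0" using a_minus_nonzero c c1 by auto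
        obtain l where l: "j = Suc l" using j(1) by (cases j) auto
        have close1: "close c1" using c1 by (simp add: close_def)
        have "v (\<tau> 1) < v (\<tau> (Suc j)) + v ((a - c1) ^ j)"
          using dom'[OF j(1) close1] j(2) nz by (simp add: val_gt_def v_mult)
        also have "\<dots> = v (\<tau> (Suc j)) + (v (a - c1) + v ((a - c1) ^ l))"
          using nz by (simp add: l v_mult)
        also have "\<dots> \<le> v (\<tau> (Suc j)) + (v (a - c1) + v ((a - c) ^ l))"
          using v_power_mono[OF nz(2,1) True] by (intro add_left_mono)
        finally have "v (a - c) - v (a - c1) \<le> v (\<tau> (Suc j)) + (v (a - c) + v ((a - c) ^ l)) - v (\<tau> 1)"
          by (simp add: algebra_simps)
        also have "\<dots> = v (\<tau> (Suc j) * (a - c) ^ j) - v (\<tau> 1)"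
          using nz j(2) by (simp add: l v_mult)
        finally have "v (a - c) \<le> v (a - c1) + (v (\<tau> (Suc j) * (a - c) ^ j) - v (\<tau> 1))"
          by (simp only: diff_le_eq add.commute)
        then show ?thesis using j(3) by blast
      next
        case False
        then show ?thesis using H.H_zero by (intro bexI[of _ 0]) auto
      qed
      have close1: "close c1" using c1 by (simp add: close_def)
      have u1: "poly f1 c1 \<in> W" "poly f1 c1 \<noteq> 0" "v (poly f1 c1) = v (\<tau> 1)"
        using W.poly_mem[OF f1W c1] val_eqI[OF \<tau>1 u_near[OF close1]] by auto
      obtain e where e: "e \<in> K" "e \<noteq> 0" "v e = v (\<tau> 1)"
        using immediate_space_approx[OF W u1(1,2)] u1(3) by metis
      show False
      proof (rule no_simple_coarse_zero[OF f(1) c1 top t_def])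
        show "Polynomial.coeff t 1 \<noteq> 0" using \<tau>1 by (simp add: \<tau>_def)
        show "e \<in> K" "e \<noteq> 0" "v e = v (Polynomial.coeff t 1)" using e by (auto simp: \<tau>_def)
        show "val_ge (Polynomial.coeff t i * (a - c1) ^ i) (v (Polynomial.coeff t 1 * (a - c1)))" for i
        proof -
          consider "i = 0" | "i = 1" | j where "i = Suc j" "j \<ge> 1" by (cases i) force+
          then show ?thesis
          proof cases
            case 1
            then show ?thesis using fa_ge[OF close1] \<tau>0 by (simp add: \<tau>_def)
          next
            case 3
            show ?thesis using val_gt_imp_ge[OF dom''[OF 3(2) close1]] unfolding 3(1) \<tau>_def .
          qed simp
        qed
        fix h assume h: "h \<in> H"
        obtain d where d: "d \<in> K" "v (a - c1) + h < v (a - d)" using H_add_below[OF c1 h] .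
        define d' where "d' = (if v (a - c1) \<le> v (a - d) then d else c1)"
        have d': "close d'" "v (a - d) \<le> v (a - d')" using d c1 by (auto simp: d'_def close_def)
        have "v (\<tau> 1 * (a - c1)) + h < v (\<tau> 1 * (a - d'))"
          using d d'(2) \<tau>1 a_minus_nonzero[OF c1] a_minus_nonzero[OF closeK[OF d'(1)]]
          by (auto simp: v_mult add.assoc)
        with fa_ge[OF d'(1)] show "val_gt (poly f a) (v (Polynomial.coeff t 1 * (a - c1)) + h)"
          unfolding \<tau>_def by (rule val_ge_less)
      qed
    qed
  qed
qed

text \<open>The linear Taylor term governs \<open>poly f a - poly f c\<close>, and \<beta> is the
  value of its coefficient; it belongs to \<open>vK\<close> because the derivative at
  \<open>c1\<close> is an element of \<open>W\<close> with the same value. The upper bound comes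
  from \<open>taylor_dominated\<close> for \<open>f - [:e:]\<close>, whose linear coefficient is the
  same.\<close>

lemma difference_dominated:
  assumes f: "coeffs_in W f" and deg: "0 < Polynomial.degree f" "Polynomial.degree f < p"
  shows "\<exists>c1\<in>K. \<exists>\<beta>\<in>value_group v K.
    (\<forall>c\<in>K. v (a - c1) \<le> v (a - c) \<longrightarrow>
      poly f a \<noteq> poly f c \<and> v (poly f a - poly f c) = \<beta> + v (a - c)) \<and>
    (\<forall>e\<in>K. \<exists>c\<in>K. poly f a \<noteq> e \<and> v (poly f a - e) < \<beta> + v (a - c))"
proof -
  define t where "t = pcompose f [:a, 1:]"
  define \<tau> where "\<tau> = Polynomial.coeff t"
  have \<tau>0: "\<tau> 0 = poly f a"
    using poly_0_coeff_0[of t] by (simp add: \<tau>_def t_def poly_pcompose)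
  define f1 where "f1 = pderiv f"
  have f1W: "coeffs_in W f1" unfolding f1_def by (rule W.coeffs_in_pderiv[OF f(1)])
  have "dominated f1"
    using pderiv_small_degree[OF deg] deg(2) by (intro taylor_dominated f1W) (auto simp: f1_def)
  note linear = linear_term_dominates[OF deg(2) this[unfolded f1_def], folded t_def f1_def, folded \<tau>_def]
  have \<tau>1: "\<tau> 1 \<noteq> 0" by (rule linear(1))
  obtain c1 where c1: "c1 \<in> K"
    and dom: "\<And>c. c \<in> K \<Longrightarrow> v (a - c1) \<le> v (a - c) \<Longrightarrow> val_gt (poly f1 c - \<tau> 1) (v (\<tau> 1)) \<and>
      (\<forall>i\<ge>1. val_gt (\<tau> (Suc i) * (a - c) ^ i) (v (\<tau> 1)))"
    using linear(2) by blast
  have "val_gt (poly f1 c1 - \<tau> 1) (v (\<tau> 1))" using dom[OF c1] by simp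
  from val_eqI[OF \<tau>1 this] have "poly f1 c1 \<noteq> 0" "v (poly f1 c1) = v (\<tau> 1)" by auto
  moreover have "poly f1 c1 \<in> W" by (rule W.poly_mem[OF f1W c1])
  ultimately obtain e where "e \<in> K" "e \<noteq> 0" "v e = v (\<tau> 1)"
    using immediate_space_approx[OF W] by metis
  then have \<beta>: "v (\<tau> 1) \<in> value_group v K" unfolding value_group_def
    by (metis DiffI image_eqI singletonD)
  have diff: "poly f a \<noteq> poly f c \<and> v (poly f a - poly f c) = v (\<tau> 1) + v (a - c)"
    if c: "c \<in> K" "v (a - c1) \<le> v (a - c)" for c
  proof -
    have ca: "c - a \<noteq> 0" using a_minus_nonzero[OF c(1)] by auto
    then have nz: "\<tau> 1 * (c - a) \<noteq> 0" using \<tau>1 by simp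
    have "val_gt (poly t (c - a) - (\<Sum>i<2. Polynomial.coeff t i * (c - a) ^ i)) (v (\<tau> 1 * (c - a)))"
    proof (rule val_gt_poly_minus_sum)
      fix i :: nat assume "2 \<le> i"
      then obtain j where j: "i = Suc j" "j \<ge> 1" by (cases i) auto
      show "val_gt (Polynomial.coeff t i * (c - a) ^ i) (v (\<tau> 1 * (c - a)))"
      proof -
        have "val_gt (\<tau> i * (c - a) ^ j) (v (\<tau> 1))"
          using dom[OF c] j unfolding val_power_minus_commute(1)[of _ c a] by simp
        then have "val_gt (\<tau> i * (c - a) ^ j * (c - a)) (v (\<tau> 1) + v (c - a))"
          using ca by (simp add: val_gt_times_iff)
        then show ?thesis using \<tau>1 ca by (simp add: j v_mult mult_ac add.commute \<tau>_def)
      qed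
    qed
    moreover have "poly t (c - a) = poly f c" by (simp add: t_def poly_pcompose)
    moreover have "(\<Sum>i<2. Polynomial.coeff t i * (c - a) ^ i) = poly f a + \<tau> 1 * (c - a)"
      using \<tau>0 by (simp add: numeral_2_eq_2 \<tau>_def)
    ultimately have "val_gt ((poly f c - poly f a) - \<tau> 1 * (c - a)) (v (\<tau> 1 * (c - a)))"
      by (simp add: algebra_simps)
    from val_eqI[OF nz this] show ?thesis
      using \<tau>1 ca by (auto simp: v_mult v_diff_commute)
  qed
  have upper: "\<exists>c\<in>K. poly f a \<noteq> e \<and> v (poly f a - e) < v (\<tau> 1) + v (a - c)" if e: "e \<in> K" for e
  proof -
    define g where "g = f - [:e:]"
    have cg: "Polynomial.coeff g i = Polynomial.coeff f i" if "i > 0" for i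
      using that by (cases i) (auto simp: g_def)
    have "coeffs_in W g" unfolding g_def using f e K_subset_W by (intro W.coeffs_in_diff) auto
    moreover have "Polynomial.degree g < p"
    proof -
      have "Polynomial.degree g \<le> Polynomial.degree f" by (rule degree_le) (auto simp: cg coeff_eq_0)
      then show ?thesis using deg(2) by simp
    qed
    moreover have "g \<noteq> 0"
    proof
      assume "g = 0"
      then have "Polynomial.lead_coeff f = 0" using cg[OF deg(1)] by simp
      then show False using deg(1) by (simp add: leading_coeff_0_iff)
    qed
    ultimately obtain c where c: "poly g a \<noteq> 0" "c \<in> K"
      "val_gt (Polynomial.coeff (pcompose g [:a, 1:]) 1 * (a - c) ^ 1) (v (poly g a))"
      using taylor_dominated[of g] unfolding dominated_def by blast
    have "Polynomial.coeff (pcompose g [:a, 1:]) 1 = \<tau> 1"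
      unfolding g_def by (simp add: pcompose_diff \<tau>_def t_def)
    then show ?thesis
      using c \<tau>1 a_minus_nonzero[OF c(2)] by (intro bexI[OF _ c(2)]) (auto simp: g_def val_gt_def v_mult)
  qed
  show ?thesis using c1 \<beta> diff upper by blast
qed

section \<open>Polynomials of degree below \<open>p\<close> in the new element\<close>

definition extended_space :: "'a set" where
  "extended_space = {poly f a | f. coeffs_in W f \<and> Polynomial.degree f < p}"

text \<open>If some \<open>poly f c\<close> in \<open>W - K\<close> is so close to \<open>w\<close>
  that \<open>K\<close> cannot separate the two, it passes its cut on to \<open>w\<close>. Otherwise
  each \<open>poly f c\<close> can be replaced by an element of \<open>K\<close> at the same
  distance from \<open>w\<close>, and the cut of \<open>w\<close> is that of \<open>a\<close>
  shifted by \<beta>. The description of cuts keeps the construction going when further elements are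
  adjoined.\<close>

lemma extended_space_cuts:
  assumes w: "w \<in> extended_space" "w \<notin> K"
  shows "weakly_immediate v K w \<and>
    ((\<exists>u\<in>W - K. cut w = cut u) \<or> (\<exists>\<beta>\<in>value_group v K. cut w = (+) \<beta> ` cut a))"
proof -
  obtain f where f: "coeffs_in W f" "Polynomial.degree f < p" "w = poly f a"
    using w(1) by (auto simp: extended_space_def)
  show ?thesis
  proof (cases "Polynomial.degree f = 0")
    case True
    then obtain x where "f = [:x:]" by (auto elim: degree_eq_zeroE)
    then have "w \<in> W - K" using f w(2) by simp
    then show ?thesis using W by (auto simp: immediate_space_def)
  next
    case False
    then have "0 < Polynomial.degree f" by simp
    from difference_dominated[OF f(1) this f(2)] obtain c1 \<beta>
      where c1: "c1 \<in> K" and \<beta>: "\<beta> \<in> value_group v K"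
      and diff: "\<And>c. c \<in> K \<Longrightarrow> v (a - c1) \<le> v (a - c) \<Longrightarrow>
        w \<noteq> poly f c \<and> v (w - poly f c) = \<beta> + v (a - c)"
      and upper: "\<And>e. e \<in> K \<Longrightarrow> \<exists>c\<in>K. w \<noteq> e \<and> v (w - e) < \<beta> + v (a - c)"
      unfolding f(3) by blast
    have closer: "\<exists>d\<in>K. v (a - c1) \<le> v (a - d) \<and> v (a - c) \<le> v (a - d)" if "c \<in> K" for c
      using that c1 by (cases "v (a - c1) \<le> v (a - c)") auto
    show ?thesis
    proof (cases "\<exists>c\<in>K. v (a - c1) \<le> v (a - c) \<and> poly f c \<notin> K \<and>
        (\<forall>e\<in>K. val_gt (w - poly f c) (v (poly f c - e)))")
      case True
      then obtain c where c: "c \<in> K" "poly f c \<notin> K"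
        "\<And>e. e \<in> K \<Longrightarrow> val_gt (w - poly f c) (v (poly f c - e))" by blast
      have u: "poly f c \<in> W - K" using W.poly_mem[OF f(1) c(1)] c(2) by simp
      then have "weakly_immediate v K (poly f c)" using W by (auto simp: immediate_space_def)
      note cong = weakly_immediate_cong[OF this c(3)]
      have "cut w = cut (poly f c)" by (rule cut_cong) (rule cong(2))
      with cong(1) u show ?thesis by blast
    next
      case False
      have approx: "\<exists>e\<in>K. v (w - e) = \<beta> + v (a - c)" if c: "c \<in> K" "v (a - c1) \<le> v (a - c)" for c
      proof -
        have nz: "w - poly f c \<noteq> 0" and val: "v (w - poly f c) = \<beta> + v (a - c)"
          using diff[OF c] by auto
        have "\<exists>e\<in>K. val_gt (poly f c - e) (v (w - poly f c))"
        proof (cases "poly f c \<in> K")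
          case True
          then show ?thesis by (intro bexI[of _ "poly f c"]) auto
        next
          case fK: False
          then obtain e where e: "e \<in> K" "v (w - poly f c) \<le> v (poly f c - e)"
            using False c nz by (auto simp: val_gt_def not_less)
          have "weakly_immediate v K (poly f c)"
            using W W.poly_mem[OF f(1) c(1)] fK by (auto simp: immediate_space_def)
          then obtain e' where "e' \<in> K" "v (poly f c - e) < v (poly f c - e')"
            using e(1) by (auto simp: weakly_immediate_iff)
          then show ?thesis using e(2) by (intro bexI[of _ e']) (auto simp: val_gt_def)
        qed
        then obtain e where e: "e \<in> K" "val_gt ((w - e) - (w - poly f c)) (v (w - poly f c))" by auto
        from val_eqI(2)[OF nz e(2)] show ?thesis using e(1) val by auto
      qed
      have wi: "weakly_immediate v K w"
        unfolding weakly_immediate_iff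
      proof (intro conjI ballI)
        fix e assume "e \<in> K"
        then obtain c where c: "c \<in> K" "v (w - e) < \<beta> + v (a - c)" using upper by blast
        obtain d where d: "d \<in> K" "v (a - c1) \<le> v (a - d)" "v (a - c) \<le> v (a - d)"
          using closer[OF c(1)] by blast
        obtain e' where "e' \<in> K" "v (w - e') = \<beta> + v (a - d)" using approx[OF d(1,2)] by blast
        moreover have "\<beta> + v (a - c) \<le> \<beta> + v (a - d)" using d(3) by simp
        ultimately show "\<exists>d\<in>K. v (w - e) < v (w - d)" using c(2) by (metis less_le_trans)
      qed (rule w(2))
      have "cut w = (+) \<beta> ` cut a"
      proof (intro equalityI subsetI)
        fix g assume "g \<in> cut w"
        then obtain e where e: "e \<in> K" "g \<le> v (w - e)" by (auto simp: cut_def)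
        then obtain c where c: "c \<in> K" "v (w - e) < \<beta> + v (a - c)" using upper by blast
        then have "g - \<beta> \<in> cut a"
          using e by (auto simp: cut_def diff_le_eq add.commute intro!: bexI[OF _ c(1)] order_trans[OF e(2)])
        then show "g \<in> (+) \<beta> ` cut a" by (intro image_eqI[of _ _ "g - \<beta>"]) auto
      next
        fix g assume "g \<in> (+) \<beta> ` cut a"
        then obtain c where c: "c \<in> K" "g \<le> \<beta> + v (a - c)" by (auto simp: cut_def)
        obtain d where d: "d \<in> K" "v (a - c1) \<le> v (a - d)" "v (a - c) \<le> v (a - d)"
          using closer[OF c(1)] by blast
        obtain e where e: "e \<in> K" "v (w - e) = \<beta> + v (a - d)" using approx[OF d(1,2)] by blast
        have "g \<le> v (w - e)" unfolding e(2) using c(2) d(3) by (meson add_left_mono order_trans)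
        then show "g \<in> cut w" using e(1) by (auto simp: cut_def)
      qed
      then show ?thesis using wi \<beta> by blast
    qed
  qed
qed

lemma immediate_space_extended:
  assumes "0 < p"
  shows "immediate_space extended_space"
  unfolding immediate_space_def
proof (intro conjI)
  have const: "x \<in> extended_space" if "x \<in> W" for x
    unfolding extended_space_def using that assms by (auto intro!: exI[of _ "[:x:]"])
  show "field_submodule K extended_space"
  proof
    show "0 \<in> extended_space" by (rule const) simp
    fix x y assume "x \<in> extended_space"
    then obtain f where f: "coeffs_in W f" "Polynomial.degree f < p" "x = poly f a"
      by (auto simp: extended_space_def)
    show "r * x \<in> extended_space" if "r \<in> K" for r
      unfolding extended_space_def using f that
      by (auto intro!: exI[of _ "smult r f"] W.coeffs_in_smult intro: le_less_trans[OF degree_smult_le])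
    assume "y \<in> extended_space"
    then obtain g where g: "coeffs_in W g" "Polynomial.degree g < p" "y = poly g a"
      by (auto simp: extended_space_def)
    show "x + y \<in> extended_space"
      unfolding extended_space_def using f g
      by (auto intro!: exI[of _ "f + g"] W.coeffs_in_add degree_add_less)
  qed
  show "K \<subseteq> extended_space" using K_subset_W const by auto
  show "\<forall>w\<in>extended_space - K. weakly_immediate v K w" using extended_space_cuts by blast
qed

end

section \<open>Linear independence over a subfield\<close>

text \<open>Index sets are arbitrary, so that families of products are indexed by products of sets;
  \<open>lin_indep_nat\<close> flattens them for the comparison with the degree.\<close>

definition lin_indep :: "'a::field set \<Rightarrow> 'i set \<Rightarrow> ('i \<Rightarrow> 'a) \<Rightarrow> bool" where
  "lin_indep K I x \<longleftrightarrow> finite I \<and>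
    (\<forall>c. (\<forall>i\<in>I. c i \<in> K) \<longrightarrow> (\<Sum>i\<in>I. c i * x i) = 0 \<longrightarrow> (\<forall>i\<in>I. c i = 0))"

lemma lin_indepI:
  assumes "finite I"
    "\<And>c i. (\<And>i. i \<in> I \<Longrightarrow> c i \<in> K) \<Longrightarrow> (\<Sum>i\<in>I. c i * x i) = 0 \<Longrightarrow> i \<in> I \<Longrightarrow> c i = 0"
  shows "lin_indep K I x"
  using assms unfolding lin_indep_def by blast

lemma lin_indepD:
  "lin_indep K I x \<Longrightarrow> (\<And>i. i \<in> I \<Longrightarrow> c i \<in> K) \<Longrightarrow> (\<Sum>i\<in>I. c i * x i) = 0 \<Longrightarrow> i \<in> I \<Longrightarrow> c i = 0"
  unfolding lin_indep_def by blast

lemma lin_indep_reindex: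
  assumes "lin_indep K I x" "bij_betw h J I"
  shows "lin_indep K J (x \<circ> h)"
proof (rule lin_indepI)
  show "finite J" using assms bij_betw_finite unfolding lin_indep_def by blast
  fix c j assume c: "\<And>j. j \<in> J \<Longrightarrow> c j \<in> K" "(\<Sum>j\<in>J. c j * (x \<circ> h) j) = 0" and j: "j \<in> J"
  define g where "g = the_inv_into J h"
  have g: "g (h j) = j" if "j \<in> J" for j
    unfolding g_def using that assms(2) by (simp add: bij_betw_def the_inv_into_f_f)
  have "(\<Sum>i\<in>I. c (g i) * x i) = (\<Sum>j\<in>J. c (g (h j)) * x (h j))"
    by (rule sum.reindex_bij_betw[OF assms(2), symmetric])
  also have "\<dots> = 0" using c(2) g by (simp cong: sum.cong)
  finally have sum0: "(\<Sum>i\<in>I. c (g i) * x i) = 0" .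
  have "c (g i) \<in> K" if "i \<in> I" for i
    using that c(1) g assms(2) by (auto simp: bij_betw_def)
  from lin_indepD[OF assms(1), of "\<lambda>i. c (g i)", OF this sum0] have "c (g (h j)) = 0"
    using assms(2) j by (auto simp: bij_betw_def)
  then show "c j = 0" using g j by simp
qed

lemma lin_indep_nat:
  assumes "lin_indep K I x"
  obtains y :: "nat \<Rightarrow> 'a::field" where "lin_indep K {..<card I} y" "y ` {..<card I} = x ` I"
proof -
  have "finite I" using assms by (simp add: lin_indep_def)
  then obtain h where h: "bij_betw h {..<card I} I"
    using ex_bij_betw_nat_finite by (metis atLeast0LessThan)
  then have "(x \<circ> h) ` {..<card I} = x ` I" by (simp only: image_comp[symmetric] bij_betw_def)
  then show ?thesis by (rule that[OF lin_indep_reindex[OF assms h]])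
qed

context extension_step begin

text \<open>A relation between the products is a polynomial over \<open>W\<close> of degree below
  \<open>p\<close> that vanishes at \<open>a\<close>, hence the zero polynomial; its coefficients
  are relations between the \<open>w i\<close>.\<close>

lemma lin_indep_extended:
  assumes "lin_indep K I w" "w ` I \<subseteq> W"
  shows "lin_indep K (I \<times> {..<p}) (\<lambda>(i, j). w i * a ^ j)"
    and "(\<lambda>(i, j). w i * a ^ j) ` (I \<times> {..<p}) \<subseteq> extended_space"
proof -
  have fin: "finite I" using assms by (simp add: lin_indep_def)
  show "lin_indep K (I \<times> {..<p}) (\<lambda>(i, j). w i * a ^ j)"
  proof (rule lin_indepI)
    show "finite (I \<times> {..<p})" using fin by simp
    fix c ij assume c: "\<And>ij. ij \<in> I \<times> {..<p} \<Longrightarrow> c ij \<in> K"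
      "(\<Sum>ij\<in>I \<times> {..<p}. c ij * (case ij of (i, j) \<Rightarrow> w i * a ^ j)) = 0" and ij: "ij \<in> I \<times> {..<p}"
    define x where "x j = (\<Sum>i\<in>I. c (i, j) * w i)" for j
    define f where "f = (\<Sum>j<p. monom (x j) j)"
    have cf: "Polynomial.coeff f j = (if j < p then x j else 0)" for j
      unfolding f_def by (auto simp: coeff_sum sum.delta)
    have "x j \<in> W" if "j < p" for j
      unfolding x_def using that c(1) assms(2) by (intro W.W_sum W.W_scale) auto
    then have fW: "coeffs_in W f" by (auto simp: coeffs_in_def cf)
    have "poly f a = (\<Sum>j<p. \<Sum>i\<in>I. c (i, j) * (w i * a ^ j))"
      unfolding f_def x_def by (simp add: poly_sum poly_monom sum_distrib_right mult.assoc)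
    also have "\<dots> = (\<Sum>i\<in>I. \<Sum>j<p. c (i, j) * (w i * a ^ j))" by (rule sum.swap)
    also have "\<dots> = 0" using c(2) by (simp add: sum.cartesian_product split_def)
    finally have fa: "poly f a = 0" .
    obtain i j where ij': "ij = (i, j)" "i \<in> I" "j < p" using ij by auto
    have deg: "Polynomial.degree f < p"
    proof -
      have "Polynomial.degree f \<le> p - 1" by (rule degree_le) (auto simp: cf)
      then show ?thesis using ij' by simp
    qed
    have "f = 0" using taylor_dominated[OF fW _ deg] fa by (auto simp: dominated_def)
    then have "x j = 0" using cf[of j] ij' by simp
    then show "c ij = 0"
      unfolding ij'(1) x_def using lin_indepD[OF assms(1), of "\<lambda>i. c (i, j)" i] c(1) ij' by auto
  qed
  show "(\<lambda>(i, j). w i * a ^ j) ` (I \<times> {..<p}) \<subseteq> extended_space"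
  proof (clarify)
    fix i j assume "i \<in> I" "j < p"
    then have "coeffs_in W (monom (w i) j)" "Polynomial.degree (monom (w i) j) < p"
      using assms(2) by (auto simp: coeffs_in_def intro: le_less_trans[OF degree_monom_le])
    then show "w i * a ^ j \<in> extended_space"
      unfolding extended_space_def by (auto intro!: exI[of _ "monom (w i) j"] simp: poly_monom)
  qed
qed

end

section \<open>Construction of large immediate spaces\<close>

context valued_field_over begin

lemma value_group_0: "0 \<in> value_group v K"
  unfolding value_group_def using K.one_mem by (intro image_eqI[of _ _ 1]) auto

lemma value_group_add: "g \<in> value_group v K \<Longrightarrow> h \<in> value_group v K \<Longrightarrow> g + h \<in> value_group v K"
  unfolding value_group_def using K.mult_mem by (auto simp: v_mult[symmetric])

lemma value_group_uminus: "g \<in> value_group v K \<Longrightarrow> - g \<in> value_group v K"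
  unfolding value_group_def using K.inverse_mem by (auto simp: v_inverse[symmetric])

lemma value_group_diff: "g \<in> value_group v K \<Longrightarrow> h \<in> value_group v K \<Longrightarrow> g - h \<in> value_group v K"
  using value_group_add[of g "- h"] value_group_uminus by simp

lemma value_groupI: "c \<in> K \<Longrightarrow> c \<noteq> 0 \<Longrightarrow> v c \<in> value_group v K"
  by (auto simp: value_group_def)

section \<open>Equivalence of cuts modulo \<open>vK\<close>, and the order of adjunction\<close>

definition cut_equiv :: "'a \<Rightarrow> 'a \<Rightarrow> bool" where
  "cut_equiv a b \<longleftrightarrow> (\<exists>\<beta>\<in>value_group v K. cut a = (+) \<beta> ` cut b)"

lemma cut_equiv_refl: "cut_equiv a a"
  unfolding cut_equiv_def using value_group_0 by (intro bexI[of _ 0]) auto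

lemma cut_equiv_sym: "cut_equiv a b \<Longrightarrow> cut_equiv b a"
proof -
  assume "cut_equiv a b"
  then obtain \<beta> where \<beta>: "\<beta> \<in> value_group v K" "cut a = (+) \<beta> ` cut b" by (auto simp: cut_equiv_def)
  have "(+) (- \<beta>) ` cut a = cut b" unfolding \<beta>(2) by (simp add: image_comp comp_def)
  then show "cut_equiv b a"
    unfolding cut_equiv_def using value_group_uminus[OF \<beta>(1)] by metis
qed

lemma cut_equiv_trans: "cut_equiv a b \<Longrightarrow> cut_equiv b c \<Longrightarrow> cut_equiv a c"
proof -
  assume "cut_equiv a b" "cut_equiv b c"
  then obtain \<beta> \<gamma> where \<beta>: "\<beta> \<in> value_group v K" "cut a = (+) \<beta> ` cut b"
    and \<gamma>: "\<gamma> \<in> value_group v K" "cut b = (+) \<gamma> ` cut c" by (auto simp: cut_equiv_def)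
  have "cut a = (+) (\<beta> + \<gamma>) ` cut c" unfolding \<beta>(2) \<gamma>(2) by (simp add: image_comp comp_def add.assoc)
  then show "cut_equiv a c" unfolding cut_equiv_def using value_group_add[OF \<beta>(1) \<gamma>(1)] by metis
qed

text \<open>Shifting \<alpha> by a positive \<open>g\<close> from the stabilizer of
  \<open>cut b\<close> stays in \<open>cut b\<close>, hence below \<alpha> plus an element of the
  other stabilizer, which contains \<open>g\<close> by convexity. This makes narrowness
  transitive.\<close>

lemma narrow_stabilizer_mono:
  assumes "narrow (cut b) (stabilizer (cut a))"
  shows "stabilizer (cut b) \<subseteq> stabilizer (cut a)"
proof
  interpret Ha: convex_subgroup "stabilizer (cut a)" by (rule convex_subgroup_cut)
  interpret Hb: convex_subgroup "stabilizer (cut b)" by (rule convex_subgroup_cut)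
  obtain \<alpha> where \<alpha>: "\<alpha> \<in> cut b" "\<And>\<beta>. \<beta> \<in> cut b \<Longrightarrow> \<exists>h\<in>stabilizer (cut a). \<beta> \<le> \<alpha> + h"
    using assms by (auto simp: narrow_def)
  have pos: "g \<in> stabilizer (cut a)" if "g \<in> stabilizer (cut b)" "0 \<le> g" for g
  proof -
    have "\<alpha> + g \<in> cut b" using that(1) \<alpha>(1) by (simp add: stabilizer_def)
    then obtain h where "h \<in> stabilizer (cut a)" "\<alpha> + g \<le> \<alpha> + h" using \<alpha>(2) by blast
    then show ?thesis using that(2) Ha.H_convex by simp
  qed
  fix g assume g: "g \<in> stabilizer (cut b)"
  show "g \<in> stabilizer (cut a)"
  proof (cases "0 \<le> g")
    case False
    then show ?thesis using pos[OF Hb.H_uminus[OF g]] Ha.H_uminus[of "- g"] by simp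
  qed (rule pos[OF g])
qed

lemma narrow_mono: "narrow C H \<Longrightarrow> H \<subseteq> H' \<Longrightarrow> narrow C H'"
  unfolding narrow_def by blast

lemma narrow_shift: "narrow ((+) \<beta> ` C) H \<Longrightarrow> narrow C H"
  unfolding narrow_def by (force simp: add.assoc)

text \<open>The point \<alpha> may be raised to a value \<open>v (b - c)\<close>, which lies in
  \<open>vK\<close>. Narrowness bounds the cut by the translate from above, invariance from
  below.\<close>

lemma narrow_cut_eq:
  assumes b: "weakly_immediate v K b" and n: "narrow (cut b) (stabilizer (cut b))"
  obtains \<gamma> where "\<gamma> \<in> value_group v K" "cut b = (+) \<gamma> ` {x. \<exists>h\<in>stabilizer (cut b). x \<le> h}"
proof -
  obtain \<alpha> where \<alpha>: "\<alpha> \<in> cut b" "\<And>\<beta>. \<beta> \<in> cut b \<Longrightarrow> \<exists>h\<in>stabilizer (cut b). \<beta> \<le> \<alpha> + h"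
    using n by (auto simp: narrow_def)
  then obtain c where c: "c \<in> K" "\<alpha> \<le> v (b - c)" by (auto simp: cut_def)
  obtain d where d: "d \<in> K" "d \<noteq> c" "v (d - c) = v (b - c)"
    using weakly_immediate_approx[OF b c(1)] by metis
  have "v (b - c) \<in> value_group v K"
    using value_groupI[of "d - c"] d c K.minus_mem by simp
  moreover have "cut b = (+) (v (b - c)) ` {x. \<exists>h\<in>stabilizer (cut b). x \<le> h}"
  proof (intro equalityI subsetI)
    fix x assume "x \<in> cut b"
    then obtain h where h: "h \<in> stabilizer (cut b)" "x \<le> \<alpha> + h" using \<alpha>(2) by blast
    have "x \<le> v (b - c) + h" using h(2) c(2) by (meson add_right_mono order_trans)
    then have "x - v (b - c) \<le> h" by (simp add: diff_le_eq add.commute)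
    then show "x \<in> (+) (v (b - c)) ` {x. \<exists>h\<in>stabilizer (cut b). x \<le> h}"
      using h(1) by (intro image_eqI[of _ _ "x - v (b - c)"]) auto
  next
    fix x assume "x \<in> (+) (v (b - c)) ` {x. \<exists>h\<in>stabilizer (cut b). x \<le> h}"
    then obtain h where h: "h \<in> stabilizer (cut b)" "x \<le> v (b - c) + h" by auto
    have "v (b - c) + h \<in> cut b" using h(1) cut_memI[OF c(1), of b] by (simp add: stabilizer_def)
    then show "x \<in> cut b" using h(2) by (rule cut_downward)
  qed
  ultimately show ?thesis by (rule that)
qed

text \<open>Mutual narrowness forces the stabilizers to coincide, and both cuts are then translates
  of the downward closure of the same subgroup.\<close>

lemma narrow_antisym:
  assumes "weakly_immediate v K a" "weakly_immediate v K b"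
    and "narrow (cut a) (stabilizer (cut b))" "narrow (cut b) (stabilizer (cut a))"
  shows "cut_equiv a b"
proof -
  have eq: "stabilizer (cut a) = stabilizer (cut b)"
    using assms(3,4) narrow_stabilizer_mono by blast
  have na: "narrow (cut a) (stabilizer (cut a))" and nb: "narrow (cut b) (stabilizer (cut b))"
    using assms(3,4) eq by simp_all
  obtain \<gamma> where \<gamma>: "\<gamma> \<in> value_group v K" "cut a = (+) \<gamma> ` {x. \<exists>h\<in>stabilizer (cut a). x \<le> h}"
    by (rule narrow_cut_eq[OF assms(1) na])
  obtain \<delta> where \<delta>: "\<delta> \<in> value_group v K" "cut b = (+) \<delta> ` {x. \<exists>h\<in>stabilizer (cut b). x \<le> h}"
    by (rule narrow_cut_eq[OF assms(2) nb])
  have "(+) (\<gamma> - \<delta>) ` (+) \<delta> ` {x. \<exists>h\<in>stabilizer (cut b). x \<le> h} =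
      (+) \<gamma> ` {x. \<exists>h\<in>stabilizer (cut b). x \<le> h}"
    by (simp add: image_comp comp_def)
  then have "cut a = (+) (\<gamma> - \<delta>) ` cut b"
    using \<gamma>(2)[unfolded eq] \<delta>(2)[symmetric] by simp
  then show ?thesis unfolding cut_equiv_def using value_group_diff[OF \<gamma>(1) \<delta>(1)] by blast
qed

text \<open>Take \<open>a\<close> with the fewest \<open>b\<close> narrow relative to its
  stabilizer. For any such \<open>b\<close>, the set \<open>S b\<close> would be contained in
  \<open>S a\<close> by transitivity and antisymmetry, and it would miss \<open>b\<close>, against
  minimality.\<close>

lemma exists_last:
  assumes "finite C" "C \<noteq> {}" and wi: "\<And>a. a \<in> C \<Longrightarrow> weakly_immediate v K a"
    and inequiv: "\<And>a b. a \<in> C \<Longrightarrow> b \<in> C \<Longrightarrow> a \<noteq> b \<Longrightarrow> \<not> cut_equiv a b"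
  obtains a where "a \<in> C" "\<And>b. b \<in> C \<Longrightarrow> b \<noteq> a \<Longrightarrow> \<not> narrow (cut b) (stabilizer (cut a))"
proof -
  define S where "S a = {b \<in> C - {a}. narrow (cut b) (stabilizer (cut a))}" for a
  obtain a0 where "a0 \<in> C" using assms(2) by blast
  then obtain a where a: "a \<in> C" and amin: "\<And>b. b \<in> C \<Longrightarrow> card (S a) \<le> card (S b)"
    using ex_has_least_nat[of "\<lambda>a. a \<in> C" a0 "\<lambda>a. card (S a)"] by blast
  have "\<not> narrow (cut b) (stabilizer (cut a))" if b: "b \<in> C" "b \<noteq> a" for b
  proof
    assume nb: "narrow (cut b) (stabilizer (cut a))"
    have "S b \<subseteq> S a"
    proof
      fix c assume c: "c \<in> S b"
      have "c \<noteq> a"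
        using c nb narrow_antisym[of a b] wi inequiv a b by (auto simp: S_def)
      then show "c \<in> S a"
        using c narrow_mono[OF _ narrow_stabilizer_mono[OF nb]] by (auto simp: S_def)
    qed
    moreover have "b \<in> S a - S b" using nb b by (auto simp: S_def)
    ultimately have "S b \<subset> S a" by blast
    moreover have "finite (S a)" using assms(1) by (simp add: S_def)
    ultimately have "card (S b) < card (S a)" by (simp only: psubset_card_mono)
    then show False using amin[OF b(1)] by simp
  qed
  then show ?thesis using that a by blast
qed

text \<open>The elements of \<open>C\<close> are adjoined in an order in which no cut is contained in a translate of
  the stabilizer of a later one.\<close>

lemma exists_immediate_space:
  assumes "finite C" and wi: "\<And>a. a \<in> C \<Longrightarrow> weakly_immediate v K a"
    and inequiv: "\<And>a b. a \<in> C \<Longrightarrow> b \<in> C \<Longrightarrow> a \<noteq> b \<Longrightarrow> \<not> cut_equiv a b"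
    and conj: "\<And>a. a \<in> C \<Longrightarrow> \<exists>A. coeffs_in K (\<Prod>x\<in>#A. [:- x, 1:]) \<and> a \<in># A \<and>
      (\<forall>x\<in>#A. \<forall>c\<in>K. v (x - c) = v (a - c))"
    and pp: "0 < p" "\<And>k. 0 < k \<Longrightarrow> k < p \<Longrightarrow> of_nat k \<noteq> (0 :: 'a) \<and> v (of_nat k) = 0"
    and L: "field_subring L" "K \<subseteq> L" "C \<subseteq> L"
  shows "\<exists>W (w :: nat \<Rightarrow> 'a). immediate_space W \<and> W \<subseteq> L \<and>
    lin_indep K {..<p ^ card C} w \<and> w ` {..<p ^ card C} \<subseteq> W \<and>
    (\<forall>u\<in>W - K. \<exists>a\<in>C. cut_equiv u a)"
  using assms(1) wi inequiv conj L(3)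
proof (induction "card C" arbitrary: C)
  case 0
  then have C: "C = {}" by simp
  have "immediate_space K"
    using K.self.field_submodule_axioms by (simp add: immediate_space_def)
  moreover have "lin_indep K {..<p ^ card C} (\<lambda>_. 1)"
    unfolding C lin_indep_def by (simp add: lessThan_Suc)
  ultimately show ?case
    using L(2) K.one_mem by (intro exI[of _ K] exI[of _ "\<lambda>_. 1"]) (auto simp: C)
next
  case (Suc n)
  interpret L: field_subring L by fact
  have "C \<noteq> {}" using Suc.hyps(2) by auto
  from exists_last[OF Suc.prems(1) this Suc.prems(2,3)] obtain a where aC: "a \<in> C"
    and last: "\<And>b. b \<in> C \<Longrightarrow> b \<noteq> a \<Longrightarrow> \<not> narrow (cut b) (stabilizer (cut a))" by blast
  define C' where "C' = C - {a}"
  have card_C: "card C = Suc (card C')" and nC: "n = card C'"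
    using Suc.hyps(2) Suc.prems(1) aC by (simp_all add: C'_def)
  have "\<exists>W (w :: nat \<Rightarrow> 'a). immediate_space W \<and> W \<subseteq> L \<and>
    lin_indep K {..<p ^ card C'} w \<and> w ` {..<p ^ card C'} \<subseteq> W \<and>
    (\<forall>u\<in>W - K. \<exists>a\<in>C'. cut_equiv u a)"
    by (rule Suc.hyps(1)[OF nC]) (use Suc.prems in \<open>auto simp: C'_def\<close>)
  then obtain W and w :: "nat \<Rightarrow> 'a" where imm: "immediate_space W" "W \<subseteq> L"
    and w: "lin_indep K {..<p ^ card C'} w" "w ` {..<p ^ card C'} \<subseteq> W"
    and cuts: "\<And>u. u \<in> W - K \<Longrightarrow> \<exists>a\<in>C'. cut_equiv u a"
    by (elim exE conjE) blast
  \<comment> \<open>The last conjunct of the conclusion is the invariant behind this: all cuts of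
    \<open>W\<close> come from elements adjoined earlier, which are inequivalent to
    \<open>a\<close>.\<close>
  have new: "\<not> cut_equiv u a" if u: "u \<in> W - K" for u
  proof
    assume "cut_equiv u a"
    moreover obtain b where b: "b \<in> C'" "cut_equiv u b" using cuts[OF u] by blast
    ultimately have "cut_equiv b a" using cut_equiv_sym cut_equiv_trans by blast
    then show False using b(1) aC Suc.prems(3)[of b a] by (auto simp: C'_def)
  qed
  interpret extension_step v K W a p
  proof
    show "immediate_space W" by fact
    show wia: "weakly_immediate v K a" using aC Suc.prems by blast
    \<comment> \<open>An element \<open>b\<close> of \<open>W\<close> at least as close to
      \<open>a\<close> as all of \<open>K\<close> would have the cut of \<open>a\<close>.\<close>
    show "\<exists>c\<in>K. a \<noteq> b \<and> v (a - b) < v (a - c)" if b: "b \<in> W" for b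
    proof (rule ccontr)
      assume neg: "\<not> ?thesis"
      have "val_gt (b - a) (v (a - c))" if c: "c \<in> K" for c
      proof -
        obtain d where d: "d \<in> K" "v (a - c) < v (a - d)" using wia c by (auto simp: weakly_immediate_iff)
        then have "b = a \<or> v (a - c) < v (a - b)" using neg by (metis leI less_le_trans)
        then show ?thesis by (auto simp: val_gt_def v_diff_commute)
      qed
      note cong = weakly_immediate_cong[OF wia this]
      have "cut b = cut a" by (rule cut_cong) (rule cong(2))
      moreover have "b \<in> W - K" using b cong(1) by (simp add: weakly_immediate_def)
      ultimately show False using new[of b] cut_equiv_refl[of a] by (simp add: cut_equiv_def)
    qed
    show "\<not> narrow (cut u) (stabilizer (cut a))" if u: "u \<in> W - K" for u
    proof
      assume n: "narrow (cut u) (stabilizer (cut a))"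
      obtain b where b: "b \<in> C'" "cut_equiv u b" using cuts[OF u] by blast
      then obtain \<beta> where "cut u = (+) \<beta> ` cut b" by (auto simp: cut_equiv_def)
      then have "narrow (cut b) (stabilizer (cut a))"
        using n narrow_shift[of \<beta> "cut b" "stabilizer (cut a)"] by simp
      then show False using last[of b] b(1) by (simp add: C'_def)
    qed
    show "of_nat k \<noteq> (0 :: 'a) \<and> v (of_nat k) = 0" if "0 < k" "k < p" for k by (rule pp(2)[OF that])
    show "\<exists>A. coeffs_in K (\<Prod>x\<in>#A. [:- x, 1:]) \<and> a \<in># A \<and> (\<forall>x\<in>#A. \<forall>c\<in>K. v (x - c) = v (a - c))"
      using aC Suc.prems(4) by blast
  qed
  have "extended_space \<subseteq> L"
  proof
    fix x assume "x \<in> extended_space"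
    then obtain f where "coeffs_in W f" "x = poly f a" by (auto simp: extended_space_def)
    then show "x \<in> L" using imm(2) aC Suc.prems(5) L.self.poly_mem[of f a] unfolding coeffs_in_def by blast
  qed
  moreover have "immediate_space extended_space" by (rule immediate_space_extended[OF pp(1)])
  moreover have "\<exists>b\<in>C. cut_equiv u b" if u: "u \<in> extended_space - K" for u
  proof -
    consider u' where "u' \<in> W - K" "cut u = cut u'" | \<beta> where "\<beta> \<in> value_group v K" "cut u = (+) \<beta> ` cut a"
      using extended_space_cuts[of u] u by blast
    then show ?thesis
    proof cases
      case 1
      then obtain b where "b \<in> C'" "cut_equiv u' b" using cuts by blast
      then show ?thesis using 1(2) by (auto simp: C'_def cut_equiv_def)
    next
      case 2
      then show ?thesis using aC by (auto simp: cut_equiv_def)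
    qed
  qed
  moreover obtain y :: "nat \<Rightarrow> 'a" where "lin_indep K {..<card ({..<p ^ card C'} \<times> {..<p})} y"
    and y: "y ` {..<card ({..<p ^ card C'} \<times> {..<p})} =
      (\<lambda>(i, j). w i * a ^ j) ` ({..<p ^ card C'} \<times> {..<p})"
    by (rule lin_indep_nat[OF lin_indep_extended(1)[OF w]])
  moreover have "y ` {..<card ({..<p ^ card C'} \<times> {..<p})} \<subseteq> extended_space"
    unfolding y by (rule lin_indep_extended(2)[OF w])
  moreover have "card ({..<p ^ card C'} \<times> {..<p}) = p ^ card C" by (simp add: card_C)
  ultimately show ?case by (intro exI[of _ extended_space] exI[of _ y]) simp
qed

end

section \<open>Degrees of field extensions\<close>

lemma ambient_simps [simp]:
  "carrier (ambient :: 'a::field ring) = UNIV" "x \<otimes>\<^bsub>ambient\<^esub> y = x * y" "x \<oplus>\<^bsub>ambient\<^esub> y = x + y"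
  "\<one>\<^bsub>ambient\<^esub> = (1 :: 'a)" "\<zero>\<^bsub>ambient\<^esub> = (0 :: 'a)"
  by (simp_all add: ring_of_type_algebra_def)

lemma ambient_a_inv: "a_inv ambient x = - (x :: 'a::field)"
proof -
  interpret ring "ambient :: 'a ring" by (rule ring_from_type_algebra)
  have "x \<oplus>\<^bsub>ambient\<^esub> a_inv ambient x = \<zero>\<^bsub>ambient\<^esub>" by (rule r_neg) simp
  then show ?thesis by (simp add: eq_neg_iff_add_eq_0 add.commute)
qed

lemma field_subfield_of_subfield:
  assumes "subfield K (ambient :: 'a::field ring)"
  shows "field_subfield K"
proof -
  interpret ring "ambient :: 'a ring" by (rule ring_from_type_algebra)
  note K = subringE[OF subfieldE(1)[OF assms]]
  show ?thesis
  proof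
    fix x y
    show "0 \<in> K" "1 \<in> K" using K(2,3) by simp_all
    show "x + y \<in> K" "x * y \<in> K" if "x \<in> K" "y \<in> K"
      using that K(6)[of x y] K(7)[of x y] by simp_all
    show "- x \<in> K" if "x \<in> K" using that K(5)[of x] by (simp add: ambient_a_inv)
    show "inverse x \<in> K" if "x \<in> K"
    proof (cases "x = 0")
      case False
      then have "m_inv ambient x \<in> K" "x * m_inv ambient x = 1"
        using subfield_m_inv[OF assms, of x] that by auto
      then show ?thesis using inverse_unique by metis
    qed (use that in simp)
  qed
qed

lemma combine_ambient:
  "length ks = length us \<Longrightarrow>
    ring.combine (ambient :: 'a::field ring) ks us = (\<Sum>i<length us. ks ! i * us ! i)"
proof (induction ks us rule: list_induct2)
  case Nil
  interpret ring "ambient :: 'a ring" by (rule ring_from_type_algebra)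
  show ?case by simp
next
  case (Cons k ks u us)
  interpret ring "ambient :: 'a ring" by (rule ring_from_type_algebra)
  show ?case by (simp add: Cons.IH sum.lessThan_Suc_shift del: sum.lessThan_Suc)
qed

lemma lin_indep_le_field_degree:
  fixes w :: "nat \<Rightarrow> 'a::field"
  assumes K: "subfield K (ambient :: 'a ring)" and fin: "ring.finite_dimension (ambient :: 'a ring) K L"
    and w: "lin_indep K {..<N} w" "w ` {..<N} \<subseteq> L"
  shows "N \<le> field_degree K L"
proof -
  interpret ring "ambient :: 'a ring" by (rule ring_from_type_algebra)
  interpret K: field_subfield K by (rule field_subfield_of_subfield[OF K])
  have "independent K (map w [0..<N])"
  proof (rule trivial_combine_imp_independent[OF K])
    fix ks assume ks: "set ks \<subseteq> K" "combine ks (map w [0..<N]) = \<zero>\<^bsub>ambient\<^esub>"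
    have "set ks \<subseteq> carrier ambient" "set (map w [0..<N]) \<subseteq> carrier ambient" by simp_all
    \<comment> \<open>The coefficient list may differ in length from the family; it is truncated or
      padded with zeros.\<close>
    from combine_normalize[OF this ks(2)] obtain ks' where ks':
      "set (take (length (map w [0..<N])) ks) \<subseteq> set ks'"
      "set ks' \<subseteq> set (take (length (map w [0..<N])) ks) \<union> {\<zero>\<^bsub>ambient\<^esub>}"
      "length ks' = length (map w [0..<N])" "combine ks' (map w [0..<N]) = \<zero>\<^bsub>ambient\<^esub>" by metis
    have "set ks' \<subseteq> K" using ks'(2) ks(1) set_take_subset[of "length (map w [0..<N])" ks] K.zero_mem
      by (auto dest!: subsetD)
    moreover have "(\<Sum>i<N. ks' ! i * w i) = 0"
      using ks'(4) ks'(3) by (simp add: combine_ambient)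
    ultimately have "ks' ! i = 0" if "i < N" for i
      using lin_indepD[OF w(1), of "\<lambda>i. ks' ! i" i] that ks'(3) by (auto dest: nth_mem)
    then have "set ks' \<subseteq> {0}" using ks'(3) by (auto simp: in_set_conv_nth)
    then show "set (take (length (map w [0..<N])) ks) \<subseteq> {\<zero>\<^bsub>ambient\<^esub>}" using ks'(1) by auto
  qed simp
  moreover have "set (map w [0..<N]) \<subseteq> L" using w(2) by auto
  ultimately have "length (map w [0..<N]) \<le> (dim over K) L"
    by (intro independent_length_le_dimension[OF K finite_dimensionE[OF K fin]])
  then show ?thesis by (simp add: field_degree_def)
qed

text \<open>Reduces the extension of an embedding to \<open>L\<close> to the adjunction of finitely
  many elements.\<close>

lemma finite_spanning_list:
  assumes K: "subfield K (ambient :: 'a::field ring)" and fin: "ring.finite_dimension (ambient :: 'a ring) K L"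
  obtains us where "\<And>E. field_subring E \<Longrightarrow> K \<subseteq> E \<Longrightarrow> set us \<subseteq> E \<Longrightarrow> L \<subseteq> E"
    "set us \<subseteq> L"
proof -
  interpret ring "ambient :: 'a ring" by (rule ring_from_type_algebra)
  obtain us where us: "set us \<subseteq> carrier ambient" "Span K us = L"
    using exists_base[OF K finite_dimensionE[OF K fin]] by blast
  have "L \<subseteq> E" if E: "field_subring E" "K \<subseteq> E" "set us \<subseteq> E" for E
  proof
    interpret E: field_subring E by fact
    fix x assume "x \<in> L"
    then obtain ks where ks: "set ks \<subseteq> K" "length ks = length us" "x = combine ks us"
      using Span_mem_iff_length_version[OF K us(1)] us(2) by blast
    have "x = (\<Sum>i<length us. ks ! i * us ! i)" unfolding ks(3) by (rule combine_ambient[OF ks(2)])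
    also have "\<dots> \<in> E"
    proof (intro E.self.W_sum E.mult_mem)
      fix i assume "i \<in> {..<length us}"
      then have "ks ! i \<in> set ks" "us ! i \<in> set us" using ks(2) by simp_all
      then show "ks ! i \<in> E" "us ! i \<in> E" using E ks(1) by auto
    qed
    finally show "x \<in> E" .
  qed
  moreover have "set us \<subseteq> L" using Span_base_incl[OF K us(1)] us(2) by simp
  ultimately show ?thesis using that by blast
qed

lemma algebraic_of_finite_dimension:
  assumes K: "subfield K (ambient :: 'a::field ring)" and fin: "ring.finite_dimension (ambient :: 'a ring) K L"
    and L: "field_subring L" and b: "b \<in> L"
  obtains f where "coeffs_in K f" "f \<noteq> 0" "poly f b = 0"
proof -
  interpret K: field_subfield K by (rule field_subfield_of_subfield[OF K])
  interpret L: field_subring L by fact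
  have "\<not> lin_indep K {..<Suc (field_degree K L)} (\<lambda>i. b ^ i)"
    using lin_indep_le_field_degree[OF K fin, of "Suc (field_degree K L)" "\<lambda>i. b ^ i"]
      L.self.power_mem[OF b] by auto
  then obtain c i where c: "\<And>i. i < Suc (field_degree K L) \<Longrightarrow> c i \<in> K"
    "(\<Sum>i<Suc (field_degree K L). c i * b ^ i) = 0" "i < Suc (field_degree K L)" "c i \<noteq> 0"
    unfolding lin_indep_def by auto
  define f where "f = (\<Sum>i<Suc (field_degree K L). monom (c i) i)"
  have cf: "Polynomial.coeff f j = (if j < Suc (field_degree K L) then c j else 0)" for j
    unfolding f_def by (simp add: coeff_sum sum.delta del: sum.lessThan_Suc)
  show ?thesis
  proof (rule that[of f])
    show "coeffs_in K f" using c(1) by (auto simp: coeffs_in_def cf)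
    show "f \<noteq> 0" using cf[of i] c(3,4) by auto
    show "poly f b = 0" using c(2) unfolding f_def by (simp add: poly_sum poly_monom del: sum.lessThan_Suc)
  qed
qed

section \<open>Extension of embeddings\<close>

text \<open>Only the restriction of \<open>s\<close> to \<open>E\<close> matters. On a subfield
  \<open>E\<close> these equations imply compatibility with 0, negation and inverses, and
  injectivity.\<close>

definition embedding_on :: "'a::field set \<Rightarrow> ('a \<Rightarrow> 'a) \<Rightarrow> bool" where
  "embedding_on E s \<longleftrightarrow> s 1 = 1 \<and> (\<forall>x\<in>E. \<forall>y\<in>E. s (x + y) = s x + s y \<and> s (x * y) = s x * s y)"

lemma minimal_polynomial:
  assumes "field_subfield E" and f: "coeffs_in E f" "f \<noteq> 0" "poly f b = (0 :: 'a::field)"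
  obtains \<mu> where "coeffs_in E \<mu>" "Polynomial.lead_coeff \<mu> = 1" "poly \<mu> b = 0"
    "\<And>g. coeffs_in E g \<Longrightarrow> poly g b = 0 \<Longrightarrow> g \<noteq> 0 \<Longrightarrow> Polynomial.degree \<mu> \<le> Polynomial.degree g"
    "\<And>g. coeffs_in E g \<Longrightarrow> poly g b = 0 \<Longrightarrow> \<exists>Q. coeffs_in E Q \<and> g = Q * \<mu>"
proof -
  interpret E: field_subfield E by fact
  define P where "P g \<longleftrightarrow> coeffs_in E g \<and> g \<noteq> 0 \<and> poly g b = 0" for g
  have "P f" using f by (simp add: P_def)
  then obtain g where g: "P g" and least: "\<And>h. P h \<Longrightarrow> Polynomial.degree g \<le> Polynomial.degree h"
    using ex_has_least_nat[of P f Polynomial.degree] by blast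
  define \<mu> where "\<mu> = smult (inverse (Polynomial.lead_coeff g)) g"
  have nz: "Polynomial.lead_coeff g \<noteq> 0" using g by (simp add: P_def leading_coeff_0_iff)
  have deg: "Polynomial.degree \<mu> = Polynomial.degree g" using nz by (simp add: \<mu>_def)
  have \<mu>E: "coeffs_in E \<mu>"
    unfolding \<mu>_def using g by (intro E.self.coeffs_in_smult E.inverse_mem) (auto simp: P_def coeffs_in_def)
  have \<mu>1: "Polynomial.lead_coeff \<mu> = 1" using nz by (simp add: \<mu>_def)
  have \<mu>b: "poly \<mu> b = 0" using g by (simp add: \<mu>_def P_def)
  show ?thesis
  proof (rule that[OF \<mu>E \<mu>1 \<mu>b])
    show least': "Polynomial.degree \<mu> \<le> Polynomial.degree h" if "coeffs_in E h" "poly h b = 0" "h \<noteq> 0" for h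
      using least[of h] that deg by (simp add: P_def)
    fix h assume h: "coeffs_in E h" "poly h b = 0"
    obtain Q r where Qr: "coeffs_in E Q" "coeffs_in E r" "h = Q * \<mu> + r"
      "\<forall>i\<ge>Polynomial.degree \<mu>. Polynomial.coeff r i = 0"
      using E.division_by_monic[OF \<mu>E \<mu>1 h(1)] by blast
    have "r = 0"
    proof (rule ccontr)
      assume r: "r \<noteq> 0"
      have "poly r b = 0" using h(2) \<mu>b unfolding Qr(3) by simp
      then have "Polynomial.degree \<mu> \<le> Polynomial.degree r" using least' Qr(2) r by blast
      then show False using Qr(4) r leading_coeff_0_iff by blast
    qed
    then show "\<exists>Q. coeffs_in E Q \<and> h = Q * \<mu>" using Qr by auto
  qed
qed

text \<open>The quotient of the polynomial ring by \<mu> is realized as the ring of values at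
  \<open>b\<close>. The map evaluates at \<open>b'\<close> the image of a chosen representing
  polynomial; two representatives differ by a multiple of \<mu>, so the choice does not
  matter.\<close>

lemma embedding_extend_simple:
  fixes b :: "'a::field"
  assumes E: "field_subfield E" and s: "embedding_on E s"
    and \<mu>: "coeffs_in E \<mu>" "Polynomial.lead_coeff \<mu> = 1" "poly \<mu> b = 0"
    and least: "\<And>g. coeffs_in E g \<Longrightarrow> poly g b = 0 \<Longrightarrow> g \<noteq> 0 \<Longrightarrow> Polynomial.degree \<mu> \<le> Polynomial.degree g"
    and divides: "\<And>g. coeffs_in E g \<Longrightarrow> poly g b = 0 \<Longrightarrow> \<exists>Q. coeffs_in E Q \<and> g = Q * \<mu>"
    and b': "poly (map_poly s \<mu>) b' = 0"
  shows "\<exists>E' s'. field_subfield E' \<and> embedding_on E' s' \<and> E \<subseteq> E' \<and> b \<in> E' \<and> s' b = b' \<and>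
    (\<forall>x\<in>E. s' x = s x)"
proof -
  interpret E: field_subfield E by fact
  have s1: "s 1 = 1" and s_add: "\<And>x y. x \<in> E \<Longrightarrow> y \<in> E \<Longrightarrow> s (x + y) = s x + s y"
    and s_mult: "\<And>x y. x \<in> E \<Longrightarrow> y \<in> E \<Longrightarrow> s (x * y) = s x * s y"
    using s by (auto simp: embedding_on_def)
  have "s 0 = s 0 + s 0" using s_add[of 0 0] by simp
  then have s0: "s 0 = 0" by (simp only: add_cancel_right_right)
  have s_sum: "s (sum f I) = (\<Sum>i\<in>I. s (f i))" if "\<And>i. i \<in> I \<Longrightarrow> f i \<in> E" for f and I :: "nat set"
    using that by (induction I rule: infinite_finite_induct) (auto simp: s0 s_add E.self.W_sum)
  have m_add: "map_poly s (f + g) = map_poly s f + map_poly s g" if "coeffs_in E f" "coeffs_in E g" for f g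
    using that by (intro poly_eqI) (auto simp: coeff_map_poly s0 s_add coeffs_in_def)
  have m_mult: "map_poly s (f * g) = map_poly s f * map_poly s g" if "coeffs_in E f" "coeffs_in E g" for f g
    using that by (intro poly_eqI) (auto simp: coeff_map_poly s0 s_mult s_sum coeff_mult coeffs_in_def E.mult_mem)
  have m_pCons: "map_poly s (pCons x f) = pCons (s x) (map_poly s f)" for x f
    by (intro poly_eqI) (auto simp: coeff_map_poly s0 coeff_pCons split: nat.splits)
  have wd: "poly (map_poly s f) b' = poly (map_poly s g) b'"
    if fg: "coeffs_in E f" "coeffs_in E g" "poly f b = poly g b" for f g
  proof -
    have "coeffs_in E (f - g)" by (rule E.self.coeffs_in_diff[OF fg(1,2)])
    then obtain Q where Q: "coeffs_in E Q" "f - g = Q * \<mu>" using divides[of "f - g"] fg(3) by auto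
    have "f = Q * \<mu> + g" using Q(2) by (simp add: algebra_simps)
    then have "map_poly s f = map_poly s Q * map_poly s \<mu> + map_poly s g"
      using m_add[OF E.self.coeffs_in_mult[OF Q(1) \<mu>(1)] fg(2)] m_mult[OF Q(1) \<mu>(1)] by simp
    then show ?thesis using b' by simp
  qed
  define E' where "E' = {poly f b | f. coeffs_in E f}"
  define s' where "s' x = poly (map_poly s (SOME f. coeffs_in E f \<and> poly f b = x)) b'" for x
  have s'_poly: "s' (poly f b) = poly (map_poly s f) b'" if "coeffs_in E f" for f
  proof -
    have "\<exists>g. coeffs_in E g \<and> poly g b = poly f b" using that by blast
    from someI_ex[OF this] show ?thesis unfolding s'_def using that by (intro wd) auto
  qed
  have E'I: "poly f b \<in> E'" if "coeffs_in E f" for f using that by (auto simp: E'_def)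
  have const: "x \<in> E'" if "x \<in> E" for x using E'I[of "[:x:]"] that by simp
  have E'_add: "x + y \<in> E'" and E'_mult: "x * y \<in> E'" if xy: "x \<in> E'" "y \<in> E'" for x y
  proof -
    obtain f g where fg: "coeffs_in E f" "x = poly f b" "coeffs_in E g" "y = poly g b"
      using xy by (auto simp: E'_def)
    show "x + y \<in> E'" using E'I[OF E.self.coeffs_in_add[OF fg(1,3)]] fg by simp
    show "x * y \<in> E'" using E'I[OF E.self.coeffs_in_mult[OF fg(1,3)]] fg by simp
  qed
  interpret E': field_subring E'
  proof
    show "0 \<in> E'" "1 \<in> E'" by (auto intro: const)
    show "- x \<in> E'" if "x \<in> E'" for x
      using E'_mult[OF const[of "- 1"] that] E.uminus_mem[of 1] by simp
  qed (auto intro: E'_add E'_mult)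
  have inv: "inverse x \<in> E'" if x: "x \<in> E'" "x \<noteq> 0" for x
  proof -
    obtain f0 where f0: "coeffs_in E f0" "x = poly f0 b" using x by (auto simp: E'_def)
    obtain Q f where f: "coeffs_in E Q" "coeffs_in E f" "f0 = Q * \<mu> + f"
      "\<forall>i\<ge>Polynomial.degree \<mu>. Polynomial.coeff f i = 0"
      using E.division_by_monic[OF \<mu>(1,2) f0(1)] by blast
    \<comment> \<open>Least degree produces a greatest common divisor of \<open>f\<close> and \<mu>.
      It divides \<mu> and does not vanish at \<open>b\<close>, so the cofactor vanishes there and
      has full degree; the divisor is constant, and its relation to \<open>x\<close> gives the
      inverse.\<close>
    define P where "P g \<longleftrightarrow> coeffs_in E g \<and> g \<noteq> 0 \<and> (\<exists>z\<in>E'. poly g b = x * z)" for g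
    have xf: "x = poly f b" using f0(2) f(3) \<mu>(3) by simp
    then have f_nz: "f \<noteq> 0" using x by auto
    have "P f" unfolding P_def using f f_nz xf E'.one_mem by (metis mult.right_neutral)
    then obtain g where g: "P g" and g_least: "\<And>h. P h \<Longrightarrow> Polynomial.degree g \<le> Polynomial.degree h"
      using ex_has_least_nat[of P f Polynomial.degree] by blast
    define g1 where "g1 = smult (inverse (Polynomial.lead_coeff g)) g"
    have lg: "Polynomial.lead_coeff g \<noteq> 0" "Polynomial.lead_coeff g \<in> E"
      using g by (auto simp: P_def leading_coeff_0_iff coeffs_in_def)
    have deg1: "Polynomial.degree g1 = Polynomial.degree g" using lg by (simp add: g1_def)
    have g1E: "coeffs_in E g1" "Polynomial.lead_coeff g1 = 1"
      using g lg by (auto simp: g1_def P_def intro: E.self.coeffs_in_smult E.inverse_mem)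
    obtain z where z: "z \<in> E'" "poly g b = x * z" using g by (auto simp: P_def)
    define z1 where "z1 = inverse (Polynomial.lead_coeff g) * z"
    have "z1 \<in> E'" unfolding z1_def by (intro E'_mult const E.inverse_mem lg z)
    moreover have "poly g1 b = x * z1" using z by (simp add: g1_def z1_def)
    ultimately have z1: "z1 \<in> E'" "poly g1 b = x * z1" .
    obtain R r where Rr: "coeffs_in E R" "coeffs_in E r" "\<mu> = R * g1 + r"
      "\<forall>i\<ge>Polynomial.degree g1. Polynomial.coeff r i = 0"
      using E.division_by_monic[OF g1E \<mu>(1)] by blast
    have "r = 0"
    proof (rule ccontr)
      assume r: "r \<noteq> 0"
      have "poly r b = x * (- poly R b * z1)"
        using \<mu>(3) z1(2) unfolding Rr(3) by (simp add: eq_neg_iff_add_eq_0 algebra_simps)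
      moreover have "- poly R b * z1 \<in> E'" using z1(1) E'I[OF Rr(1)] by (intro E'_mult E'.uminus_mem)
      ultimately have "P r" unfolding P_def using r Rr(2) by blast
      then have "Polynomial.degree g1 \<le> Polynomial.degree r" using g_least deg1 by simp
      then show False using Rr(4) r leading_coeff_0_iff by blast
    qed
    then have \<mu>_eq: "\<mu> = R * g1" using Rr(3) by simp
    have "\<mu> \<noteq> 0" using \<mu>(2) by auto
    then have R_nz: "R \<noteq> 0" "g1 \<noteq> 0" using \<mu>_eq by auto
    have deg_f: "Polynomial.degree f < Polynomial.degree \<mu>"
      using f(4) f_nz leading_coeff_0_iff not_le by blast
    have "poly g1 b \<noteq> 0"
    proof
      assume "poly g1 b = 0"
      then have "Polynomial.degree \<mu> \<le> Polynomial.degree g1" using least g1E(1) R_nz(2) by blast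
      also have "\<dots> \<le> Polynomial.degree f" using g_least[OF \<open>P f\<close>] deg1 by simp
      finally show False using deg_f by simp
    qed
    then have "poly R b = 0" using \<mu>(3) \<mu>_eq by simp
    then have "Polynomial.degree \<mu> \<le> Polynomial.degree R" using least Rr(1) R_nz(1) by blast
    moreover have "Polynomial.degree \<mu> = Polynomial.degree R + Polynomial.degree g1"
      unfolding \<mu>_eq by (rule degree_mult_eq[OF R_nz])
    ultimately have "Polynomial.degree g1 = 0" by simp
    then obtain c where "g1 = [:c:]" by (auto elim: degree_eq_zeroE)
    then have "x * z1 = 1" using g1E(2) z1(2) by simp
    then have "inverse x = z1" by (rule inverse_unique)
    then show ?thesis using z1(1) by simp
  qed
  show ?thesis
  proof (intro exI[of _ E'] exI[of _ s'] conjI ballI)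
    show "field_subfield E'"
    proof
      show "inverse x \<in> E'" if "x \<in> E'" for x using inv[OF that] that by (cases "x = 0") auto
    qed
    show eq: "s' x = s x" if "x \<in> E" for x
      using s'_poly[of "[:x:]"] that by (simp add: m_pCons)
    have "s' 1 = 1" using s1 eq[of 1] by simp
    moreover have "s' (x + y) = s' x + s' y \<and> s' (x * y) = s' x * s' y" if xy: "x \<in> E'" "y \<in> E'" for x y
    proof -
      obtain f g where fg: "coeffs_in E f" "x = poly f b" "coeffs_in E g" "y = poly g b"
        using xy by (auto simp: E'_def)
      have "s' (x + y) = poly (map_poly s (f + g)) b'"
        using s'_poly[OF E.self.coeffs_in_add[OF fg(1,3)]] fg by simp
      moreover have "s' (x * y) = poly (map_poly s (f * g)) b'"
        using s'_poly[OF E.self.coeffs_in_mult[OF fg(1,3)]] fg by simp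
      ultimately show ?thesis using fg s'_poly m_add m_mult by simp
    qed
    ultimately show "embedding_on E' s'" by (auto simp: embedding_on_def)
    show "E \<subseteq> E'" using const by blast
    have X: "coeffs_in E [:0, 1:]" by simp
    show "b \<in> E'" using E'I[OF X] by simp
    show "s' b = b'" using s'_poly[OF X] by (simp add: m_pCons s0 s1)
  qed
qed

lemma embedding_extend:
  fixes s :: "'a::alg_closed_field \<Rightarrow> 'a"
  assumes "field_subfield E" "embedding_on E s" "K \<subseteq> E"
    and "\<And>b. b \<in> set bs \<Longrightarrow> \<exists>f. coeffs_in K f \<and> f \<noteq> 0 \<and> poly f b = 0"
  shows "\<exists>E' s'. field_subfield E' \<and> embedding_on E' s' \<and> E \<subseteq> E' \<and> set bs \<subseteq> E' \<and> (\<forall>x\<in>E. s' x = s x)"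
  using assms
proof (induction bs arbitrary: E s)
  case Nil
  then show ?case by auto
next
  case (Cons b bs)
  obtain f where f: "coeffs_in K f" "f \<noteq> 0" "poly f b = 0" using Cons.prems(4)[of b] by auto
  have fE: "coeffs_in E f" using f(1) Cons.prems(3) by (auto simp: coeffs_in_def)
  obtain \<mu> where \<mu>: "coeffs_in E \<mu>" "Polynomial.lead_coeff \<mu> = 1" "poly \<mu> b = 0"
    "\<And>g. coeffs_in E g \<Longrightarrow> poly g b = 0 \<Longrightarrow> g \<noteq> 0 \<Longrightarrow> Polynomial.degree \<mu> \<le> Polynomial.degree g"
    "\<And>g. coeffs_in E g \<Longrightarrow> poly g b = 0 \<Longrightarrow> \<exists>Q. coeffs_in E Q \<and> g = Q * \<mu>"
    using minimal_polynomial[OF Cons.prems(1) fE f(2,3)] by blast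
  have "Polynomial.degree \<mu> > 0"
    using \<mu>(2,3) by (metis degree_eq_zeroE gr0I lead_coeff_pCons(2) mult_zero_right poly_0 poly_pCons zero_neq_one add.right_neutral)
  moreover have "Polynomial.degree (map_poly s \<mu>) = Polynomial.degree \<mu>"
  proof -
    have "s 0 = 0"
      using Cons.prems(2) field_subring.zero_mem[OF field_subfield.axioms(1)[OF Cons.prems(1)]]
      unfolding embedding_on_def by (metis add_cancel_right_right)
    moreover have "s 1 = 1" using Cons.prems(2) by (simp add: embedding_on_def)
    ultimately show ?thesis
      using \<mu>(2) by (intro antisym degree_le le_degree) (auto simp: coeff_map_poly coeff_eq_0)
  qed
  ultimately obtain b' where b': "poly (map_poly s \<mu>) b' = 0"
    using alg_closed_imp_poly_has_root[of "map_poly s \<mu>"] by auto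
  have "\<exists>E' s'. field_subfield E' \<and> embedding_on E' s' \<and> E \<subseteq> E' \<and> b \<in> E' \<and> s' b = b' \<and>
    (\<forall>x\<in>E. s' x = s x)"
    by (rule embedding_extend_simple[OF Cons.prems(1,2) \<mu>(1-3) _ _ b']) (blast intro: \<mu>(4,5))+
  then obtain E1 s1 where 1: "field_subfield E1" "embedding_on E1 s1" "E \<subseteq> E1" "b \<in> E1" "\<And>x. x \<in> E \<Longrightarrow> s1 x = s x"
    by blast
  have "\<exists>E' s'. field_subfield E' \<and> embedding_on E' s' \<and> E1 \<subseteq> E' \<and> set bs \<subseteq> E' \<and> (\<forall>x\<in>E1. s' x = s1 x)"
    using 1 Cons.prems by (intro Cons.IH) auto
  then obtain E' s' where "field_subfield E'" "embedding_on E' s'" "E1 \<subseteq> E'" "set bs \<subseteq> E'" "\<forall>x\<in>E1. s' x = s1 x"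
    by blast
  then show ?case using 1 by (intro exI[of _ E'] exI[of _ s']) auto
qed


text \<open>For a root \<open>x\<close> of the minimal polynomial of \<open>a\<close>, some
  embedding \<open>s\<close> of \<open>L\<close> over \<open>K\<close> sends \<open>a\<close> to
  \<open>x\<close>. It may leave \<open>L\<close>, but \<open>v\<close> is defined everywhere, so
  \<open>v \<circ> s\<close> is an extension of \<open>v\<close> to \<open>L\<close>. By uniqueness
  it is \<open>v\<close>, and \<open>s\<close> sends \<open>a - c\<close> to
  \<open>x - c\<close>.\<close>

lemma unique_extension_conjugates:
  fixes v :: "'a::alg_closed_field \<Rightarrow> 'g::linordered_ab_group_add"
  assumes v: "valuation_on UNIV v" and K: "subfield K (ambient :: 'a ring)"
    and L: "subfield L (ambient :: 'a ring)" and KL: "K \<subseteq> L"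
    and fin: "ring.finite_dimension (ambient :: 'a ring) K L"
    and unique: "unique_extension v K L" and a: "a \<in> L" "a \<notin> K"
  shows "\<exists>A. coeffs_in K (\<Prod>x\<in>#A. [:- x, 1:]) \<and> a \<in># A \<and>
    (\<forall>x\<in>#A. \<forall>c\<in>K. v (x - c) = v (a - c))"
proof -
  interpret valued_field v by unfold_locales (rule v)
  interpret K: field_subfield K by (rule field_subfield_of_subfield[OF K])
  interpret L: field_subfield L by (rule field_subfield_of_subfield[OF L])
  have alg: "\<exists>f. coeffs_in K f \<and> f \<noteq> 0 \<and> poly f b = 0" if "b \<in> L" for b
    using algebraic_of_finite_dimension[OF K fin L.field_subring_axioms that] by metis
  obtain f where f: "coeffs_in K f" "f \<noteq> 0" "poly f a = 0" using alg[OF a(1)] by blast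
  obtain \<mu> where \<mu>: "coeffs_in K \<mu>" "Polynomial.lead_coeff \<mu> = 1" "poly \<mu> a = 0"
    "\<And>g. coeffs_in K g \<Longrightarrow> poly g a = 0 \<Longrightarrow> g \<noteq> 0 \<Longrightarrow> Polynomial.degree \<mu> \<le> Polynomial.degree g"
    "\<And>g. coeffs_in K g \<Longrightarrow> poly g a = 0 \<Longrightarrow> \<exists>Q. coeffs_in K Q \<and> g = Q * \<mu>"
    using minimal_polynomial[OF K.field_subfield_axioms f] by blast
  have "\<mu> \<noteq> 0" using \<mu>(2) by auto
  then obtain A where A: "\<mu> = (\<Prod>x\<in>#A. [:- x, 1:])"
    using alg_closed_imp_factorization[of \<mu>] \<mu>(2) by auto
  have root: "poly \<mu> y = 0 \<longleftrightarrow> y \<in># A" for y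
    unfolding A by (induction A) (auto simp: algebra_simps)
  have "v (x - c) = v (a - c)" if x: "x \<in># A" and c: "c \<in> K" for x c
  proof -
    have id: "embedding_on K id" by (simp add: embedding_on_def)
    have "poly (map_poly id \<mu>) x = 0" using root x by (simp add: map_poly_id)
    then have "\<exists>E' s'. field_subfield E' \<and> embedding_on E' s' \<and> K \<subseteq> E' \<and> a \<in> E' \<and> s' a = x \<and>
      (\<forall>y\<in>K. s' y = id y)"
      by (intro embedding_extend_simple[OF K.field_subfield_axioms id \<mu>(1-3)]) (blast intro: \<mu>(4,5))+
    then obtain E1 s1 where E1: "field_subfield E1" "embedding_on E1 s1" "K \<subseteq> E1" "a \<in> E1" "s1 a = x"
      "\<And>y. y \<in> K \<Longrightarrow> s1 y = y" by auto
    obtain us where us: "\<And>E. field_subring E \<Longrightarrow> K \<subseteq> E \<Longrightarrow> set us \<subseteq> E \<Longrightarrow> L \<subseteq> E" "set us \<subseteq> L"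
      using finite_spanning_list[OF K fin] by blast
    have "\<exists>E' s'. field_subfield E' \<and> embedding_on E' s' \<and> E1 \<subseteq> E' \<and> set us \<subseteq> E' \<and> (\<forall>y\<in>E1. s' y = s1 y)"
      by (rule embedding_extend[OF E1(1-3)]) (use us(2) alg in blast)
    then obtain E s where E: "field_subfield E" "embedding_on E s" "E1 \<subseteq> E" "set us \<subseteq> E" "\<And>y. y \<in> E1 \<Longrightarrow> s y = s1 y"
      by blast
    have LE: "L \<subseteq> E" using us(1)[of E] E E1(3) field_subfield.axioms(1)[OF E(1)] by blast
    have s_add: "s (y + z) = s y + s z" and s_mult: "s (y * z) = s y * s z" if "y \<in> L" "z \<in> L" for y z
      using that LE E(2) by (auto simp: embedding_on_def)
    have sK: "s y = y" if "y \<in> K" for y using that E(5) E1(3,6) by auto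
    have s_nz: "s y \<noteq> 0" if "y \<in> L" "y \<noteq> 0" for y
    proof
      assume "s y = 0"
      then have "s (y * inverse y) = 0" using s_mult[OF that(1) L.inverse_mem[OF that(1)]] by simp
      then show False using that(2) sK[OF K.one_mem] by simp
    qed
    have "valuation_on L (v \<circ> s)"
      unfolding valuation_on_def
    proof (intro conjI ballI impI)
      fix y z assume yz: "y \<in> L - {0}" "z \<in> L - {0}"
      then show "(v \<circ> s) (y * z) = (v \<circ> s) y + (v \<circ> s) z"
        using s_mult s_nz by (simp add: v_mult)
      assume "y + z \<noteq> 0"
      then have "s (y + z) \<noteq> 0" using yz by (intro s_nz) (auto intro: L.add_mem)
      then show "min ((v \<circ> s) y) ((v \<circ> s) z) \<le> (v \<circ> s) (y + z)"
        using v_add[of "s y" "s z"] yz s_nz s_add by simp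
    qed
    moreover have "\<forall>y\<in>K - {0}. (v \<circ> s) y = v y" using sK by simp
    ultimately have eq: "\<forall>y\<in>L - {0}. (v \<circ> s) y = v y"
      using unique unfolding unique_extension_def by blast
    have "c \<in> L" "- c \<in> L" "- c \<in> K" using c KL K.uminus_mem by auto
    then have "s (a + - c) = x - c" using s_add[of a "- c"] a(1) sK[of "- c"] E(5) E1(4,5) by simp
    moreover have "a + - c \<in> L - {0}" using a c \<open>- c \<in> L\<close> L.add_mem[of a "- c"] by auto
    ultimately have "v (x - c) = v (a + - c)" using eq by (metis comp_apply)
    then show ?thesis by simp
  qed
  then show ?thesis using \<mu>(1,3) root[of a] unfolding A by blast
qed

section \<open>Ramification index and residue degree\<close>

locale valued_extension = valued_field v + K: field_subfield K + L: field_subfield L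
  for v :: "'a::field \<Rightarrow> 'g::linordered_ab_group_add" and K L :: "'a set" +
  assumes K_subset_L: "K \<subseteq> L"
begin

lemma valuation_ring_iff: "x \<in> valuation_ring v F \<longleftrightarrow> x \<in> F \<and> val_ge x 0"
  by (simp add: valuation_ring_def val_ge_def)

lemma valuation_ideal_iff: "x \<in> valuation_ideal v F \<longleftrightarrow> x \<in> F \<and> val_gt x 0"
  by (simp add: valuation_ideal_def val_gt_def)

section \<open>The residue field of \<open>L\<close> and the image of that of
  \<open>K\<close>\<close>

abbreviation O_L :: "'a ring" where
  "O_L \<equiv> ambient\<lparr>carrier := valuation_ring v L\<rparr>"

abbreviation residue :: "'a \<Rightarrow> 'a set" where
  "residue x \<equiv> valuation_ideal v L +>\<^bsub>O_L\<^esub> x"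

lemma val_ge_0_mult: "val_ge x 0 \<Longrightarrow> val_ge y 0 \<Longrightarrow> val_ge (x * y) 0"
  using val_ge_mult[of x 0 y 0] by simp

lemma valuation_ring_subring:
  assumes "field_subfield F"
  shows "subring (valuation_ring v F) (ambient :: 'a ring)"
proof -
  interpret F: field_subfield F by fact
  interpret field "ambient :: 'a ring" by (rule field_from_type_algebra)
  show ?thesis
    by (rule subringI)
      (auto simp: valuation_ring_iff val_ge_def[of 1] ambient_a_inv intro: F.uminus_mem F.mult_mem F.add_mem val_ge_0_mult val_ge_add)
qed

lemma cring_O_L: "cring O_L"
proof -
  interpret field "ambient :: 'a ring" by (rule field_from_type_algebra)
  show ?thesis
    using subcring_iff[of "valuation_ring v L"] subcringI'[OF valuation_ring_subring[OF L.field_subfield_axioms]]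
    by simp
qed

lemma ideal_O_L: "ideal (valuation_ideal v L) O_L"
proof -
  interpret O: cring O_L by (rule cring_O_L)
  have minus: "a_inv O_L x = - x" if "x \<in> valuation_ring v L" for x
  proof -
    have "x \<oplus>\<^bsub>O_L\<^esub> a_inv O_L x = \<zero>\<^bsub>O_L\<^esub>" using that by (intro O.r_neg) simp
    then show ?thesis by (simp add: eq_neg_iff_add_eq_0 add.commute)
  qed
  have sub: "valuation_ideal v L \<subseteq> valuation_ring v L"
    by (auto simp: valuation_ideal_iff valuation_ring_iff intro: val_gt_imp_ge)
  show ?thesis
  proof (rule idealI)
    show "ring O_L" by (rule O.ring_axioms)
    show "subgroup (valuation_ideal v L) (add_monoid O_L)"
    proof (rule O.add.subgroupI)
      show "valuation_ideal v L \<subseteq> carrier O_L" using sub by simp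
      have "0 \<in> valuation_ideal v L" by (simp add: valuation_ideal_iff)
      then show "valuation_ideal v L \<noteq> {}" by blast
      fix x y assume x: "x \<in> valuation_ideal v L"
      have "a_inv O_L x = - x" using minus[of x] x sub by auto
      then show "a_inv O_L x \<in> valuation_ideal v L"
        using x by (simp add: valuation_ideal_iff L.uminus_mem)
      assume "y \<in> valuation_ideal v L"
      then show "x \<oplus>\<^bsub>O_L\<^esub> y \<in> valuation_ideal v L"
        using x by (simp add: valuation_ideal_iff L.add_mem val_gt_add)
    qed
    fix x y assume "x \<in> valuation_ideal v L" "y \<in> carrier O_L"
    then show "y \<otimes>\<^bsub>O_L\<^esub> x \<in> valuation_ideal v L" "x \<otimes>\<^bsub>O_L\<^esub> y \<in> valuation_ideal v L"
      using val_ge_gt_mult[of y 0 x 0] val_gt_ge_mult[of x 0 y 0]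
      by (auto simp: valuation_ideal_iff valuation_ring_iff L.mult_mem)
  qed
qed

lemma residue_hom: "ring_hom_ring O_L (residue_field v L) residue"
  unfolding residue_field_def by (rule ideal.rcos_ring_hom_ring[OF ideal_O_L])

lemma residue_zero_iff:
  assumes "x \<in> valuation_ring v L"
  shows "residue x = \<zero>\<^bsub>residue_field v L\<^esub> \<longleftrightarrow> x \<in> valuation_ideal v L"
proof -
  interpret O: cring O_L by (rule cring_O_L)
  have "\<zero>\<^bsub>residue_field v L\<^esub> = valuation_ideal v L" by (simp add: residue_field_def FactRing_def)
  then show ?thesis
    using O.a_rcos_zero[OF ideal_O_L] ideal.rcos_const_imp_mem[OF ideal_O_L] assms by auto
qed

lemma carrier_residue_field: "carrier (residue_field v L) = residue ` valuation_ring v L"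
  by (simp add: residue_field_def FactRing_def A_RCOSETS_def' UNION_singleton_eq_range)

lemma residue_mult_inverse:
  assumes "x \<in> valuation_ring v F" "x \<notin> valuation_ideal v L" "field_subfield F" "F \<subseteq> L"
  shows "inverse x \<in> valuation_ring v F" "residue x \<otimes>\<^bsub>residue_field v L\<^esub> residue (inverse x) = \<one>\<^bsub>residue_field v L\<^esub>"
proof -
  have "x \<in> L" "x \<in> F" using assms(1,4) by (auto simp: valuation_ring_iff)
  then have x: "x \<noteq> 0" "v x = 0"
    using assms(1,2) by (auto simp: valuation_ring_iff valuation_ideal_iff val_ge_def val_gt_def)
  then show inv: "inverse x \<in> valuation_ring v F"
    using assms(1) field_subfield.inverse_mem[OF assms(3)]
    by (auto simp: valuation_ring_iff val_ge_def v_inverse)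
  have "x \<in> carrier O_L" "inverse x \<in> carrier O_L"
    using assms(1,4) inv by (auto simp: valuation_ring_iff)
  interpret h: ring_hom_ring O_L "residue_field v L" residue by (rule residue_hom)
  have "residue x \<otimes>\<^bsub>residue_field v L\<^esub> residue (inverse x) = residue (x \<otimes>\<^bsub>O_L\<^esub> inverse x)"
    by (simp only: h.hom_mult \<open>x \<in> carrier O_L\<close> \<open>inverse x \<in> carrier O_L\<close>)
  also have "x \<otimes>\<^bsub>O_L\<^esub> inverse x = \<one>\<^bsub>O_L\<^esub>" using x by simp
  also have "residue \<one>\<^bsub>O_L\<^esub> = \<one>\<^bsub>residue_field v L\<^esub>" by (rule h.hom_one)
  finally show "residue x \<otimes>\<^bsub>residue_field v L\<^esub> residue (inverse x) = \<one>\<^bsub>residue_field v L\<^esub>" .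
qed

lemma field_residue_field: "field (residue_field v L)"
proof -
  interpret h: ring_hom_ring O_L "residue_field v L" residue by (rule residue_hom)
  interpret O: cring O_L by (rule cring_O_L)
  interpret S: cring "residue_field v L"
    unfolding residue_field_def by (rule ideal.quotient_is_cring[OF ideal_O_L cring_O_L])
  show ?thesis
  proof (rule S.cring_fieldI2)
    have one: "1 \<in> valuation_ring v L" by (simp add: valuation_ring_iff val_ge_def)
    have "1 \<notin> valuation_ideal v L" by (simp add: valuation_ideal_iff val_gt_def)
    then have "residue 1 \<noteq> \<zero>\<^bsub>residue_field v L\<^esub>" using residue_zero_iff[OF one] by simp
    then show "\<zero>\<^bsub>residue_field v L\<^esub> \<noteq> \<one>\<^bsub>residue_field v L\<^esub>" using h.hom_one by auto
    fix \<xi> assume \<xi>: "\<xi> \<in> carrier (residue_field v L)" "\<xi> \<noteq> \<zero>\<^bsub>residue_field v L\<^esub>"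
    then obtain x where x: "x \<in> valuation_ring v L" "\<xi> = residue x" by (auto simp: carrier_residue_field)
    then have "x \<notin> valuation_ideal v L" using \<xi>(2) residue_zero_iff[OF x(1)] by metis
    from residue_mult_inverse[OF x(1) this L.field_subfield_axioms]
    show "\<exists>Y\<in>carrier (residue_field v L). \<xi> \<otimes>\<^bsub>residue_field v L\<^esub> Y = \<one>\<^bsub>residue_field v L\<^esub>"
      unfolding x(2) carrier_residue_field by blast
  qed
qed

lemma subfield_residue_subfield: "subfield (residue_subfield v K L) (residue_field v L)"
proof -
  interpret h: ring_hom_ring O_L "residue_field v L" residue by (rule residue_hom)
  interpret S: field "residue_field v L" by (rule field_residue_field)
  interpret A: field "ambient :: 'a ring" by (rule field_from_type_algebra)
  have sub: "valuation_ring v K \<subseteq> valuation_ring v L" using K_subset_L by (auto simp: valuation_ring_iff)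
  have "subring (valuation_ring v K) O_L"
  proof (rule h.R.subringI)
    fix x y assume x: "x \<in> valuation_ring v K"
    have "x \<oplus>\<^bsub>O_L\<^esub> a_inv O_L x = \<zero>\<^bsub>O_L\<^esub>" using x sub by (intro h.R.r_neg) auto
    then have "a_inv O_L x = - x" by (simp add: eq_neg_iff_add_eq_0 add.commute)
    then show "a_inv O_L x \<in> valuation_ring v K"
      using x by (simp add: valuation_ring_iff K.uminus_mem)
    assume "y \<in> valuation_ring v K"
    then show "x \<otimes>\<^bsub>O_L\<^esub> y \<in> valuation_ring v K" "x \<oplus>\<^bsub>O_L\<^esub> y \<in> valuation_ring v K"
      using x by (auto simp: valuation_ring_iff K.mult_mem K.add_mem val_ge_0_mult val_ge_add)
  qed (use sub in \<open>auto simp: valuation_ring_iff val_ge_def\<close>)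
  then have ring: "subring (residue_subfield v K L) (residue_field v L)"
    unfolding residue_subfield_def by (rule h.img_is_subring)
  show ?thesis
  proof (rule S.subfieldI'[OF ring])
    fix \<xi> assume \<xi>: "\<xi> \<in> residue_subfield v K L - {\<zero>\<^bsub>residue_field v L\<^esub>}"
    then obtain x where x: "x \<in> valuation_ring v K" "\<xi> = residue x" by (auto simp: residue_subfield_def)
    then have "x \<notin> valuation_ideal v L" using \<xi> residue_zero_iff sub by auto
    note inv = residue_mult_inverse[OF x(1) this K.field_subfield_axioms K_subset_L]
    have "inv\<^bsub>residue_field v L\<^esub> \<xi> = residue (inverse x)"
      using inv x sub by (intro S.comm_inv_char) (auto simp: carrier_residue_field)
    then show "inv\<^bsub>residue_field v L\<^esub> \<xi> \<in> residue_subfield v K L"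
      using inv(1) by (simp add: residue_subfield_def)
  qed
qed

text \<open>Lifts of residues that are linearly independent over the image of \<open>Kv\<close>,
  phrased inside \<open>L\<close> so that later computations involve values only.\<close>

definition residue_indep :: "nat \<Rightarrow> (nat \<Rightarrow> 'a) \<Rightarrow> bool" where
  "residue_indep n z \<longleftrightarrow> (\<forall>j<n. z j \<in> valuation_ring v L) \<and>
    (\<forall>c. (\<forall>j<n. c j \<in> valuation_ring v K) \<longrightarrow> (\<Sum>j<n. c j * z j) \<in> valuation_ideal v L \<longrightarrow>
      (\<forall>j<n. c j \<in> valuation_ideal v L))"

lemma ring_residue_field: "ring (residue_field v L)"
  unfolding residue_field_def by (rule ideal.quotient_is_ring[OF ideal_O_L])

lemma residue_add_mult:
  assumes "x \<in> valuation_ring v L" "y \<in> valuation_ring v L"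
  shows "residue (x + y) = residue x \<oplus>\<^bsub>residue_field v L\<^esub> residue y"
    and "residue (x * y) = residue x \<otimes>\<^bsub>residue_field v L\<^esub> residue y"
  using ring_hom_ring.axioms(1)[OF residue_hom] ring_hom_add[OF ring_hom_ring.homh[OF residue_hom], of x y]
    ring_hom_mult[OF ring_hom_ring.homh[OF residue_hom], of x y] assms by simp_all

lemma combine_residue:
  assumes "length cs = length zs" "set cs \<subseteq> valuation_ring v L" "set zs \<subseteq> valuation_ring v L"
  shows "ring.combine (residue_field v L) (map residue cs) (map residue zs) =
      residue (\<Sum>j<length cs. cs ! j * zs ! j) \<and>
    (\<Sum>j<length cs. cs ! j * zs ! j) \<in> valuation_ring v L"
  using assms
proof (induction cs zs rule: list_induct2)
  case Nil
  have "(0 :: 'a) \<in> valuation_ring v L" by (simp add: valuation_ring_iff)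
  moreover have "(0 :: 'a) \<in> valuation_ideal v L" by (simp add: valuation_ideal_iff)
  ultimately show ?case using residue_zero_iff[of 0] ring.combine.simps(2)[OF ring_residue_field] by simp
next
  case (Cons c cs z zs)
  let ?s = "\<Sum>j<length cs. cs ! j * zs ! j"
  have IH: "ring.combine (residue_field v L) (map residue cs) (map residue zs) = residue ?s"
      "?s \<in> valuation_ring v L"
    using Cons by auto
  have cz: "c \<in> valuation_ring v L" "z \<in> valuation_ring v L" "c * z \<in> valuation_ring v L"
    using Cons.prems by (auto simp: valuation_ring_iff L.mult_mem val_ge_0_mult)
  have sum: "(\<Sum>j<length (c # cs). (c # cs) ! j * (z # zs) ! j) = c * z + ?s"
    by (simp add: sum.lessThan_Suc_shift del: sum.lessThan_Suc)
  have "residue (c * z + ?s) = residue c \<otimes>\<^bsub>residue_field v L\<^esub> residue z \<oplus>\<^bsub>residue_field v L\<^esub> residue ?s"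
    by (simp only: residue_add_mult(1)[OF cz(3) IH(2)] residue_add_mult(2)[OF cz(1,2)])
  moreover have "c * z + ?s \<in> valuation_ring v L"
    using cz(3) IH(2) by (auto simp: valuation_ring_iff L.add_mem val_ge_add)
  ultimately show ?case
    unfolding sum list.map ring.combine.simps(1)[OF ring_residue_field] IH(1) by simp
qed

lemma residue_indep_of_independent:
  assumes ind: "ring.independent (residue_field v L) (residue_subfield v K L) us"
  shows "\<exists>z. residue_indep (length us) z"
proof -
  have sub: "valuation_ring v K \<subseteq> valuation_ring v L" using K_subset_L by (auto simp: valuation_ring_iff)
  have "set us \<subseteq> residue ` valuation_ring v L"
    using ring.independent_in_carrier[OF ring_residue_field ind] carrier_residue_field by simp
  then have "\<forall>y\<in>set us. \<exists>x. x \<in> valuation_ring v L \<and> residue x = y" by auto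
  from bchoice[OF this] obtain g where g: "\<And>y. y \<in> set us \<Longrightarrow> g y \<in> valuation_ring v L \<and> residue (g y) = y"
    by blast
  define zs where "zs = map g us"
  have zs: "set zs \<subseteq> valuation_ring v L" "us = map residue zs"
    using g by (auto simp: zs_def map_idI)
  have "residue_indep (length us) (\<lambda>j. zs ! j)"
    unfolding residue_indep_def
  proof (intro conjI allI impI)
    show "zs ! j \<in> valuation_ring v L" if "j < length us" for j
      using zs that by auto
    fix c j assume c: "\<forall>j<length us. c j \<in> valuation_ring v K"
      "(\<Sum>j<length us. c j * zs ! j) \<in> valuation_ideal v L" and j: "j < length us"
    define cs where "cs = map c [0..<length us]"
    have len: "length cs = length us" "length zs = length us" by (simp_all add: cs_def zs_def)
    have cs: "set cs \<subseteq> valuation_ring v K" using c(1) by (auto simp: cs_def)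
    have cL: "set cs \<subseteq> valuation_ring v L" using cs sub by blast
    have sum: "(\<Sum>j<length cs. cs ! j * zs ! j) = (\<Sum>j<length us. c j * zs ! j)"
      by (simp add: cs_def)
    have "length cs = length zs" using len by simp
    from combine_residue[OF this cL zs(1)]
    have "ring.combine (residue_field v L) (map residue cs) us = residue (\<Sum>j<length us. c j * zs ! j)"
      and "(\<Sum>j<length us. c j * zs ! j) \<in> valuation_ring v L"
      unfolding sum zs(2)[symmetric] by simp_all
    then have "ring.combine (residue_field v L) (map residue cs) us = \<zero>\<^bsub>residue_field v L\<^esub>"
      using residue_zero_iff c(2) by simp
    moreover have "set (map residue cs) \<subseteq> residue_subfield v K L"
      using cs by (auto simp: residue_subfield_def)
    ultimately have "set (take (length us) (map residue cs)) \<subseteq> {\<zero>\<^bsub>residue_field v L\<^esub>}"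
      by (intro ring.independent_imp_trivial_combine[OF ring_residue_field subfield_residue_subfield ind])
    moreover have "residue (cs ! j) \<in> set (take (length us) (map residue cs))"
    proof -
      have "take (length us) (map residue cs) = map residue cs" using len by simp
      moreover have "cs ! j \<in> set cs" using j len by simp
      ultimately show ?thesis by simp
    qed
    ultimately have "residue (cs ! j) = \<zero>\<^bsub>residue_field v L\<^esub>" by blast
    moreover have "cs ! j \<in> valuation_ring v L" using cL j len(1) nth_mem[of j cs] by auto
    ultimately have "cs ! j \<in> valuation_ideal v L" using residue_zero_iff by blast
    then show "c j \<in> valuation_ideal v L" using j by (simp add: cs_def)
  qed
  then show ?thesis by blast
qed

lemma exists_residue_indep:
  "\<exists>n z. (n = residue_degree v K L \<or> n > B) \<and> residue_indep n z"
proof -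
  interpret S: field "residue_field v L" by (rule field_residue_field)
  let ?k = "residue_subfield v K L" and ?C = "carrier (residue_field v L)"
  note k = subfield_residue_subfield
  have "(\<exists>d. S.dimension d ?k ?C) \<or> (\<exists>us. S.independent ?k us \<and> length us = n)" for n
  proof (induction n)
    case 0
    then show ?case using S.li_Nil by auto
  next
    case (Suc n)
    then show ?case
    proof (elim disjE exE conjE)
      fix us assume us: "S.independent ?k us" "length us = n"
      show ?case
      proof (cases "S.Span ?k us = ?C")
        case True
        then show ?thesis using S.dimensionI[OF k us(1)] by blast
      next
        case False
        then obtain x where "x \<in> ?C" "x \<notin> S.Span ?k us"
          using S.Span_in_carrier[OF subfieldE(3)[OF k] S.independent_in_carrier[OF us(1)]] by blast
        then have "S.independent ?k (x # us)" using us(1) by (rule S.li_Cons)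
        then show ?thesis using us(2) by (intro disjI2 exI[of _ "x # us"]) simp
      qed
    qed blast
  qed
  from this[of "Suc B"] show ?thesis
  proof (elim disjE exE conjE)
    fix d assume d: "S.dimension d ?k ?C"
    then have "residue_degree v K L = d" using S.dimI[OF k] by (simp add: residue_degree_def)
    moreover obtain us where "S.independent ?k us" "length us = d" using S.exists_base[OF k d] by blast
    ultimately show ?thesis using residue_indep_of_independent by blast
  next
    fix us assume "S.independent ?k us" "length us = Suc B"
    then show ?thesis using residue_indep_of_independent[of us] by auto
  qed
qed

lemma exists_value_representatives:
  assumes "ramification_index v K L > 0"
  obtains u :: "nat \<Rightarrow> 'a" where "\<And>i. i < ramification_index v K L \<Longrightarrow> u i \<in> L \<and> u i \<noteq> 0"
    "\<And>i j. i < ramification_index v K L \<Longrightarrow> j < ramification_index v K L \<Longrightarrow>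
      v (u i) - v (u j) \<in> value_group v K \<Longrightarrow> i = j"
proof -
  let ?q = "\<lambda>g. (+) g ` value_group v K" and ?e = "ramification_index v K L"
  have fin: "finite (?q ` value_group v L)"
    using assms unfolding ramification_index_def by (rule card_ge_0_finite)
  then obtain h where h: "bij_betw h {..<?e} (?q ` value_group v L)"
    using ex_bij_betw_nat_finite[OF fin] unfolding ramification_index_def by (metis atLeast0LessThan)
  have "\<exists>x. x \<in> L \<and> x \<noteq> 0 \<and> ?q (v x) = h i" if "i < ?e" for i
  proof -
    have "h i \<in> ?q ` value_group v L" using h that by (auto simp: bij_betw_def)
    then show ?thesis by (auto simp: value_group_def)
  qed
  then obtain u where u: "\<And>i. i < ?e \<Longrightarrow> u i \<in> L \<and> u i \<noteq> 0 \<and> ?q (v (u i)) = h i" by metis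
  show ?thesis
  proof (rule that[of u])
    fix i j assume ij: "i < ?e" "j < ?e" "v (u i) - v (u j) \<in> value_group v K"
    have shift: "?q (v (u i)) \<subseteq> ?q (v (u j))" if d: "v (u i) - v (u j) \<in> value_group v K" for i j
    proof (clarify)
      fix g assume "g \<in> value_group v K"
      then obtain c where c: "c \<in> K" "c \<noteq> 0" "g = v c" by (auto simp: value_group_def)
      obtain b where b: "b \<in> K" "b \<noteq> 0" "v (u i) - v (u j) = v b" using d by (auto simp: value_group_def)
      have "v (b * c) \<in> value_group v K" using b c K.mult_mem by (auto simp: value_group_def)
      moreover have "v (u i) + g = v (u j) + v (b * c)"
        using b c by (simp add: v_mult diff_eq_eq algebra_simps)
      ultimately show "v (u i) + g \<in> ?q (v (u j))" by blast
    qed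
    have "v (u j) - v (u i) \<in> value_group v K"
    proof -
      obtain b where "b \<in> K" "b \<noteq> 0" "v (u i) - v (u j) = v b" using ij(3) by (auto simp: value_group_def)
      then have "v (inverse b) = v (u j) - v (u i)" "inverse b \<in> K - {0}"
        using K.inverse_mem by (auto simp: v_inverse algebra_simps)
      then show ?thesis unfolding value_group_def by (metis image_eqI)
    qed
    then have "?q (v (u i)) = ?q (v (u j))" using shift ij(3) by blast
    then have "h i = h j" using u ij by metis
    then show "i = j" using h ij by (auto simp: bij_betw_def inj_on_def)
  qed (use u in blast)
qed

text \<open>The products of elements of an immediate space, of representatives of \<open>vL\<close> modulo \<open>vK\<close> and of
  lifts of a basis of the residue field extension are independent: modulo terms of higher value the
  coefficients can be replaced by elements of \<open>K\<close>.\<close>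

lemma lin_indep_product:
  fixes w u z :: "nat \<Rightarrow> 'a"
  assumes W: "field_submodule K W" "W \<subseteq> L"
    and approx: "\<And>x. x \<in> W \<Longrightarrow> x \<noteq> 0 \<Longrightarrow> \<exists>d\<in>K. d \<noteq> 0 \<and> v d = v x \<and> val_gt (x - d) (v x)"
    and w: "lin_indep K {..<N} w" "w ` {..<N} \<subseteq> W"
    and u: "\<And>i. i < e \<Longrightarrow> u i \<in> L \<and> u i \<noteq> 0"
      "\<And>i j. i < e \<Longrightarrow> j < e \<Longrightarrow> v (u i) - v (u j) \<in> value_group v K \<Longrightarrow> i = j"
    and z: "residue_indep n z"
  shows "lin_indep K ({..<N} \<times> ({..<e} \<times> {..<n})) (\<lambda>(l, i, j). w l * (u i * z j))"
proof (rule lin_indepI)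
  interpret W: field_submodule K W by fact
  let ?I = "{..<e} \<times> {..<n}"
  have zL: "z j \<in> L" "val_ge (z j) 0" if "j < n" for j
    using z that by (auto simp: residue_indep_def valuation_ring_iff)
  show "finite ({..<N} \<times> ?I)" by simp
  fix c lij assume c: "\<And>lij. lij \<in> {..<N} \<times> ?I \<Longrightarrow> c lij \<in> K"
    and sum0: "(\<Sum>lij\<in>{..<N} \<times> ?I. c lij * (case lij of (l, i, j) \<Rightarrow> w l * (u i * z j))) = 0"
    and lij: "lij \<in> {..<N} \<times> ?I"
  define x where "x ij = (\<Sum>l<N. c (l, ij) * w l)" for ij
  define y where "y ij = (case ij of (i, j) \<Rightarrow> u i * z j)" for ij
  have xW: "x ij \<in> W" if "ij \<in> ?I" for ij
    unfolding x_def using that c w(2) by (intro W.W_sum W.W_scale) auto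
  have total: "(\<Sum>ij\<in>?I. x ij * y ij) = 0"
  proof -
    have "(\<Sum>ij\<in>?I. x ij * y ij) = (\<Sum>ij\<in>?I. \<Sum>l<N. c (l, ij) * (w l * y ij))"
      by (simp add: x_def sum_distrib_right mult.assoc)
    also have "\<dots> = (\<Sum>l<N. \<Sum>ij\<in>?I. c (l, ij) * (w l * y ij))" by (rule sum.swap)
    also have "\<dots> = (\<Sum>lij\<in>{..<N} \<times> ?I. c lij * (case lij of (l, ij) \<Rightarrow> w l * y ij))"
      by (simp add: sum.cartesian_product split_def)
    also have "\<dots> = 0" using sum0 by (simp add: y_def split_def)
    finally show ?thesis .
  qed
  have "x ij = 0" if "ij \<in> ?I" for ij
  proof (rule ccontr)
    assume "x ij \<noteq> 0"
    define P where "P = {ij \<in> ?I. x ij \<noteq> 0}"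
    have P: "finite P" "P \<noteq> {}" using that \<open>x ij \<noteq> 0\<close> by (auto simp: P_def)
    define Q where "Q ij d \<longleftrightarrow> d \<in> K \<and> d \<noteq> 0 \<and> v d = v (x ij) \<and> val_gt (x ij - d) (v (x ij))" for ij d
    \<comment> \<open>Leading terms: each nonzero coefficient \<open>x ij\<close> from
      \<open>W\<close> is replaced by an element of \<open>K\<close> up to higher value. The factor
      \<open>z j\<close> is left out of \<open>val\<close> below, as its value is
      nonnegative.\<close>
    define d where "d ij = (if x ij = 0 then 0 else SOME d. Q ij d)" for ij
    have dQ: "Q ij (d ij)" if "ij \<in> P" for ij
    proof -
      have ij: "ij \<in> ?I" "x ij \<noteq> 0" using that by (auto simp: P_def)
      then have "\<exists>d. Q ij d" using approx[OF xW[OF ij(1)] ij(2)] by (auto simp: Q_def)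
      then show ?thesis using ij(2) by (simp add: d_def someI_ex)
    qed
    have d: "\<And>ij. ij \<in> ?I \<Longrightarrow> d ij \<in> K" "\<And>ij. ij \<in> ?I \<Longrightarrow> x ij = 0 \<Longrightarrow> d ij = 0"
      "\<And>ij. ij \<in> P \<Longrightarrow> d ij \<noteq> 0 \<and> v (d ij) = v (x ij) \<and> val_gt (x ij - d ij) (v (x ij))"
    proof -
      show "d ij \<in> K" if "ij \<in> ?I" for ij
        using dQ[of ij] that by (cases "x ij = 0") (simp_all add: d_def[of ij] P_def Q_def)
      show "d ij = 0" if "x ij = 0" for ij using that by (simp add: d_def)
      show "d ij \<noteq> 0 \<and> v (d ij) = v (x ij) \<and> val_gt (x ij - d ij) (v (x ij))" if "ij \<in> P" for ij
        using dQ[OF that] by (simp add: Q_def)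
    qed
    define val where "val ij = v (d ij * u (fst ij))" for ij
    obtain ij0 where ij0: "ij0 \<in> P" and min: "\<And>ij. ij \<in> P \<Longrightarrow> val ij0 \<le> val ij"
      using ex_min_if_finite[of "val ` P"] P by (auto simp: not_less)
    obtain i0 j0 where ij0_eq: "ij0 = (i0, j0)" by (cases ij0)
    have i0: "i0 < e" "j0 < n" using ij0 by (auto simp: P_def ij0_eq)
    define \<mu> where "\<mu> = val ij0"
    have d0: "d ij0 \<noteq> 0" "d ij0 \<in> K" using d ij0 by (auto simp: P_def)
    have \<mu>: "\<mu> = v (d ij0) + v (u i0)" using d0 u(1)[OF i0(1)] by (simp add: \<mu>_def val_def ij0_eq v_mult)
    have small: "val_gt ((x ij - d ij) * y ij) \<mu>" if ij: "ij \<in> ?I" for ij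
    proof (cases "ij \<in> P")
      case True
      obtain i j where ij_eq: "ij = (i, j)" "i < e" "j < n" using ij by auto
      have "val_gt ((x ij - d ij) * u i) (v (x ij) + v (u i))"
        using d(3)[OF True] u(1)[OF ij_eq(2)] by (simp add: val_gt_times_iff)
      moreover have "\<mu> \<le> v (x ij) + v (u i)"
        using min[OF True] d(3)[OF True] u(1)[OF ij_eq(2)] by (simp add: \<mu>_def val_def ij_eq(1) v_mult)
      ultimately have "val_gt ((x ij - d ij) * u i) \<mu>" by (rule val_gt_mono)
      from val_gt_ge_mult[OF this zL(2)[OF ij_eq(3)]] show ?thesis
        by (simp add: y_def ij_eq(1) mult.assoc)
    next
      case False
      then show ?thesis using ij d(2) by (simp add: P_def)
    qed
    \<comment> \<open>Equal values for different indices would place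
      \<open>v (u i) - v (u i0)\<close> in \<open>vK\<close>.\<close>
    have other: "val_gt (d ij * y ij) \<mu>" if ij: "ij \<in> ?I" "fst ij \<noteq> i0" for ij
    proof (cases "ij \<in> P")
      case True
      obtain i j where ij_eq: "ij = (i, j)" "i < e" "j < n" "i \<noteq> i0" using ij by auto
      have "\<mu> \<noteq> v (d ij * u i)"
      proof
        assume "\<mu> = v (d ij * u i)"
        then have "v (u i) - v (u i0) = v (d ij0) - v (d ij)"
          unfolding \<mu> using d(3)[OF True] u(1)[OF ij_eq(2)] by (simp add: v_mult algebra_simps)
        also have "\<dots> = v (d ij0 / d ij)" using d0 d(3)[OF True] by (simp add: v_divide)
        also have "\<dots> \<in> value_group v K"
          using d0 d(1)[OF ij(1)] d(3)[OF True] K.divide_mem by (auto simp: value_group_def)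
        finally show False using u(2)[OF ij_eq(2) i0(1)] ij_eq(4) by simp
      qed
      then have "val_gt (d ij * u i) \<mu>"
        using min[OF True] by (simp add: \<mu>_def val_def ij_eq(1) val_gt_def less_le)
      from val_gt_ge_mult[OF this zL(2)[OF ij_eq(3)]] show ?thesis
        by (simp add: y_def ij_eq(1) mult.assoc)
    next
      case False
      then show ?thesis using ij d(2) by (simp add: P_def)
    qed
    \<comment> \<open>Within the class of \<open>i0\<close>, the leading coefficients divided by one
      of least value are integral and would form a relation between the residues of the
      \<open>z j\<close>; it is nontrivial because \<open>r j0 = 1\<close>.\<close>
    define r where "r j = d (i0, j) / d ij0" for j
    have rO: "r j \<in> valuation_ring v K" if j: "j < n" for j
    proof (cases "(i0, j) \<in> P")
      case True
      have "v (d ij0) \<le> v (d (i0, j))"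
        using min[OF True] d(3)[OF True] d0 u(1)[OF i0(1)] by (simp add: val_def ij0_eq v_mult)
      then show ?thesis
        using d(1)[of "(i0, j)"] d0 d(3)[OF True] i0(1) j K.divide_mem
        by (simp add: r_def valuation_ring_iff val_ge_def v_divide)
    next
      case False
      then have "d (i0, j) = 0" using d(2) i0(1) j by (simp add: P_def)
      then show ?thesis by (simp add: r_def valuation_ring_iff)
    qed
    have "r j0 = 1" using d0 by (simp add: r_def ij0_eq)
    then have "r j0 \<notin> valuation_ideal v L" by (simp add: valuation_ideal_iff val_gt_def)
    then have unit: "(\<Sum>j<n. r j * z j) \<notin> valuation_ideal v L"
      using z rO i0(2) by (auto simp: residue_indep_def)
    have sumL: "(\<Sum>j<n. r j * z j) \<in> L"
      using rO zL K_subset_L by (intro L.self.W_sum L.mult_mem) (auto simp: valuation_ring_iff)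
    have "val_gt ((\<Sum>j<n. r j * z j) * (d ij0 * u i0)) (0 + v (d ij0 * u i0))"
    proof -
      have "{ij \<in> ?I. fst ij = i0} = (\<lambda>j. (i0, j)) ` {..<n}" using i0(1) by auto
      then have "(\<Sum>ij\<in>{ij \<in> ?I. fst ij = i0}. d ij * y ij) = (\<Sum>j<n. d (i0, j) * y (i0, j))"
        by (simp add: sum.reindex inj_on_def)
      also have "\<dots> = (\<Sum>j<n. r j * z j) * (d ij0 * u i0)"
      proof -
        have "d (i0, j) = r j * d ij0" for j using d0 by (simp add: r_def)
        then show ?thesis
          unfolding sum_distrib_right by (intro sum.cong refl) (simp add: y_def mult_ac)
      qed
      finally have head: "(\<Sum>ij\<in>{ij \<in> ?I. fst ij = i0}. d ij * y ij) = (\<Sum>j<n. r j * z j) * (d ij0 * u i0)" .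
      have "?I = {ij \<in> ?I. fst ij = i0} \<union> {ij \<in> ?I. fst ij \<noteq> i0}" by auto
      then have "(\<Sum>ij\<in>?I. d ij * y ij) = (\<Sum>ij\<in>{ij \<in> ?I. fst ij = i0}. d ij * y ij) +
          (\<Sum>ij\<in>{ij \<in> ?I. fst ij \<noteq> i0}. d ij * y ij)"
        by (metis (no_types, lifting) sum.union_disjoint finite_Un finite_SigmaI finite_lessThan
            disjoint_iff mem_Collect_eq)
      moreover have "(\<Sum>ij\<in>?I. x ij * y ij) = (\<Sum>ij\<in>?I. d ij * y ij) + (\<Sum>ij\<in>?I. (x ij - d ij) * y ij)"
        by (simp add: sum.distrib[symmetric] algebra_simps)
      ultimately have "(\<Sum>j<n. r j * z j) * (d ij0 * u i0) +
          ((\<Sum>ij\<in>{ij \<in> ?I. fst ij \<noteq> i0}. d ij * y ij) + (\<Sum>ij\<in>?I. (x ij - d ij) * y ij)) = 0"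
        using total by (simp only: head add.assoc)
      then have "(\<Sum>j<n. r j * z j) * (d ij0 * u i0) =
          - ((\<Sum>ij\<in>{ij \<in> ?I. fst ij \<noteq> i0}. d ij * y ij) + (\<Sum>ij\<in>?I. (x ij - d ij) * y ij))"
        by (simp only: eq_neg_iff_add_eq_0)
      moreover have "val_gt (\<Sum>ij\<in>{ij \<in> ?I. fst ij \<noteq> i0}. d ij * y ij) \<mu>"
        using other by (intro val_gt_sum) auto
      moreover have "val_gt (\<Sum>ij\<in>?I. (x ij - d ij) * y ij) \<mu>"
        using small by (intro val_gt_sum) auto
      ultimately have "val_gt ((\<Sum>j<n. r j * z j) * (d ij0 * u i0)) \<mu>"
        by (simp only: val_gt_uminus val_gt_add)
      then show ?thesis using d0 u(1)[OF i0(1)] by (simp add: \<mu> v_mult)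
    qed
    then have "val_gt (\<Sum>j<n. r j * z j) 0"
      using d0 u(1)[OF i0(1)] by (subst (asm) val_gt_times_iff) auto
    then show False using unit sumL by (simp add: valuation_ideal_iff)
  qed
  moreover obtain l ij where lij_eq: "lij = (l, ij)" "l < N" "ij \<in> ?I" using lij by auto
  ultimately have "(\<Sum>l<N. c (l, ij) * w l) = 0" by (simp add: x_def)
  then show "c lij = 0"
    unfolding lij_eq(1) using lin_indepD[OF w(1), of "\<lambda>l. c (l, ij)" l] c lij_eq by auto
qed

text \<open>For \<open>N = 1\<close> this is the fundamental inequality; an immediate space
  contributes its dimension as a further factor, since it enlarges neither values nor
  residues.\<close>

lemma immediate_dimension_bound:
  assumes K: "subfield K (ambient :: 'a ring)" and fin: "ring.finite_dimension (ambient :: 'a ring) K L"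
    and W: "field_submodule K W" "W \<subseteq> L"
    and approx: "\<And>x. x \<in> W \<Longrightarrow> x \<noteq> 0 \<Longrightarrow> \<exists>d\<in>K. d \<noteq> 0 \<and> v d = v x \<and> val_gt (x - d) (v x)"
    and w: "lin_indep K {..<N} w" "w ` {..<N} \<subseteq> W" and "N > 0" and e: "ramification_index v K L > 0"
  shows "N * (ramification_index v K L * residue_degree v K L) \<le> field_degree K L"
proof -
  let ?e = "ramification_index v K L"
  obtain u :: "nat \<Rightarrow> 'a" where u: "\<And>i. i < ?e \<Longrightarrow> u i \<in> L \<and> u i \<noteq> 0"
    "\<And>i j. i < ?e \<Longrightarrow> j < ?e \<Longrightarrow> v (u i) - v (u j) \<in> value_group v K \<Longrightarrow> i = j"
    using exists_value_representatives[OF e] by blast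
  obtain n z where n: "n = residue_degree v K L \<or> n > field_degree K L" and z: "residue_indep n z"
    using exists_residue_indep by blast
  let ?x = "\<lambda>(l, i, j). w l * (u i * z j)" and ?I = "{..<N} \<times> ({..<?e} \<times> {..<n})"
  have ind: "lin_indep K ?I ?x" by (rule lin_indep_product[OF W approx w u z])
  obtain y :: "nat \<Rightarrow> 'a" where y: "lin_indep K {..<card ?I} y" "y ` {..<card ?I} = ?x ` ?I"
    by (rule lin_indep_nat[OF ind])
  have "?x ` ?I \<subseteq> L"
    using w(2) W(2) u(1) z by (auto simp: residue_indep_def valuation_ring_iff intro!: L.mult_mem)
  then have "card ?I \<le> field_degree K L"
    using lin_indep_le_field_degree[OF K fin y(1)] y(2) by simp
  then have bound: "N * (?e * n) \<le> field_degree K L" by (simp add: card_cartesian_product)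
  \<comment> \<open>This excludes the alternative \<open>n > field_degree K L\<close>.\<close>
  have "n \<le> N * (?e * n)" using \<open>N > 0\<close> e by simp
  then have "n = residue_degree v K L" using n bound by linarith
  then show ?thesis using bound by simp
qed

end

section \<open>Distances\<close>

context valued_field_over begin

lemma value_group_nat_sum: "g \<in> value_group v K \<Longrightarrow> (\<Sum>i<(n::nat). g) \<in> value_group v K"
  by (induction n) (auto intro: value_group_0 value_group_add)

lemma value_group_subset_divisible_hull: "value_group v K \<subseteq> divisible_hull v K"
  unfolding divisible_hull_def by (auto intro!: exI[of _ "1 :: nat"])

lemma divisible_hull_add:
  assumes "g \<in> divisible_hull v K" "h \<in> value_group v K"
  shows "g + h \<in> divisible_hull v K"
  using assms value_group_add[OF _ value_group_nat_sum[OF assms(2)]]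
  by (auto simp: divisible_hull_def sum.distrib)

text \<open>All values \<open>v (a - c)\<close> belong to \<open>vK\<close>, so the intersection
  with the divisible hull loses none of them.\<close>

lemma distance_eq:
  assumes a: "weakly_immediate v K a"
  shows "distance v K a = cut a \<inter> divisible_hull v K"
proof (intro equalityI subsetI)
  fix g assume "g \<in> distance v K a"
  moreover have "initial_segment (divisible_hull v K) (cut a \<inter> divisible_hull v K)"
    by (auto simp: initial_segment_def intro: cut_downward)
  moreover have "difference_values v K a \<inter> divisible_hull v K \<subseteq> cut a \<inter> divisible_hull v K"
    by (auto simp: difference_values_def intro: cut_memI)
  ultimately show "g \<in> cut a \<inter> divisible_hull v K" unfolding distance_def by blast
next
  fix g assume g: "g \<in> cut a \<inter> divisible_hull v K"
  then obtain c where c: "c \<in> K" "g \<le> v (a - c)" by (auto simp: cut_def)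
  obtain d where d: "d \<in> K" "d \<noteq> c" "v (d - c) = v (a - c)"
    using weakly_immediate_approx[OF a c(1)] by metis
  have "v (a - c) \<in> value_group v K" using value_groupI[of "d - c"] d c(1) K.minus_mem by simp
  then have "v (a - c) \<in> difference_values v K a \<inter> divisible_hull v K"
    using value_group_subset_divisible_hull c(1) by (auto simp: difference_values_def)
  then show "g \<in> distance v K a"
    using g c(2) unfolding distance_def initial_segment_def by blast
qed

lemma distance_shift:
  assumes "weakly_immediate v K a" "weakly_immediate v K b" "\<beta> \<in> value_group v K" "cut b = (+) \<beta> ` cut a"
  shows "distance v K b = shift_cut \<beta> (distance v K a)"
proof -
  have "\<beta> + g \<in> divisible_hull v K \<longleftrightarrow> g \<in> divisible_hull v K" for g
    using divisible_hull_add[of g \<beta>] divisible_hull_add[of "\<beta> + g" "- \<beta>"] assms(3)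
      value_group_uminus[OF assms(3)] by (auto simp: add.commute)
  then show ?thesis unfolding distance_eq[OF assms(1)] distance_eq[OF assms(2)] assms(4) shift_cut_def by auto
qed

text \<open>A largest family of pairwise inequivalent elements exists by the bound, and by
  maximality it represents every distance.\<close>

lemma ndd_le:
  assumes bound: "\<And>C. finite C \<Longrightarrow> C \<subseteq> L - K \<Longrightarrow> (\<And>a. a \<in> C \<Longrightarrow> weakly_immediate v K a) \<Longrightarrow>
    (\<And>a b. a \<in> C \<Longrightarrow> b \<in> C \<Longrightarrow> a \<noteq> b \<Longrightarrow> \<not> cut_equiv a b) \<Longrightarrow> card C \<le> m"
  shows "ndd v K L \<le> enat m"
proof -
  define P where "P C \<longleftrightarrow> finite C \<and> C \<subseteq> L - K \<and> (\<forall>a\<in>C. weakly_immediate v K a) \<and>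
    (\<forall>a\<in>C. \<forall>b\<in>C. a \<noteq> b \<longrightarrow> \<not> cut_equiv a b)" for C
  have P_le: "card C \<le> m" if "P C" for C
    using that unfolding P_def by (intro bound) auto
  have "P {}" by (simp add: P_def)
  then obtain C where C: "P C" and max: "\<And>C'. P C' \<Longrightarrow> card C' \<le> card C"
    using ex_has_greatest_nat[of P "{}" card "Suc m"] P_le le_imp_less_Suc by blast
  have fin: "finite C" using C by (simp add: P_def)
  have cover: "\<exists>a\<in>C. cut_equiv b a" if b: "b \<in> L - K" "weakly_immediate v K b" for b
  proof (rule ccontr)
    assume neg: "\<not> ?thesis"
    then have "b \<notin> C" using cut_equiv_refl by blast
    moreover have "P (insert b C)"
      using C b neg cut_equiv_sym unfolding P_def by (auto 4 3)
    ultimately show False using max[of "insert b C"] fin by simp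
  qed
  obtain h where h: "bij_betw h {1..card C} C"
    using ex_bij_betw_nat_finite_1[OF fin] by blast
  have "ndd v K L \<le> enat (card C)"
    unfolding ndd_def num_distances_def
  proof (rule Inf_lower, rule CollectI, intro exI conjI)
    show "enat (card C) = enat (card C)" ..
    show "\<forall>i\<in>{1..card C}. h i \<in> L - K \<and> weakly_immediate v K (h i)"
      using h C by (auto simp: bij_betw_def P_def)
    show "\<forall>b\<in>L - K. weakly_immediate v K b \<longrightarrow>
      (\<exists>i\<in>{1..card C}. \<exists>\<alpha>\<in>value_group v K. distance v K b = shift_cut \<alpha> (distance v K (h i)))"
    proof (intro ballI impI)
      fix b assume b: "b \<in> L - K" "weakly_immediate v K b"
      obtain a where a: "a \<in> C" "cut_equiv b a" using cover[OF b] by blast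
      then obtain i where i: "i \<in> {1..card C}" "a = h i" using bij_betw_imp_surj_on[OF h] by blast
      obtain \<beta> where \<beta>: "\<beta> \<in> value_group v K" "cut b = (+) \<beta> ` cut a" using a(2) by (auto simp: cut_equiv_def)
      have "weakly_immediate v K a" using C a(1) by (simp add: P_def)
      from distance_shift[OF this b(2) \<beta>] show "\<exists>i\<in>{1..card C}. \<exists>\<alpha>\<in>value_group v K.
          distance v K b = shift_cut \<alpha> (distance v K (h i))"
        using i \<beta>(1) by blast
    qed
  qed
  also have "\<dots> \<le> enat m" using P_le[OF C] by simp
  finally show ?thesis .
qed

text \<open>Representatives modulo \<open>vK\<close> are representatives modulo the divisible
  hull.\<close>

lemma ndd_star_le_ndd: "ndd_star v K L \<le> ndd v K L"
  unfolding ndd_def ndd_star_def num_distances_def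
proof (intro Inf_superset_mono Collect_mono impI, elim exE conjE)
  fix x n a
  assume "x = enat n" "\<forall>i\<in>{1..n}. a i \<in> L - K \<and> weakly_immediate v K (a i)"
    and cover: "\<forall>b\<in>L - K. weakly_immediate v K b \<longrightarrow>
      (\<exists>i\<in>{1..n}. \<exists>\<alpha>\<in>value_group v K. distance v K b = shift_cut \<alpha> (distance v K (a i)))"
  moreover have "\<forall>b\<in>L - K. weakly_immediate v K b \<longrightarrow>
      (\<exists>i\<in>{1..n}. \<exists>\<alpha>\<in>divisible_hull v K. distance v K b = shift_cut \<alpha> (distance v K (a i)))"
    using cover value_group_subset_divisible_hull by (meson subsetD)
  ultimately show "\<exists>n. x = enat n \<and> (\<exists>a. (\<forall>i\<in>{1..n}. a i \<in> L - K \<and> weakly_immediate v K (a i)) \<and>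
      (\<forall>b\<in>L - K. weakly_immediate v K b \<longrightarrow>
        (\<exists>i\<in>{1..n}. \<exists>\<alpha>\<in>divisible_hull v K. distance v K b = shift_cut \<alpha> (distance v K (a i)))))"
    by (intro exI[of _ n] conjI exI[of _ a])
qed

end

section \<open>Integers and the characteristic of the residue field\<close>

lemma add_pow_residue:
  assumes "valued_extension v K K"
  shows "add_pow (residue_field v K) (n :: nat) \<one>\<^bsub>residue_field v K\<^esub> =
      valuation_ideal v K +>\<^bsub>ambient\<lparr>carrier := valuation_ring v K\<rparr>\<^esub> of_nat n \<and>
    of_nat n \<in> valuation_ring v K"
proof -
  interpret valued_extension v K K by fact
  have one: "1 \<in> valuation_ring v K" by (simp add: valuation_ring_iff val_ge_def)
  have res1: "\<one>\<^bsub>residue_field v K\<^esub> = residue 1"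
    using ring_hom_one[OF ring_hom_ring.homh[OF residue_hom]] by simp
  show ?thesis
  proof (induction n)
    case 0
    have "(0 :: 'a) \<in> valuation_ring v K" "(0 :: 'a) \<in> valuation_ideal v K"
      by (simp_all add: valuation_ring_iff valuation_ideal_iff)
    then show ?case using residue_zero_iff[of 0] by (simp add: add_pow_def nat_pow_def)
  next
    case (Suc n)
    have "add_pow (residue_field v K) (Suc n) \<one>\<^bsub>residue_field v K\<^esub> =
      add_pow (residue_field v K) n \<one>\<^bsub>residue_field v K\<^esub> \<oplus>\<^bsub>residue_field v K\<^esub> \<one>\<^bsub>residue_field v K\<^esub>"
      by (simp add: add_pow_def nat_pow_def)
    also have "\<dots> = residue (of_nat n + 1)"
      using Suc.IH residue_add_mult(1)[of "of_nat n" 1] one unfolding res1 by simp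
    also have "of_nat n + 1 = of_nat (Suc n)" by (simp add: add.commute)
    finally show ?case
      using Suc.IH one by (auto simp: valuation_ring_iff K.add_mem val_ge_add)
  qed
qed

text \<open>By minimality of the characteristic, the residue of \<open>k\<close> is nonzero, which
  for an integral element means value 0.\<close>

lemma unit_below_characteristic_exponent:
  assumes "valued_extension v K K" "0 < k" "k < characteristic_exponent (residue_field v K)"
  shows "of_nat k \<noteq> (0 :: 'a::field) \<and> v (of_nat k :: 'a) = 0"
proof -
  interpret valued_extension v K K by fact
  let ?R = "residue_field v K"
  have char: "ring_characteristic ?R > 0" "k < ring_characteristic ?R"
    using assms(2,3) by (auto simp: characteristic_exponent_def split: if_splits)
  define T where "T n \<longleftrightarrow> n > 0 \<and> add_pow ?R n \<one>\<^bsub>?R\<^esub> = \<zero>\<^bsub>?R\<^esub>" for n :: nat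
  have "ring_characteristic ?R = (if \<exists>n. T n then LEAST n. T n else 0)"
    unfolding ring_characteristic_def T_def by simp
  then have "k < (LEAST n. T n)" using char by (simp split: if_splits)
  then have "\<not> T k" by (rule not_less_Least)
  then have "add_pow ?R k \<one>\<^bsub>?R\<^esub> \<noteq> \<zero>\<^bsub>?R\<^esub>" using assms(2) by (simp add: T_def)
  then have "of_nat k \<in> valuation_ring v K" "of_nat k \<notin> valuation_ideal v K"
    using add_pow_residue[OF assms(1), of k] residue_zero_iff[of "of_nat k"] by auto
  then show ?thesis
    by (auto simp: valuation_ring_iff valuation_ideal_iff val_ge_def val_gt_def)
qed

section \<open>From the defect to the three bounds\<close>

theorem theorem19:
  fixes K L :: "'a::alg_closed_field set"
    and v :: "'a \<Rightarrow> 'g::linordered_ab_group_add"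
    and p m :: nat
  assumes "algebraic_closure (ambient :: 'a ring) K"
    and "subfield L (ambient :: 'a ring)"
    and "K \<subseteq> L"
    and "ring.finite_dimension (ambient :: 'a ring) K L"
    and "valuation_on UNIV v"
    and "unique_extension v K L"
    and "p = characteristic_exponent (residue_field v K)"
    and "defect v K L = real p ^ m"
  shows "ereal_of_enat (ndd v K L) \<le> ereal (real m * (fact (field_degree K L) / real p ^ m)) \<and>
    ndd_star v K L \<le> enat m \<and>
    (normal_extension K L \<longrightarrow> ndd v K L \<le> enat (m * ramification_index v K L))"
proof -
  have K: "subfield K (ambient :: 'a ring)" using assms(1) by (rule algebraic_closure.axioms(2))
  interpret V: valued_field v by unfold_locales (rule assms(5))
  interpret K: field_subfield K by (rule field_subfield_of_subfield[OF K])
  interpret L: field_subfield L by (rule field_subfield_of_subfield[OF assms(2)])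
  interpret valued_field_over v K ..
  interpret E: valued_extension v K L by unfold_locales (rule assms(3))
  have KK: "valued_extension v K K" by unfold_locales simp
  let ?e = "ramification_index v K L" and ?f = "residue_degree v K L" and ?D = "field_degree K L"
  have p: "p > 0" by (simp add: assms(7) characteristic_exponent_def)
  \<comment> \<open>Division by zero would make the defect 0, but it is a power of a positive
    number. So both indices are positive; in particular \<open>vL/vK\<close> is finite.\<close>
  have "real ?e * real ?f \<noteq> 0"
  proof
    assume "real ?e * real ?f = 0"
    then have "defect v K L = 0" unfolding defect_def by (simp only: div_by_0)
    then show False using assms(8) p by simp
  qed
  then have ef: "?e > 0" "?f > 0" by simp_all
  then have "real ?D = real p ^ m * (real ?e * real ?f)"
    using assms(8) by (simp add: defect_def field_simps)
  then have D: "?D = p ^ m * (?e * ?f)" by (metis of_nat_eq_iff of_nat_mult of_nat_power)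
  \<comment> \<open>The value \<open>2\<close> for \<open>p = 1\<close> turns \<open>P ^ card C \<le> p ^ m\<close> into \<open>C = {}\<close>.\<close>
  define P where "P = max p 2"
  have unit: "of_nat k \<noteq> (0 :: 'a) \<and> v (of_nat k) = 0" if "0 < k" "k < P" for k
  proof (cases "k < p")
    case True
    then show ?thesis using unit_below_characteristic_exponent[OF KK that(1)] by (simp add: assms(7))
  next
    case False
    then have "k = 1" using that by (simp add: P_def)
    then show ?thesis by simp
  qed
  have ndd: "ndd v K L \<le> enat m"
  proof (rule ndd_le)
    fix C assume C: "finite C" "C \<subseteq> L - K" "\<And>a. a \<in> C \<Longrightarrow> weakly_immediate v K a"
      "\<And>a b. a \<in> C \<Longrightarrow> b \<in> C \<Longrightarrow> a \<noteq> b \<Longrightarrow> \<not> cut_equiv a b"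
    have "\<exists>W (w :: nat \<Rightarrow> 'a). immediate_space W \<and> W \<subseteq> L \<and>
        lin_indep K {..<P ^ card C} w \<and> w ` {..<P ^ card C} \<subseteq> W \<and> (\<forall>u\<in>W - K. \<exists>a\<in>C. cut_equiv u a)"
    proof (rule exists_immediate_space[OF C(1,3,4)])
      fix a assume "a \<in> C"
      then show "\<exists>A. coeffs_in K (\<Prod>x\<in>#A. [:- x, 1:]) \<and> a \<in># A \<and> (\<forall>x\<in>#A. \<forall>c\<in>K. v (x - c) = v (a - c))"
        using C(2) by (intro unique_extension_conjugates[OF assms(5) K assms(2,3,4,6)]) auto
    qed (use C(2) unit L.field_subring_axioms assms(3) in \<open>auto simp: P_def\<close>)
    then obtain W and w :: "nat \<Rightarrow> 'a" where W: "immediate_space W" "W \<subseteq> L"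
      and w: "lin_indep K {..<P ^ card C} w" "w ` {..<P ^ card C} \<subseteq> W" by blast
    have "P ^ card C * (?e * ?f) \<le> ?D"
    proof (rule E.immediate_dimension_bound[OF K assms(4) _ W(2) _ w _ ef(1)])
      show "field_submodule K W" using W(1) by (simp add: immediate_space_def)
      show "\<exists>d\<in>K. d \<noteq> 0 \<and> v d = v x \<and> V.val_gt (x - d) (v x)" if "x \<in> W" "x \<noteq> 0" for x
        using immediate_space_approx[OF W(1) that] by metis
      show "0 < P ^ card C" by (simp add: P_def less_max_iff_disj)
    qed
    then have le: "P ^ card C \<le> p ^ m" unfolding D using ef by simp
    show "card C \<le> m"
    proof (cases "p = 1")
      case True
      then have "P = 2" by (simp add: P_def)
      then have "2 ^ card C \<le> (1 :: nat)" using le True by (simp only: power_one)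
      then have "card C = 0" using one_less_power[of "2 :: nat" "card C"] by (cases "card C = 0") auto
      then show ?thesis by simp
    next
      case False
      then have "P = p" "1 < p" using p by (auto simp: P_def)
      then show ?thesis using le power_le_imp_le_exp by blast
    qed
  qed
  \<comment> \<open>Hence the factor \<open>fact ?D / real p ^ m\<close> is at least 1, and the
    first bound follows from \<open>ndd v K L \<le> enat m\<close>.\<close>
  have "p ^ m \<le> ?D" using D ef by simp
  also have "?D \<le> fact ?D" by (rule fact_ge_self)
  finally have "real (p ^ m) \<le> fact ?D" by (metis of_nat_fact of_nat_le_iff)
  then have "1 \<le> fact ?D / real p ^ m" using p by simp
  then have "real m \<le> real m * (fact ?D / real p ^ m)"
    using mult_left_mono[of 1 "fact ?D / real p ^ m" "real m"] by simp
  moreover have "ereal_of_enat (ndd v K L) \<le> ereal (real m)"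
    using ndd ereal_of_enat_le_iff[of "ndd v K L" "enat m"] by simp
  ultimately have "ereal_of_enat (ndd v K L) \<le> ereal (real m * (fact ?D / real p ^ m))"
    by (meson ereal_less_eq(3) order_trans)
  moreover have "ndd_star v K L \<le> enat m" using ndd_star_le_ndd ndd by (rule order_trans)
  moreover have "enat m \<le> enat (m * ?e)" using ef(1) by simp
  ultimately show ?thesis using ndd order_trans by blast
qed

end
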